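(* Let $\Bbbk$ be an algebraically closed field. Every finite, $\Bbbk$-linear, pivotal tensor category is equivalent (as a category) to the category of finite-dimensional modules over a finite-dimensional Frobenius $\Bbbk$-algebra.
   Context: A finite $\Bbbk$-linear tensor category is a $\Bbbk$-linear abelian monoidal category with $\Bbbk$-bilinear tensor product in which every object has left and right duals, $\operatorname{End}(\mathbf 1)=\Bbbk$ for the unit object $\mathbf 1$, all hom-spaces are finite-dimensional, every object has finite length, there are enough projectives (every object has a projective cover), and there are finitely many isomorphism classes of simple objects. It is pivotal if it is equipped with left and right dualities having the same dual objects $V^*$, for which the left and right duals of each morphism coincide and the two canonical isomorphisms $W^*\otimes V^*\to(V\otimes W)^*$ coincide. A finite-dimensional algebra $A$ is Frobenius if it admits a $\Bbbk$-linear map $\mathsf{t}:A\to\Bbbk$ such that the pairing $(a,b)\mapsto\mathsf{t}(ab)$ on $A$ is non-degenerate. *)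

theory Defs
  imports "HOL-Algebra.Algebra"
begin

(* HOL-Algebra reads a bare X as the polynomial indeterminate; here it is an object variable. *)
no_notation var (\<open>X\<index>\<close>)

section \<open>Linear categories\<close>

text \<open>
  A category with hom-spaces over a scalar ring. Each \<^term>\<open>Hom C X Y\<close> is a module record, whose
  \<open>mult\<close> and \<open>one\<close> fields carry no meaning (as usual for modules in HOL-Algebra).
  Hom-sets of distinct pairs of objects are disjoint, so that composition needs no object indices.
\<close>

record ('k, 'o, 'm) lincat =
  Obj :: "'o set"
  Hom :: "'o \<Rightarrow> 'o \<Rightarrow> ('k, 'm) module"
  Ident :: "'o \<Rightarrow> 'm"
  Comp :: "'m \<Rightarrow> 'm \<Rightarrow> 'm"  (infixr \<open>\<bullet>\<index>\<close> 70)

abbreviation mor :: "('k, 'o, 'm, 'z) lincat_scheme \<Rightarrow> 'o \<Rightarrow> 'o \<Rightarrow> 'm set" where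
  "mor C X Y \<equiv> carrier (Hom C X Y)"

locale category =
  fixes C :: "('k, 'o, 'm, 'z) lincat_scheme" (structure)
  assumes mor_disjoint:
      "\<lbrakk> X \<in> Obj C; Y \<in> Obj C; X' \<in> Obj C; Y' \<in> Obj C; f \<in> mor C X Y; f \<in> mor C X' Y' \<rbrakk>
        \<Longrightarrow> X = X' \<and> Y = Y'"
    and ident_mor: "X \<in> Obj C \<Longrightarrow> Ident C X \<in> mor C X X"
    and comp_mor:
      "\<lbrakk> X \<in> Obj C; Y \<in> Obj C; Z \<in> Obj C; f \<in> mor C X Y; g \<in> mor C Y Z \<rbrakk> \<Longrightarrow> g \<bullet> f \<in> mor C X Z"
    and comp_ident_left: "\<lbrakk> X \<in> Obj C; Y \<in> Obj C; f \<in> mor C X Y \<rbrakk> \<Longrightarrow> Ident C Y \<bullet> f = f"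
    and comp_ident_right: "\<lbrakk> X \<in> Obj C; Y \<in> Obj C; f \<in> mor C X Y \<rbrakk> \<Longrightarrow> f \<bullet> Ident C X = f"
    and comp_assoc:
      "\<lbrakk> W \<in> Obj C; X \<in> Obj C; Y \<in> Obj C; Z \<in> Obj C;
         f \<in> mor C W X; g \<in> mor C X Y; h \<in> mor C Y Z \<rbrakk> \<Longrightarrow> (h \<bullet> g) \<bullet> f = h \<bullet> (g \<bullet> f)"

definition is_iso :: "('k, 'o, 'm, 'z) lincat_scheme \<Rightarrow> 'o \<Rightarrow> 'o \<Rightarrow> 'm \<Rightarrow> bool" where
  "is_iso C X Y f \<longleftrightarrow> f \<in> mor C X Y \<and>
     (\<exists>g \<in> mor C Y X. g \<bullet>\<^bsub>C\<^esub> f = Ident C X \<and> f \<bullet>\<^bsub>C\<^esub> g = Ident C Y)"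

definition isomorphic :: "('k, 'o, 'm, 'z) lincat_scheme \<Rightarrow> 'o \<Rightarrow> 'o \<Rightarrow> bool" where
  "isomorphic C X Y \<longleftrightarrow> (\<exists>f. is_iso C X Y f)"

text \<open>The inverse of an isomorphism; it is unique since hom-sets are disjoint.\<close>

definition minv :: "('k, 'o, 'm, 'z) lincat_scheme \<Rightarrow> 'm \<Rightarrow> 'm" where
  "minv C f = (THE g. \<exists>X \<in> Obj C. \<exists>Y \<in> Obj C. f \<in> mor C X Y \<and> g \<in> mor C Y X \<and>
                 g \<bullet>\<^bsub>C\<^esub> f = Ident C X \<and> f \<bullet>\<^bsub>C\<^esub> g = Ident C Y)"

definition is_mono :: "('k, 'o, 'm, 'z) lincat_scheme \<Rightarrow> 'o \<Rightarrow> 'o \<Rightarrow> 'm \<Rightarrow> bool" where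
  "is_mono C X Y f \<longleftrightarrow> f \<in> mor C X Y \<and>
     (\<forall>W \<in> Obj C. \<forall>g \<in> mor C W X. \<forall>h \<in> mor C W X. f \<bullet>\<^bsub>C\<^esub> g = f \<bullet>\<^bsub>C\<^esub> h \<longrightarrow> g = h)"

definition is_epi :: "('k, 'o, 'm, 'z) lincat_scheme \<Rightarrow> 'o \<Rightarrow> 'o \<Rightarrow> 'm \<Rightarrow> bool" where
  "is_epi C X Y f \<longleftrightarrow> f \<in> mor C X Y \<and>
     (\<forall>Z \<in> Obj C. \<forall>g \<in> mor C Y Z. \<forall>h \<in> mor C Y Z. g \<bullet>\<^bsub>C\<^esub> f = h \<bullet>\<^bsub>C\<^esub> f \<longrightarrow> g = h)"

definition is_zero_object :: "('k, 'o, 'm, 'z) lincat_scheme \<Rightarrow> 'o \<Rightarrow> bool" where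
  "is_zero_object C Z \<longleftrightarrow> Z \<in> Obj C \<and>
     (\<forall>X \<in> Obj C. (\<exists>!f. f \<in> mor C X Z) \<and> (\<exists>!f. f \<in> mor C Z X))"

locale linear_category = field K + category C
  for K :: "('k, 'r) ring_scheme" and C :: "('k, 'o, 'm, 'z) lincat_scheme" (structure) +
  assumes hom_module: "\<lbrakk> X \<in> Obj C; Y \<in> Obj C \<rbrakk> \<Longrightarrow> module K (Hom C X Y)"
    and comp_add_left:
      "\<lbrakk> X \<in> Obj C; Y \<in> Obj C; Z \<in> Obj C; f \<in> mor C X Y; g \<in> mor C Y Z; h \<in> mor C Y Z \<rbrakk>
        \<Longrightarrow> (g \<oplus>\<^bsub>Hom C Y Z\<^esub> h) \<bullet> f = (g \<bullet> f) \<oplus>\<^bsub>Hom C X Z\<^esub> (h \<bullet> f)"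
    and comp_add_right:
      "\<lbrakk> X \<in> Obj C; Y \<in> Obj C; Z \<in> Obj C; f \<in> mor C X Y; g \<in> mor C X Y; h \<in> mor C Y Z \<rbrakk>
        \<Longrightarrow> h \<bullet> (f \<oplus>\<^bsub>Hom C X Y\<^esub> g) = (h \<bullet> f) \<oplus>\<^bsub>Hom C X Z\<^esub> (h \<bullet> g)"
    and comp_smult_left:
      "\<lbrakk> X \<in> Obj C; Y \<in> Obj C; Z \<in> Obj C; c \<in> carrier K; f \<in> mor C X Y; g \<in> mor C Y Z \<rbrakk>
        \<Longrightarrow> (c \<odot>\<^bsub>Hom C Y Z\<^esub> g) \<bullet> f = c \<odot>\<^bsub>Hom C X Z\<^esub> (g \<bullet> f)"
    and comp_smult_right:
      "\<lbrakk> X \<in> Obj C; Y \<in> Obj C; Z \<in> Obj C; c \<in> carrier K; f \<in> mor C X Y; g \<in> mor C Y Z \<rbrakk>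
        \<Longrightarrow> g \<bullet> (c \<odot>\<^bsub>Hom C X Y\<^esub> f) = c \<odot>\<^bsub>Hom C X Z\<^esub> (g \<bullet> f)"


section \<open>Abelian categories\<close>

definition is_kernel ::
    "('k, 'o, 'm, 'z) lincat_scheme \<Rightarrow> 'o \<Rightarrow> 'o \<Rightarrow> 'm \<Rightarrow> 'o \<Rightarrow> 'm \<Rightarrow> bool" where
  "is_kernel C X Y f N i \<longleftrightarrow> N \<in> Obj C \<and> i \<in> mor C N X \<and> f \<bullet>\<^bsub>C\<^esub> i = \<zero>\<^bsub>Hom C N Y\<^esub> \<and>
     (\<forall>W \<in> Obj C. \<forall>g \<in> mor C W X. f \<bullet>\<^bsub>C\<^esub> g = \<zero>\<^bsub>Hom C W Y\<^esub> \<longrightarrow>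
        (\<exists>!u. u \<in> mor C W N \<and> i \<bullet>\<^bsub>C\<^esub> u = g))"

definition is_cokernel ::
    "('k, 'o, 'm, 'z) lincat_scheme \<Rightarrow> 'o \<Rightarrow> 'o \<Rightarrow> 'm \<Rightarrow> 'o \<Rightarrow> 'm \<Rightarrow> bool" where
  "is_cokernel C X Y f Q p \<longleftrightarrow> Q \<in> Obj C \<and> p \<in> mor C Y Q \<and> p \<bullet>\<^bsub>C\<^esub> f = \<zero>\<^bsub>Hom C X Q\<^esub> \<and>
     (\<forall>W \<in> Obj C. \<forall>g \<in> mor C Y W. g \<bullet>\<^bsub>C\<^esub> f = \<zero>\<^bsub>Hom C X W\<^esub> \<longrightarrow>
        (\<exists>!u. u \<in> mor C Q W \<and> u \<bullet>\<^bsub>C\<^esub> p = g))"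

definition is_direct_sum ::
    "('k, 'o, 'm, 'z) lincat_scheme \<Rightarrow> 'o \<Rightarrow> 'o \<Rightarrow> 'o \<Rightarrow> 'm \<Rightarrow> 'm \<Rightarrow> 'm \<Rightarrow> 'm \<Rightarrow> bool" where
  "is_direct_sum C X Y S i\<^sub>1 i\<^sub>2 p\<^sub>1 p\<^sub>2 \<longleftrightarrow> S \<in> Obj C \<and>
     i\<^sub>1 \<in> mor C X S \<and> i\<^sub>2 \<in> mor C Y S \<and> p\<^sub>1 \<in> mor C S X \<and> p\<^sub>2 \<in> mor C S Y \<and>
     p\<^sub>1 \<bullet>\<^bsub>C\<^esub> i\<^sub>1 = Ident C X \<and> p\<^sub>2 \<bullet>\<^bsub>C\<^esub> i\<^sub>2 = Ident C Y \<and>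
     p\<^sub>1 \<bullet>\<^bsub>C\<^esub> i\<^sub>2 = \<zero>\<^bsub>Hom C Y X\<^esub> \<and> p\<^sub>2 \<bullet>\<^bsub>C\<^esub> i\<^sub>1 = \<zero>\<^bsub>Hom C X Y\<^esub> \<and>
     (i\<^sub>1 \<bullet>\<^bsub>C\<^esub> p\<^sub>1) \<oplus>\<^bsub>Hom C S S\<^esub> (i\<^sub>2 \<bullet>\<^bsub>C\<^esub> p\<^sub>2) = Ident C S"

locale abelian_linear_category = linear_category +
  assumes zero_object: "\<exists>Z. is_zero_object C Z"
    and direct_sums:
      "\<lbrakk> X \<in> Obj C; Y \<in> Obj C \<rbrakk> \<Longrightarrow> \<exists>S i\<^sub>1 i\<^sub>2 p\<^sub>1 p\<^sub>2. is_direct_sum C X Y S i\<^sub>1 i\<^sub>2 p\<^sub>1 p\<^sub>2"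
    and kernels: "\<lbrakk> X \<in> Obj C; Y \<in> Obj C; f \<in> mor C X Y \<rbrakk> \<Longrightarrow> \<exists>N i. is_kernel C X Y f N i"
    and cokernels: "\<lbrakk> X \<in> Obj C; Y \<in> Obj C; f \<in> mor C X Y \<rbrakk> \<Longrightarrow> \<exists>Q p. is_cokernel C X Y f Q p"
    and mono_normal:
      "\<lbrakk> X \<in> Obj C; Y \<in> Obj C; is_mono C X Y f \<rbrakk>
        \<Longrightarrow> \<exists>Z \<in> Obj C. \<exists>g \<in> mor C Y Z. is_kernel C Y Z g X f"
    and epi_normal:
      "\<lbrakk> X \<in> Obj C; Y \<in> Obj C; is_epi C X Y f \<rbrakk>
        \<Longrightarrow> \<exists>W \<in> Obj C. \<exists>g \<in> mor C W X. is_cokernel C W X g Y f"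


section \<open>Finiteness conditions\<close>

definition finite_dimensional :: "('k, 'r) ring_scheme \<Rightarrow> ('k, 'v, 's) module_scheme \<Rightarrow> bool" where
  "finite_dimensional K V \<longleftrightarrow>
     (\<exists>B. finite B \<and> B \<subseteq> carrier V \<and>
        (\<forall>v \<in> carrier V. \<exists>c \<in> B \<rightarrow> carrier K. v = (\<Oplus>\<^bsub>V\<^esub>b \<in> B. c b \<odot>\<^bsub>V\<^esub> b)))"

definition is_simple :: "('k, 'o, 'm, 'z) lincat_scheme \<Rightarrow> 'o \<Rightarrow> bool" where
  "is_simple C S \<longleftrightarrow> S \<in> Obj C \<and> \<not> is_zero_object C S \<and>
     (\<forall>Y \<in> Obj C. \<forall>f. is_mono C Y S f \<longrightarrow> is_zero_object C Y \<or> is_iso C Y S f)"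

text \<open>Existence of a composition series \<open>0 = Y 0 \<hookrightarrow> Y 1 \<hookrightarrow> \<dots> \<hookrightarrow> Y n = X\<close> with simple quotients.\<close>

definition has_finite_length :: "('k, 'o, 'm, 'z) lincat_scheme \<Rightarrow> 'o \<Rightarrow> bool" where
  "has_finite_length C X \<longleftrightarrow>
     (\<exists>n (Y :: nat \<Rightarrow> 'o) (i :: nat \<Rightarrow> 'm). (\<forall>j \<le> n. Y j \<in> Obj C) \<and> is_zero_object C (Y 0) \<and> Y n = X \<and>
        (\<forall>j < n. is_mono C (Y j) (Y (Suc j)) (i j) \<and>
           (\<exists>S p. is_cokernel C (Y j) (Y (Suc j)) (i j) S p \<and> is_simple C S)))"

definition is_projective :: "('k, 'o, 'm, 'z) lincat_scheme \<Rightarrow> 'o \<Rightarrow> bool" where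
  "is_projective C P \<longleftrightarrow> P \<in> Obj C \<and>
     (\<forall>X \<in> Obj C. \<forall>Y \<in> Obj C. \<forall>e. is_epi C X Y e \<longrightarrow>
        (\<forall>f \<in> mor C P Y. \<exists>g \<in> mor C P X. e \<bullet>\<^bsub>C\<^esub> g = f))"

definition is_projective_cover ::
    "('k, 'o, 'm, 'z) lincat_scheme \<Rightarrow> 'o \<Rightarrow> 'o \<Rightarrow> 'm \<Rightarrow> bool" where
  "is_projective_cover C X P p \<longleftrightarrow> is_projective C P \<and> is_epi C P X p \<and>
     (\<forall>Y \<in> Obj C. \<forall>g \<in> mor C Y P. is_epi C Y X (p \<bullet>\<^bsub>C\<^esub> g) \<longrightarrow> is_epi C Y P g)"

locale finite_linear_category = abelian_linear_category +
  assumes hom_finite_dimensional: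
      "\<lbrakk> X \<in> Obj C; Y \<in> Obj C \<rbrakk> \<Longrightarrow> finite_dimensional K (Hom C X Y)"
    and finite_length: "X \<in> Obj C \<Longrightarrow> has_finite_length C X"
    and projective_covers: "X \<in> Obj C \<Longrightarrow> \<exists>P p. is_projective_cover C X P p"
    and finitely_many_simples:
      "\<exists>F. finite F \<and> F \<subseteq> Obj C \<and> (\<forall>S. is_simple C S \<longrightarrow> (\<exists>T \<in> F. isomorphic C S T))"


section \<open>Monoidal categories and duality\<close>

text \<open>
  The structure is not assumed strict: \<open>Assoc C X Y Z : (X \<boxtimes> Y) \<boxtimes> Z \<rightarrow> X \<boxtimes> (Y \<boxtimes> Z)\<close>,
  \<open>LUnitor C X : 1 \<boxtimes> X \<rightarrow> X\<close> and \<open>RUnitor C X : X \<boxtimes> 1 \<rightarrow> X\<close>.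
\<close>

record ('k, 'o, 'm) moncat = "('k, 'o, 'm) lincat" +
  Tens :: "'o \<Rightarrow> 'o \<Rightarrow> 'o"  (infixl \<open>\<boxtimes>\<index>\<close> 75)
  TensM :: "'m \<Rightarrow> 'm \<Rightarrow> 'm"  (infixl \<open>\<star>\<index>\<close> 75)
  TUnit :: "'o"
  Assoc :: "'o \<Rightarrow> 'o \<Rightarrow> 'o \<Rightarrow> 'm"
  LUnitor :: "'o \<Rightarrow> 'm"
  RUnitor :: "'o \<Rightarrow> 'm"

locale monoidal_category = category C
  for C :: "('k, 'o, 'm, 'z) moncat_scheme" (structure) +
  assumes tens_obj: "\<lbrakk> X \<in> Obj C; Y \<in> Obj C \<rbrakk> \<Longrightarrow> X \<boxtimes> Y \<in> Obj C"
    and unit_obj: "TUnit C \<in> Obj C"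
    and tens_mor:
      "\<lbrakk> X \<in> Obj C; Y \<in> Obj C; X' \<in> Obj C; Y' \<in> Obj C; f \<in> mor C X X'; g \<in> mor C Y Y' \<rbrakk>
        \<Longrightarrow> f \<star> g \<in> mor C (X \<boxtimes> Y) (X' \<boxtimes> Y')"
    and tens_ident:
      "\<lbrakk> X \<in> Obj C; Y \<in> Obj C \<rbrakk> \<Longrightarrow> Ident C X \<star> Ident C Y = Ident C (X \<boxtimes> Y)"
    and tens_comp:
      "\<lbrakk> X \<in> Obj C; Y \<in> Obj C; X' \<in> Obj C; Y' \<in> Obj C; X'' \<in> Obj C; Y'' \<in> Obj C;
         f \<in> mor C X X'; g \<in> mor C Y Y'; f' \<in> mor C X' X''; g' \<in> mor C Y' Y'' \<rbrakk>
        \<Longrightarrow> (f' \<bullet> f) \<star> (g' \<bullet> g) = (f' \<star> g') \<bullet> (f \<star> g)"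
    and assoc_iso:
      "\<lbrakk> X \<in> Obj C; Y \<in> Obj C; Z \<in> Obj C \<rbrakk>
        \<Longrightarrow> is_iso C ((X \<boxtimes> Y) \<boxtimes> Z) (X \<boxtimes> (Y \<boxtimes> Z)) (Assoc C X Y Z)"
    and assoc_natural:
      "\<lbrakk> X \<in> Obj C; Y \<in> Obj C; Z \<in> Obj C; X' \<in> Obj C; Y' \<in> Obj C; Z' \<in> Obj C;
         f \<in> mor C X X'; g \<in> mor C Y Y'; h \<in> mor C Z Z' \<rbrakk>
        \<Longrightarrow> Assoc C X' Y' Z' \<bullet> ((f \<star> g) \<star> h) = (f \<star> (g \<star> h)) \<bullet> Assoc C X Y Z"
    and lunitor_iso: "X \<in> Obj C \<Longrightarrow> is_iso C (TUnit C \<boxtimes> X) X (LUnitor C X)"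
    and lunitor_natural:
      "\<lbrakk> X \<in> Obj C; Y \<in> Obj C; f \<in> mor C X Y \<rbrakk>
        \<Longrightarrow> LUnitor C Y \<bullet> (Ident C (TUnit C) \<star> f) = f \<bullet> LUnitor C X"
    and runitor_iso: "X \<in> Obj C \<Longrightarrow> is_iso C (X \<boxtimes> TUnit C) X (RUnitor C X)"
    and runitor_natural:
      "\<lbrakk> X \<in> Obj C; Y \<in> Obj C; f \<in> mor C X Y \<rbrakk>
        \<Longrightarrow> RUnitor C Y \<bullet> (f \<star> Ident C (TUnit C)) = f \<bullet> RUnitor C X"
    and pentagon:
      "\<lbrakk> W \<in> Obj C; X \<in> Obj C; Y \<in> Obj C; Z \<in> Obj C \<rbrakk>
        \<Longrightarrow> Assoc C W X (Y \<boxtimes> Z) \<bullet> Assoc C (W \<boxtimes> X) Y Z =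
            (Ident C W \<star> Assoc C X Y Z) \<bullet> Assoc C W (X \<boxtimes> Y) Z \<bullet> (Assoc C W X Y \<star> Ident C Z)"
    and triangle:
      "\<lbrakk> X \<in> Obj C; Y \<in> Obj C \<rbrakk>
        \<Longrightarrow> (Ident C X \<star> LUnitor C Y) \<bullet> Assoc C X (TUnit C) Y = RUnitor C X \<star> Ident C Y"

text \<open>
  \<open>X'\<close> is a left dual of \<open>X\<close> (equivalently, \<open>X\<close> is a right dual of \<open>X'\<close>) by means of
  \<open>e : X' \<boxtimes> X \<rightarrow> 1\<close> and \<open>d : 1 \<rightarrow> X \<boxtimes> X'\<close>, subject to the zigzag identities.
\<close>

definition is_duality ::
    "('k, 'o, 'm, 'z) moncat_scheme \<Rightarrow> 'o \<Rightarrow> 'o \<Rightarrow> 'm \<Rightarrow> 'm \<Rightarrow> bool" where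
  "is_duality C X' X e d \<longleftrightarrow> X' \<in> Obj C \<and> X \<in> Obj C \<and>
     e \<in> mor C (X' \<boxtimes>\<^bsub>C\<^esub> X) (TUnit C) \<and> d \<in> mor C (TUnit C) (X \<boxtimes>\<^bsub>C\<^esub> X') \<and>
     RUnitor C X \<bullet>\<^bsub>C\<^esub> (Ident C X \<star>\<^bsub>C\<^esub> e) \<bullet>\<^bsub>C\<^esub> Assoc C X X' X \<bullet>\<^bsub>C\<^esub> (d \<star>\<^bsub>C\<^esub> Ident C X) \<bullet>\<^bsub>C\<^esub> minv C (LUnitor C X)
       = Ident C X \<and>
     LUnitor C X' \<bullet>\<^bsub>C\<^esub> (e \<star>\<^bsub>C\<^esub> Ident C X') \<bullet>\<^bsub>C\<^esub> minv C (Assoc C X' X X') \<bullet>\<^bsub>C\<^esub> (Ident C X' \<star>\<^bsub>C\<^esub> d)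
         \<bullet>\<^bsub>C\<^esub> minv C (RUnitor C X')
       = Ident C X'"

locale finite_tensor_category = finite_linear_category K C + monoidal_category C
  for K :: "('k, 'r) ring_scheme" and C :: "('k, 'o, 'm, 'z) moncat_scheme" (structure) +
  assumes tens_add_left:
      "\<lbrakk> X \<in> Obj C; Y \<in> Obj C; X' \<in> Obj C; Y' \<in> Obj C;
         f \<in> mor C X X'; f' \<in> mor C X X'; g \<in> mor C Y Y' \<rbrakk>
        \<Longrightarrow> (f \<oplus>\<^bsub>Hom C X X'\<^esub> f') \<star> g = (f \<star> g) \<oplus>\<^bsub>Hom C (X \<boxtimes> Y) (X' \<boxtimes> Y')\<^esub> (f' \<star> g)"
    and tens_add_right:
      "\<lbrakk> X \<in> Obj C; Y \<in> Obj C; X' \<in> Obj C; Y' \<in> Obj C;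
         f \<in> mor C X X'; g \<in> mor C Y Y'; g' \<in> mor C Y Y' \<rbrakk>
        \<Longrightarrow> f \<star> (g \<oplus>\<^bsub>Hom C Y Y'\<^esub> g') = (f \<star> g) \<oplus>\<^bsub>Hom C (X \<boxtimes> Y) (X' \<boxtimes> Y')\<^esub> (f \<star> g')"
    and tens_smult_left:
      "\<lbrakk> X \<in> Obj C; Y \<in> Obj C; X' \<in> Obj C; Y' \<in> Obj C;
         c \<in> carrier K; f \<in> mor C X X'; g \<in> mor C Y Y' \<rbrakk>
        \<Longrightarrow> (c \<odot>\<^bsub>Hom C X X'\<^esub> f) \<star> g = c \<odot>\<^bsub>Hom C (X \<boxtimes> Y) (X' \<boxtimes> Y')\<^esub> (f \<star> g)"
    and tens_smult_right:
      "\<lbrakk> X \<in> Obj C; Y \<in> Obj C; X' \<in> Obj C; Y' \<in> Obj C;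
         c \<in> carrier K; f \<in> mor C X X'; g \<in> mor C Y Y' \<rbrakk>
        \<Longrightarrow> f \<star> (c \<odot>\<^bsub>Hom C Y Y'\<^esub> g) = c \<odot>\<^bsub>Hom C (X \<boxtimes> Y) (X' \<boxtimes> Y')\<^esub> (f \<star> g)"
    and left_duals: "X \<in> Obj C \<Longrightarrow> \<exists>X' e d. is_duality C X' X e d"
    and right_duals: "X \<in> Obj C \<Longrightarrow> \<exists>X' e d. is_duality C X X' e d"
    and end_unit:
      "bij_betw (\<lambda>c. c \<odot>\<^bsub>Hom C (TUnit C) (TUnit C)\<^esub> Ident C (TUnit C))
         (carrier K) (mor C (TUnit C) (TUnit C))"

text \<open>
  A choice of dual objects \<open>V\<^sup>*\<close> with a left duality \<open>LEv V : V\<^sup>* \<boxtimes> V \<rightarrow> 1\<close>, \<open>LCoev V : 1 \<rightarrow> V \<boxtimes> V\<^sup>*\<close>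
  and a right duality \<open>REv V : V \<boxtimes> V\<^sup>* \<rightarrow> 1\<close>, \<open>RCoev V : 1 \<rightarrow> V\<^sup>* \<boxtimes> V\<close>.
\<close>

record ('k, 'o, 'm) pivcat = "('k, 'o, 'm) moncat" +
  Dual :: "'o \<Rightarrow> 'o"
  LEv :: "'o \<Rightarrow> 'm"
  LCoev :: "'o \<Rightarrow> 'm"
  REv :: "'o \<Rightarrow> 'm"
  RCoev :: "'o \<Rightarrow> 'm"

definition left_dual_mor :: "('k, 'o, 'm, 'z) pivcat_scheme \<Rightarrow> 'o \<Rightarrow> 'o \<Rightarrow> 'm \<Rightarrow> 'm" where
  "left_dual_mor C V W f =
     LUnitor C (Dual C V)
     \<bullet>\<^bsub>C\<^esub> (LEv C W \<star>\<^bsub>C\<^esub> Ident C (Dual C V))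
     \<bullet>\<^bsub>C\<^esub> minv C (Assoc C (Dual C W) W (Dual C V))
     \<bullet>\<^bsub>C\<^esub> (Ident C (Dual C W) \<star>\<^bsub>C\<^esub> (f \<star>\<^bsub>C\<^esub> Ident C (Dual C V)))
     \<bullet>\<^bsub>C\<^esub> (Ident C (Dual C W) \<star>\<^bsub>C\<^esub> LCoev C V)
     \<bullet>\<^bsub>C\<^esub> minv C (RUnitor C (Dual C W))"

definition right_dual_mor :: "('k, 'o, 'm, 'z) pivcat_scheme \<Rightarrow> 'o \<Rightarrow> 'o \<Rightarrow> 'm \<Rightarrow> 'm" where
  "right_dual_mor C V W f =
     RUnitor C (Dual C V)
     \<bullet>\<^bsub>C\<^esub> (Ident C (Dual C V) \<star>\<^bsub>C\<^esub> REv C W)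
     \<bullet>\<^bsub>C\<^esub> Assoc C (Dual C V) W (Dual C W)
     \<bullet>\<^bsub>C\<^esub> ((Ident C (Dual C V) \<star>\<^bsub>C\<^esub> f) \<star>\<^bsub>C\<^esub> Ident C (Dual C W))
     \<bullet>\<^bsub>C\<^esub> (RCoev C V \<star>\<^bsub>C\<^esub> Ident C (Dual C W))
     \<bullet>\<^bsub>C\<^esub> minv C (LUnitor C (Dual C W))"

text \<open>The pairings \<open>(W\<^sup>* \<boxtimes> V\<^sup>*) \<boxtimes> (V \<boxtimes> W) \<rightarrow> 1\<close> and \<open>(V \<boxtimes> W) \<boxtimes> (W\<^sup>* \<boxtimes> V\<^sup>*) \<rightarrow> 1\<close>
  obtained by nesting evaluations.\<close>

definition left_nested_ev :: "('k, 'o, 'm, 'z) pivcat_scheme \<Rightarrow> 'o \<Rightarrow> 'o \<Rightarrow> 'm" where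
  "left_nested_ev C V W =
     LEv C W
     \<bullet>\<^bsub>C\<^esub> (Ident C (Dual C W) \<star>\<^bsub>C\<^esub> LUnitor C W)
     \<bullet>\<^bsub>C\<^esub> (Ident C (Dual C W) \<star>\<^bsub>C\<^esub> (LEv C V \<star>\<^bsub>C\<^esub> Ident C W))
     \<bullet>\<^bsub>C\<^esub> (Ident C (Dual C W) \<star>\<^bsub>C\<^esub> minv C (Assoc C (Dual C V) V W))
     \<bullet>\<^bsub>C\<^esub> Assoc C (Dual C W) (Dual C V) (V \<boxtimes>\<^bsub>C\<^esub> W)"

definition right_nested_ev :: "('k, 'o, 'm, 'z) pivcat_scheme \<Rightarrow> 'o \<Rightarrow> 'o \<Rightarrow> 'm" where
  "right_nested_ev C V W =
     REv C V
     \<bullet>\<^bsub>C\<^esub> (Ident C V \<star>\<^bsub>C\<^esub> LUnitor C (Dual C V))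
     \<bullet>\<^bsub>C\<^esub> (Ident C V \<star>\<^bsub>C\<^esub> (REv C W \<star>\<^bsub>C\<^esub> Ident C (Dual C V)))
     \<bullet>\<^bsub>C\<^esub> (Ident C V \<star>\<^bsub>C\<^esub> minv C (Assoc C W (Dual C W) (Dual C V)))
     \<bullet>\<^bsub>C\<^esub> Assoc C V W (Dual C W \<boxtimes>\<^bsub>C\<^esub> Dual C V)"

text \<open>The canonical isomorphisms \<open>W\<^sup>* \<boxtimes> V\<^sup>* \<rightarrow> (V \<boxtimes> W)\<^sup>*\<close> of the left and of the right duality.\<close>

definition left_dual_tens :: "('k, 'o, 'm, 'z) pivcat_scheme \<Rightarrow> 'o \<Rightarrow> 'o \<Rightarrow> 'm" where
  "left_dual_tens C V W =
     (let T = Dual C W \<boxtimes>\<^bsub>C\<^esub> Dual C V; U = V \<boxtimes>\<^bsub>C\<^esub> W; D = Dual C U in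
     LUnitor C D
     \<bullet>\<^bsub>C\<^esub> (left_nested_ev C V W \<star>\<^bsub>C\<^esub> Ident C D)
     \<bullet>\<^bsub>C\<^esub> minv C (Assoc C T U D)
     \<bullet>\<^bsub>C\<^esub> (Ident C T \<star>\<^bsub>C\<^esub> LCoev C U)
     \<bullet>\<^bsub>C\<^esub> minv C (RUnitor C T))"

definition right_dual_tens :: "('k, 'o, 'm, 'z) pivcat_scheme \<Rightarrow> 'o \<Rightarrow> 'o \<Rightarrow> 'm" where
  "right_dual_tens C V W =
     (let T = Dual C W \<boxtimes>\<^bsub>C\<^esub> Dual C V; U = V \<boxtimes>\<^bsub>C\<^esub> W; D = Dual C U in
     RUnitor C D
     \<bullet>\<^bsub>C\<^esub> (Ident C D \<star>\<^bsub>C\<^esub> right_nested_ev C V W)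
     \<bullet>\<^bsub>C\<^esub> Assoc C D U T
     \<bullet>\<^bsub>C\<^esub> (RCoev C U \<star>\<^bsub>C\<^esub> Ident C T)
     \<bullet>\<^bsub>C\<^esub> minv C (LUnitor C T))"

locale pivotal_category = monoidal_category C
  for C :: "('k, 'o, 'm, 'z) pivcat_scheme" (structure) +
  assumes left_duality: "V \<in> Obj C \<Longrightarrow> is_duality C (Dual C V) V (LEv C V) (LCoev C V)"
    and right_duality: "V \<in> Obj C \<Longrightarrow> is_duality C V (Dual C V) (REv C V) (RCoev C V)"
    and dual_mor_coincide:
      "\<lbrakk> V \<in> Obj C; W \<in> Obj C; f \<in> mor C V W \<rbrakk> \<Longrightarrow> left_dual_mor C V W f = right_dual_mor C V W f"
    and dual_tens_coincide:
      "\<lbrakk> V \<in> Obj C; W \<in> Obj C \<rbrakk> \<Longrightarrow> left_dual_tens C V W = right_dual_tens C V W"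

locale pivotal_finite_tensor_category = finite_tensor_category K C + pivotal_category C
  for K :: "('k, 'r) ring_scheme" and C :: "('k, 'o, 'm, 'z) pivcat_scheme" (structure)


section \<open>Equivalence of linear categories\<close>

definition linear_functor ::
    "('k, 'r) ring_scheme \<Rightarrow> ('k, 'o, 'm, 'z) lincat_scheme \<Rightarrow> ('k, 'p, 'n, 'y) lincat_scheme \<Rightarrow>
     ('o \<Rightarrow> 'p) \<Rightarrow> ('m \<Rightarrow> 'n) \<Rightarrow> bool" where
  "linear_functor K C D FO FM \<longleftrightarrow>
     (\<forall>X \<in> Obj C. FO X \<in> Obj D \<and> FM (Ident C X) = Ident D (FO X)) \<and>
     (\<forall>X \<in> Obj C. \<forall>Y \<in> Obj C. \<forall>f \<in> mor C X Y. FM f \<in> mor D (FO X) (FO Y)) \<and>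
     (\<forall>X \<in> Obj C. \<forall>Y \<in> Obj C. \<forall>Z \<in> Obj C. \<forall>f \<in> mor C X Y. \<forall>g \<in> mor C Y Z.
        FM (g \<bullet>\<^bsub>C\<^esub> f) = FM g \<bullet>\<^bsub>D\<^esub> FM f) \<and>
     (\<forall>X \<in> Obj C. \<forall>Y \<in> Obj C. \<forall>f \<in> mor C X Y. \<forall>g \<in> mor C X Y.
        FM (f \<oplus>\<^bsub>Hom C X Y\<^esub> g) = FM f \<oplus>\<^bsub>Hom D (FO X) (FO Y)\<^esub> FM g) \<and>
     (\<forall>X \<in> Obj C. \<forall>Y \<in> Obj C. \<forall>c \<in> carrier K. \<forall>f \<in> mor C X Y.
        FM (c \<odot>\<^bsub>Hom C X Y\<^esub> f) = c \<odot>\<^bsub>Hom D (FO X) (FO Y)\<^esub> FM f)"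

definition natural_iso ::
    "('k, 'o, 'm, 'z) lincat_scheme \<Rightarrow> ('k, 'p, 'n, 'y) lincat_scheme \<Rightarrow>
     ('o \<Rightarrow> 'p) \<Rightarrow> ('m \<Rightarrow> 'n) \<Rightarrow> ('o \<Rightarrow> 'p) \<Rightarrow> ('m \<Rightarrow> 'n) \<Rightarrow> ('o \<Rightarrow> 'n) \<Rightarrow> bool" where
  "natural_iso C D FO FM GO GM \<eta> \<longleftrightarrow>
     (\<forall>X \<in> Obj C. is_iso D (FO X) (GO X) (\<eta> X)) \<and>
     (\<forall>X \<in> Obj C. \<forall>Y \<in> Obj C. \<forall>f \<in> mor C X Y. \<eta> Y \<bullet>\<^bsub>D\<^esub> FM f = GM f \<bullet>\<^bsub>D\<^esub> \<eta> X)"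

definition linearly_equivalent ::
    "('k, 'r) ring_scheme \<Rightarrow> ('k, 'o, 'm, 'z) lincat_scheme \<Rightarrow> ('k, 'p, 'n, 'y) lincat_scheme \<Rightarrow> bool" where
  "linearly_equivalent K C D \<longleftrightarrow>
     (\<exists>FO FM GO GM \<eta> \<epsilon>. linear_functor K C D FO FM \<and> linear_functor K D C GO GM \<and>
        natural_iso C C (\<lambda>X. X) (\<lambda>f. f) (GO \<circ> FO) (GM \<circ> FM) \<eta> \<and>
        natural_iso D D (FO \<circ> GO) (FM \<circ> GM) (\<lambda>X. X) (\<lambda>f. f) \<epsilon>)"


section \<open>Frobenius algebras and their modules\<close>

text \<open>The locale \<^locale>\<open>algebra\<close> of HOL-Algebra is restricted to commutative algebras.\<close>

locale associative_algebra = module K A + ring A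
  for K :: "('k, 'r) ring_scheme" and A :: "('k, 'a, 's) module_scheme" +
  assumes smult_mult_left:
      "\<lbrakk> c \<in> carrier K; a \<in> carrier A; b \<in> carrier A \<rbrakk>
        \<Longrightarrow> (c \<odot>\<^bsub>A\<^esub> a) \<otimes>\<^bsub>A\<^esub> b = c \<odot>\<^bsub>A\<^esub> (a \<otimes>\<^bsub>A\<^esub> b)"
    and smult_mult_right:
      "\<lbrakk> c \<in> carrier K; a \<in> carrier A; b \<in> carrier A \<rbrakk>
        \<Longrightarrow> a \<otimes>\<^bsub>A\<^esub> (c \<odot>\<^bsub>A\<^esub> b) = c \<odot>\<^bsub>A\<^esub> (a \<otimes>\<^bsub>A\<^esub> b)"

definition linear_form ::
    "('k, 'r) ring_scheme \<Rightarrow> ('k, 'v, 's) module_scheme \<Rightarrow> ('v \<Rightarrow> 'k) \<Rightarrow> bool" where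
  "linear_form K V t \<longleftrightarrow> t \<in> carrier V \<rightarrow> carrier K \<and>
     (\<forall>u \<in> carrier V. \<forall>v \<in> carrier V. t (u \<oplus>\<^bsub>V\<^esub> v) = t u \<oplus>\<^bsub>K\<^esub> t v) \<and>
     (\<forall>c \<in> carrier K. \<forall>v \<in> carrier V. t (c \<odot>\<^bsub>V\<^esub> v) = c \<otimes>\<^bsub>K\<^esub> t v)"

locale frobenius_algebra = associative_algebra +
  assumes algebra_finite_dimensional: "finite_dimensional K A"
    and frobenius_form:
      "\<exists>t. linear_form K A t \<and>
         (\<forall>a \<in> carrier A. (\<forall>b \<in> carrier A. t (a \<otimes>\<^bsub>A\<^esub> b) = \<zero>\<^bsub>K\<^esub>) \<longrightarrow> a = \<zero>\<^bsub>A\<^esub>) \<and>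
         (\<forall>b \<in> carrier A. (\<forall>a \<in> carrier A. t (a \<otimes>\<^bsub>A\<^esub> b) = \<zero>\<^bsub>K\<^esub>) \<longrightarrow> b = \<zero>\<^bsub>A\<^esub>)"

text \<open>The locale \<^locale>\<open>module\<close> of HOL-Algebra requires commutative coefficients.\<close>

locale left_module = ring A + M: abelian_group M
  for A :: "('a, 's) ring_scheme" and M :: "('a, 'v, 't) module_scheme" +
  assumes act_closed: "\<lbrakk> a \<in> carrier A; v \<in> carrier M \<rbrakk> \<Longrightarrow> a \<odot>\<^bsub>M\<^esub> v \<in> carrier M"
    and act_l_distr:
      "\<lbrakk> a \<in> carrier A; b \<in> carrier A; v \<in> carrier M \<rbrakk>
        \<Longrightarrow> (a \<oplus>\<^bsub>A\<^esub> b) \<odot>\<^bsub>M\<^esub> v = (a \<odot>\<^bsub>M\<^esub> v) \<oplus>\<^bsub>M\<^esub> (b \<odot>\<^bsub>M\<^esub> v)"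
    and act_r_distr:
      "\<lbrakk> a \<in> carrier A; u \<in> carrier M; v \<in> carrier M \<rbrakk>
        \<Longrightarrow> a \<odot>\<^bsub>M\<^esub> (u \<oplus>\<^bsub>M\<^esub> v) = (a \<odot>\<^bsub>M\<^esub> u) \<oplus>\<^bsub>M\<^esub> (a \<odot>\<^bsub>M\<^esub> v)"
    and act_assoc:
      "\<lbrakk> a \<in> carrier A; b \<in> carrier A; v \<in> carrier M \<rbrakk>
        \<Longrightarrow> (a \<otimes>\<^bsub>A\<^esub> b) \<odot>\<^bsub>M\<^esub> v = a \<odot>\<^bsub>M\<^esub> (b \<odot>\<^bsub>M\<^esub> v)"
    and act_one: "v \<in> carrier M \<Longrightarrow> \<one>\<^bsub>A\<^esub> \<odot>\<^bsub>M\<^esub> v = v"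

text \<open>A module over a \<open>K\<close>-algebra is a \<open>K\<close>-vector space through \<open>c \<mapsto> c 1\<^sub>A\<close>.\<close>

definition restrict_scalars ::
    "('k, 'a, 's) module_scheme \<Rightarrow> ('a, 'v, 't) module_scheme \<Rightarrow> ('k, 'v) module" where
  "restrict_scalars A M =
     \<lparr> carrier = carrier M, monoid.mult = monoid.mult M, one = \<one>\<^bsub>M\<^esub>, ring.zero = \<zero>\<^bsub>M\<^esub>, ring.add = ring.add M,
       smult = (\<lambda>c v. (c \<odot>\<^bsub>A\<^esub> \<one>\<^bsub>A\<^esub>) \<odot>\<^bsub>M\<^esub> v) \<rparr>"

definition module_maps ::
    "('a, 's) ring_scheme \<Rightarrow> ('a, 'v, 't) module_scheme \<Rightarrow> ('a, 'w, 'u) module_scheme \<Rightarrow> ('v \<Rightarrow> 'w) set" where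
  "module_maps A M N = {f \<in> carrier M \<rightarrow>\<^sub>E carrier N.
     (\<forall>u \<in> carrier M. \<forall>v \<in> carrier M. f (u \<oplus>\<^bsub>M\<^esub> v) = f u \<oplus>\<^bsub>N\<^esub> f v) \<and>
     (\<forall>a \<in> carrier A. \<forall>v \<in> carrier M. f (a \<odot>\<^bsub>M\<^esub> v) = a \<odot>\<^bsub>N\<^esub> f v)}"

text \<open>
  The category of finite-dimensional left \<open>A\<close>-modules with underlying set contained in a fixed
  universe type \<open>'v\<close>. Morphisms are triples (source, map, target), with pointwise linear structure.
  For \<open>K\<close> with scalars in \<open>'k\<close>, the universe \<open>nat \<Rightarrow> 'k\<close> contains an isomorphic copy of every
  finite-dimensional vector space over \<open>K\<close>, hence of every finite-dimensional \<open>A\<close>-module.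
\<close>

type_synonym ('a, 'v) module_mor = "('a, 'v) module \<times> ('v \<Rightarrow> 'v) \<times> ('a, 'v) module"

definition module_hom_space ::
    "('k, 'a, 's) module_scheme \<Rightarrow> ('a, 'v) module \<Rightarrow> ('a, 'v) module \<Rightarrow>
     ('k, ('a, 'v) module_mor) module" where
  "module_hom_space A M N =
     \<lparr> carrier = {(M, f, N) |f. f \<in> module_maps A M N},
       monoid.mult = undefined, one = undefined,
       ring.zero = (M, \<lambda>v \<in> carrier M. \<zero>\<^bsub>N\<^esub>, N),
       ring.add = (\<lambda>(_, f, _) (_, g, _). (M, \<lambda>v \<in> carrier M. f v \<oplus>\<^bsub>N\<^esub> g v, N)),
       smult = (\<lambda>c (_, f, _). (M, \<lambda>v \<in> carrier M. c \<odot>\<^bsub>restrict_scalars A N\<^esub> f v, N)) \<rparr>"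

definition fd_modules ::
    "('k, 'r) ring_scheme \<Rightarrow> ('k, 'a, 's) module_scheme \<Rightarrow>
     ('k, ('a, 'v) module, ('a, 'v) module_mor) lincat" where
  "fd_modules K A =
     \<lparr> Obj = {M. left_module A M \<and> finite_dimensional K (restrict_scalars A M)},
       Hom = module_hom_space A,
       Ident = (\<lambda>M. (M, \<lambda>v \<in> carrier M. v, M)),
       Comp = (\<lambda>(_, g, N) (L, f, _). (L, compose (carrier L) g f, N)) \<rparr>"

end

theory Submission
  imports Defs
begin


text \<open>
  Two ideas carry the proof. First, rigidity makes every projective object \<open>P\<close> injective
  (\<open>projective_is_injective\<close>). If \<open>P'\<close> is a left dual of \<open>P\<close>, the functor \<open>T = P \<boxtimes> (P' \<boxtimes> -)\<close> is exact, because tensoring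
  with a rigid object has adjoints on both sides, and all its values are projective, because tensoring preserves
  projectives. So \<open>T\<close> turns every monomorphism into a split one, and the zigzag identity of the duality, which makes \<open>P\<close>
  a retract of \<open>T P\<close>, transports extensions along \<open>T f\<close> back to extensions along \<open>f\<close>.

  Second, in a finite linear category whose projectives are injective, the endomorphism algebra of a basic projective
  generator is Frobenius (\<open>ex_generator_with_form\<close>). The projective cover \<open>P\<^sub>S\<close> of a simple object \<open>S\<close> has a local
  endomorphism algebra; with injectivity this forces \<open>P\<^sub>S\<close> to have a simple socle \<open>\<sigma> S\<close> (\<open>simple_cover_socle\<close>) and the
  socle to determine \<open>S\<close> (\<open>simple_cover_socle_inj\<close>). Hence \<open>\<sigma>\<close> is a permutation of the finitely many simple objects,
  the Nakayama permutation. Let \<open>G\<close> be the direct sum of one \<open>P\<^sub>S\<close> for each simple \<open>S\<close>, and let \<open>m\<^sub>S\<close> be the composite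
  \<open>P\<^bsub>\<sigma> S\<^esub> \<rightarrow> \<sigma> S \<rightarrow> P\<^sub>S\<close>. A linear form on \<open>End(G)\<close> that reads the blocks \<open>P\<^bsub>\<sigma> S\<^esub> \<rightarrow> P\<^sub>S\<close> and is \<open>1\<close> on every \<open>m\<^sub>S\<close> is
  non-degenerate on both sides: a nonzero morphism into \<open>P\<^sub>S\<close> has the socle in its image, so some composite with it is
  \<open>m\<^sub>S\<close> (\<open>socle_lift\<close>), and a nonzero morphism out of \<open>P\<^bsub>\<sigma> S\<^esub>\<close> keeps the top, so again some composite is \<open>m\<^sub>S\<close>
  (\<open>top_extend\<close>).

  It remains to see that \<open>Hom(G, -)\<close> is an equivalence onto the finite-dimensional modules over \<open>End(G)\<^sup>o\<^sup>p\<close>. It is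
  full, faithful and dense (\<open>hom_full\<close>, \<open>hom_faithful\<close>, \<open>hom_dense\<close>) since every object is a quotient of a finite
  direct sum of copies of \<open>G\<close> and every finite-dimensional module has a finite presentation by free modules.
  Coordinate maps place the algebra and the modules inside the sequences of scalars.
\<close>

section \<open>Linear algebra over a field\<close>

inductive_set lspan :: "('k, 'r) ring_scheme \<Rightarrow> ('k, 'v, 's) module_scheme \<Rightarrow> 'v set \<Rightarrow> 'v set"
  for K V B where
  lspan_zero: "\<zero>\<^bsub>V\<^esub> \<in> lspan K V B"
| lspan_base: "b \<in> B \<Longrightarrow> b \<in> lspan K V B"
| lspan_add: "\<lbrakk> u \<in> lspan K V B; v \<in> lspan K V B \<rbrakk> \<Longrightarrow> u \<oplus>\<^bsub>V\<^esub> v \<in> lspan K V B"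
| lspan_smult: "\<lbrakk> c \<in> carrier K; v \<in> lspan K V B \<rbrakk> \<Longrightarrow> c \<odot>\<^bsub>V\<^esub> v \<in> lspan K V B"

definition subspace :: "('k, 'r) ring_scheme \<Rightarrow> ('k, 'v, 's) module_scheme \<Rightarrow> 'v set \<Rightarrow> bool" where
  "subspace K V W \<longleftrightarrow> W \<subseteq> carrier V \<and> \<zero>\<^bsub>V\<^esub> \<in> W \<and> (\<forall>u \<in> W. \<forall>v \<in> W. u \<oplus>\<^bsub>V\<^esub> v \<in> W) \<and>
     (\<forall>c \<in> carrier K. \<forall>v \<in> W. c \<odot>\<^bsub>V\<^esub> v \<in> W)"

lemma subspaceI:
  assumes "W \<subseteq> carrier V" "\<zero>\<^bsub>V\<^esub> \<in> W" "\<And>u v. \<lbrakk> u \<in> W; v \<in> W \<rbrakk> \<Longrightarrow> u \<oplus>\<^bsub>V\<^esub> v \<in> W"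
    "\<And>c v. \<lbrakk> c \<in> carrier K; v \<in> W \<rbrakk> \<Longrightarrow> c \<odot>\<^bsub>V\<^esub> v \<in> W"
  shows "subspace K V W"
  using assms by (auto simp: subspace_def)

lemma lspan_least:
  assumes "subspace K V W" and "B \<subseteq> W" and "v \<in> lspan K V B"
  shows "v \<in> W"
  using assms(3,1,2) by (induction rule: lspan.induct) (auto simp: subspace_def)

lemma lspan_mono: "B \<subseteq> B' \<Longrightarrow> lspan K V B \<subseteq> lspan K V B'"
proof
  fix v assume "B \<subseteq> B'" "v \<in> lspan K V B"
  from this(2,1) show "v \<in> lspan K V B'" by induction (auto intro: lspan.intros)
qed

context module begin

lemma subspace_carrier: "subspace R M (carrier M)"
  by (auto intro!: subspaceI)

lemma lspan_closed: "\<lbrakk> v \<in> lspan R M B; B \<subseteq> carrier M \<rbrakk> \<Longrightarrow> v \<in> carrier M"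
  using lspan_least[OF subspace_carrier] by blast

lemma subspace_minus:
  assumes "subspace R M W" "u \<in> W" "v \<in> W" shows "u \<ominus>\<^bsub>M\<^esub> v \<in> W"
proof -
  have "v \<in> carrier M" using assms by (auto simp: subspace_def)
  then have "(\<ominus> \<one>) \<odot>\<^bsub>M\<^esub> v = \<ominus>\<^bsub>M\<^esub> v" using smult_l_minus[of \<one> v] by simp
  then show ?thesis using assms unfolding subspace_def a_minus_def by (metis R.a_inv_closed R.one_closed)
qed

lemma lspan_insertE:
  assumes "x \<in> lspan R M (insert b B)" and "b \<in> carrier M" "B \<subseteq> carrier M"
  obtains c y where "c \<in> carrier R" "y \<in> lspan R M B" "x = y \<oplus>\<^bsub>M\<^esub> c \<odot>\<^bsub>M\<^esub> b"
proof -
  let ?W = "{y \<oplus>\<^bsub>M\<^esub> c \<odot>\<^bsub>M\<^esub> b |y c. c \<in> carrier R \<and> y \<in> lspan R M B}"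
  note cl = lspan_closed[OF _ assms(3)]
  have "subspace R M ?W"
  proof (rule subspaceI)
    show "?W \<subseteq> carrier M" using cl assms by auto
    show "\<zero>\<^bsub>M\<^esub> \<in> ?W"
      using assms by (auto intro!: exI[of _ "\<zero>\<^bsub>M\<^esub>"] exI[of _ "\<zero>"] lspan_zero)
    fix u v assume "u \<in> ?W" "v \<in> ?W"
    then obtain y c z d where *: "u = y \<oplus>\<^bsub>M\<^esub> c \<odot>\<^bsub>M\<^esub> b" "v = z \<oplus>\<^bsub>M\<^esub> d \<odot>\<^bsub>M\<^esub> b"
      "c \<in> carrier R" "d \<in> carrier R" "y \<in> lspan R M B" "z \<in> lspan R M B" by auto
    have "u \<oplus>\<^bsub>M\<^esub> v = (y \<oplus>\<^bsub>M\<^esub> z) \<oplus>\<^bsub>M\<^esub> (c \<oplus> d) \<odot>\<^bsub>M\<^esub> b"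
      using * cl[of y] cl[of z] assms by (simp add: smult_l_distr M.a_ac)
    then show "u \<oplus>\<^bsub>M\<^esub> v \<in> ?W" using * by (auto intro: lspan_add)
  next
    fix c' u assume "c' \<in> carrier R" "u \<in> ?W"
    then obtain y c where *: "u = y \<oplus>\<^bsub>M\<^esub> c \<odot>\<^bsub>M\<^esub> b" "c \<in> carrier R" "y \<in> lspan R M B" by auto
    have "c' \<odot>\<^bsub>M\<^esub> u = c' \<odot>\<^bsub>M\<^esub> y \<oplus>\<^bsub>M\<^esub> (c' \<otimes> c) \<odot>\<^bsub>M\<^esub> b"
      using * cl[of y] assms \<open>c' \<in> carrier R\<close> by (simp add: smult_r_distr smult_assoc1)
    then show "c' \<odot>\<^bsub>M\<^esub> u \<in> ?W" using * \<open>c' \<in> carrier R\<close> by (auto intro: lspan_smult)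
  qed
  moreover have "insert b B \<subseteq> ?W"
  proof -
    have "b = \<zero>\<^bsub>M\<^esub> \<oplus>\<^bsub>M\<^esub> \<one> \<odot>\<^bsub>M\<^esub> b" using assms by simp
    then have "b \<in> ?W" using lspan_zero R.one_closed by blast
    moreover have "x \<in> ?W" if "x \<in> B" for x
    proof -
      have "x = x \<oplus>\<^bsub>M\<^esub> \<zero> \<odot>\<^bsub>M\<^esub> b" using assms that by auto
      then show ?thesis using lspan_base[OF that] R.zero_closed by blast
    qed
    ultimately show ?thesis by blast
  qed
  ultimately have "x \<in> ?W" by (rule lspan_least[OF _ _ assms(1)])
  then show ?thesis using that by blast
qed

text \<open>Spans as closures let facts be proved by checking that they define a subspace and hold on generators; linear
  combinations only enter here.\<close>

lemma finite_dimensional_iff_lspan: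
  "finite_dimensional R M \<longleftrightarrow> (\<exists>B. finite B \<and> B \<subseteq> carrier M \<and> carrier M \<subseteq> lspan R M B)"
proof
  assume "finite_dimensional R M"
  then obtain B where B: "finite B" "B \<subseteq> carrier M"
    "\<And>v. v \<in> carrier M \<Longrightarrow> \<exists>c \<in> B \<rightarrow> carrier R. v = (\<Oplus>\<^bsub>M\<^esub>b \<in> B. c b \<odot>\<^bsub>M\<^esub> b)"
    unfolding finite_dimensional_def by blast
  have "(\<Oplus>\<^bsub>M\<^esub>b \<in> B'. c b \<odot>\<^bsub>M\<^esub> b) \<in> lspan R M B" if "B' \<subseteq> B" "c \<in> B \<rightarrow> carrier R" for B' c
  proof -
    have cl: "c x \<odot>\<^bsub>M\<^esub> x \<in> carrier M" if "x \<in> B" for x using that \<open>c \<in> B \<rightarrow> carrier R\<close> B(2) by blast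
    have "finite B'" using that B(1) finite_subset by blast
    then show ?thesis using that(1)
    proof (induction B')
      case empty then show ?case by (simp add: lspan_zero)
    next
      case (insert b B')
      then have "(\<Oplus>\<^bsub>M\<^esub>b \<in> insert b B'. c b \<odot>\<^bsub>M\<^esub> b) = c b \<odot>\<^bsub>M\<^esub> b \<oplus>\<^bsub>M\<^esub> (\<Oplus>\<^bsub>M\<^esub>b \<in> B'. c b \<odot>\<^bsub>M\<^esub> b)"
        using cl by (intro M.finsum_insert) auto
      then show ?case using insert that by (simp add: Pi_iff lspan.intros)
    qed
  qed
  then have "carrier M \<subseteq> lspan R M B" using B(3) by fastforce
  then show "\<exists>B. finite B \<and> B \<subseteq> carrier M \<and> carrier M \<subseteq> lspan R M B" using B(1,2) by blast
next
  assume "\<exists>B. finite B \<and> B \<subseteq> carrier M \<and> carrier M \<subseteq> lspan R M B"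
  then obtain B where B: "finite B" "B \<subseteq> carrier M" "carrier M \<subseteq> lspan R M B" by blast
  let ?W = "{\<Oplus>\<^bsub>M\<^esub>b \<in> B. c b \<odot>\<^bsub>M\<^esub> b |c. c \<in> B \<rightarrow> carrier R}"
  have cl: "(\<lambda>b. c b \<odot>\<^bsub>M\<^esub> b) \<in> B \<rightarrow> carrier M" if "c \<in> B \<rightarrow> carrier R" for c
    using B that by auto
  have "subspace R M ?W"
  proof (rule subspaceI)
    show "?W \<subseteq> carrier M" using cl by (auto intro!: M.finsum_closed)
    have "(\<Oplus>\<^bsub>M\<^esub>b \<in> B. \<zero> \<odot>\<^bsub>M\<^esub> b) = \<zero>\<^bsub>M\<^esub>" using B(2) by (intro M.add.finprod_one_eqI) auto
    then show "\<zero>\<^bsub>M\<^esub> \<in> ?W" by (auto intro!: exI[of _ "\<lambda>_. \<zero>"])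
    fix u v assume "u \<in> ?W" "v \<in> ?W"
    then obtain c d where *: "c \<in> B \<rightarrow> carrier R" "d \<in> B \<rightarrow> carrier R"
      "u = (\<Oplus>\<^bsub>M\<^esub>b \<in> B. c b \<odot>\<^bsub>M\<^esub> b)" "v = (\<Oplus>\<^bsub>M\<^esub>b \<in> B. d b \<odot>\<^bsub>M\<^esub> b)" by auto
    have "u \<oplus>\<^bsub>M\<^esub> v = (\<Oplus>\<^bsub>M\<^esub>b \<in> B. c b \<odot>\<^bsub>M\<^esub> b \<oplus>\<^bsub>M\<^esub> d b \<odot>\<^bsub>M\<^esub> b)"
      using * cl by (simp add: M.finsum_addf)
    also have "\<dots> = (\<Oplus>\<^bsub>M\<^esub>b \<in> B. (c b \<oplus> d b) \<odot>\<^bsub>M\<^esub> b)"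
      using * B(2) by (intro M.finsum_cong') (auto simp: smult_l_distr subset_iff Pi_iff)
    finally show "u \<oplus>\<^bsub>M\<^esub> v \<in> ?W" using * by (auto intro!: exI[of _ "\<lambda>b. c b \<oplus> d b"])
  next
    fix a u assume a: "a \<in> carrier R" and "u \<in> ?W"
    then obtain c where *: "c \<in> B \<rightarrow> carrier R" "u = (\<Oplus>\<^bsub>M\<^esub>b \<in> B. c b \<odot>\<^bsub>M\<^esub> b)" by auto
    have "a \<odot>\<^bsub>M\<^esub> u = (\<Oplus>\<^bsub>M\<^esub>b \<in> B. a \<odot>\<^bsub>M\<^esub> (c b \<odot>\<^bsub>M\<^esub> b))"
      using * cl a by (simp add: finsum_smult_ldistr[OF B(1)])
    also have "\<dots> = (\<Oplus>\<^bsub>M\<^esub>b \<in> B. (a \<otimes> c b) \<odot>\<^bsub>M\<^esub> b)"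
      using * B(2) a by (intro M.finsum_cong') (auto simp: smult_assoc1 subset_iff Pi_iff)
    finally show "a \<odot>\<^bsub>M\<^esub> u \<in> ?W" using * a by (auto intro!: exI[of _ "\<lambda>b. a \<otimes> c b"])
  qed
  moreover have "B \<subseteq> ?W"
  proof
    fix x assume x: "x \<in> B"
    have "(\<Oplus>\<^bsub>M\<^esub>b \<in> B. (if b = x then \<one> else \<zero>) \<odot>\<^bsub>M\<^esub> b) = (\<Oplus>\<^bsub>M\<^esub>b \<in> B. if x = b then b else \<zero>\<^bsub>M\<^esub>)"
      using B(2) by (intro M.finsum_cong') auto
    also have "\<dots> = x" using B x by (subst M.add.finprod_singleton) auto
    finally have "(\<Oplus>\<^bsub>M\<^esub>b \<in> B. (if b = x then \<one> else \<zero>) \<odot>\<^bsub>M\<^esub> b) = x" .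
    then show "x \<in> ?W" by (intro CollectI exI[of _ "\<lambda>b. if b = x then \<one> else \<zero>"]) auto
  qed
  ultimately have "x \<in> ?W" if "x \<in> carrier M" for x
    by (rule lspan_least) (rule subsetD[OF B(3) that])
  then have "carrier M \<subseteq> ?W" ..
  then show "finite_dimensional R M"
    unfolding finite_dimensional_def unfolding Bex_def
  proof (intro exI[of _ B] conjI allI impI ballI)
    fix v assume "v \<in> carrier M"
    then have "v \<in> ?W" using \<open>carrier M \<subseteq> ?W\<close> by (rule rev_subsetD)
    then show "\<exists>c. c \<in> B \<rightarrow> carrier R \<and> v = (\<Oplus>\<^bsub>M\<^esub>b\<in>B. c b \<odot>\<^bsub>M\<^esub> b)"
      by (elim CollectE exE conjE) (intro exI conjI)
  qed (rule B)+
qed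

text \<open>Only injectivity of the coordinates matters, so the coefficients with respect to a finite spanning set
  may be chosen arbitrarily.\<close>

lemma ex_coordinates:
  assumes "finite_dimensional R M"
  shows "\<exists>enc :: 'c \<Rightarrow> nat \<Rightarrow> 'a. inj_on enc (carrier M)"
proof -
  obtain B where B: "finite B" "B \<subseteq> carrier M"
    and ex: "\<forall>v \<in> carrier M. \<exists>c. c \<in> B \<rightarrow> carrier R \<and> v = (\<Oplus>\<^bsub>M\<^esub>b \<in> B. c b \<odot>\<^bsub>M\<^esub> b)"
    using assms unfolding finite_dimensional_def Bex_def by (elim exE conjE)
  obtain c
    where c': "\<forall>v \<in> carrier M. c v \<in> B \<rightarrow> carrier R \<and> v = (\<Oplus>\<^bsub>M\<^esub>b \<in> B. c v b \<odot>\<^bsub>M\<^esub> b)"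
    using bchoice[OF ex] ..
  note c = bspec[OF c', THEN conjunct1] bspec[OF c', THEN conjunct2]
  from B(1) obtain f :: "'c \<Rightarrow> nat" where f: "inj_on f B"
    using finite_imp_inj_to_nat_seg by blast
  have "inj_on (\<lambda>v n. c v (inv_into B f n)) (carrier M)"
  proof (rule inj_onI)
    fix u v assume uv: "u \<in> carrier M" "v \<in> carrier M"
      and eq: "(\<lambda>n. c u (inv_into B f n)) = (\<lambda>n. c v (inv_into B f n))"
    have "c u b = c v b" if "b \<in> B" for b
      using fun_cong[OF eq, of "f b"] f that by simp
    then have "(\<Oplus>\<^bsub>M\<^esub>b \<in> B. c u b \<odot>\<^bsub>M\<^esub> b) = (\<Oplus>\<^bsub>M\<^esub>b \<in> B. c v b \<odot>\<^bsub>M\<^esub> b)"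
      using c(1)[OF uv(2)] B(2) by (intro M.finsum_cong') (auto simp: Pi_iff subset_iff)
    then show "u = v" by (rule trans[OF c(2)[OF uv(1)] trans[OF _ c(2)[OF uv(2), symmetric]]])
  qed
  then show ?thesis by blast
qed

end

locale vspace = R: field K + module K V for K :: "('k, 'r) ring_scheme" and V :: "('k, 'v, 's) module_scheme"
begin

lemma smult_inverse_cancel:
  assumes "c \<in> carrier K" "c \<noteq> \<zero>\<^bsub>K\<^esub>" "x \<in> carrier V"
  shows "inv\<^bsub>K\<^esub> c \<odot>\<^bsub>V\<^esub> (c \<odot>\<^bsub>V\<^esub> x) = x" "inv\<^bsub>K\<^esub> c \<in> carrier K"
  using assms by (simp_all add: smult_assoc1[symmetric] R.field_Units)

text \<open>Induction on the spanning set: a subspace that leaves the span of \<open>B\<close> is spanned by its part inside that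
  span together with a single further vector.\<close>

lemma subspace_finite_span:
  assumes "finite B" "B \<subseteq> carrier V" "subspace K V W" "W \<subseteq> lspan K V B"
  shows "\<exists>B'. finite B' \<and> B' \<subseteq> W \<and> W \<subseteq> lspan K V B'"
  using assms
proof (induction B arbitrary: W rule: finite_induct)
  case empty
  have "lspan K V {} \<subseteq> {\<zero>\<^bsub>V\<^esub>}"
  proof
    fix x assume "x \<in> lspan K V {}"
    then show "x \<in> {\<zero>\<^bsub>V\<^esub>}"
      by (rule lspan_least[rotated 2]) (auto simp: subspace_def)
  qed
  then show ?case using empty by blast
next
  case (insert b B W)
  have b: "b \<in> carrier V" "B \<subseteq> carrier V" using insert by auto
  note cl = lspan_closed[OF _ b(2)]
  have W: "W \<subseteq> carrier V" using insert by (simp add: subspace_def)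
  show ?case
  proof (cases "W \<subseteq> lspan K V B")
    case True
    then show ?thesis using insert.IH[of W] insert.prems by auto
  next
    case False
    then obtain w where w: "w \<in> W" "w \<notin> lspan K V B" by blast
    obtain c y where cy: "c \<in> carrier K" "y \<in> lspan K V B" "w = y \<oplus>\<^bsub>V\<^esub> c \<odot>\<^bsub>V\<^esub> b"
      using lspan_insertE[of w b B] insert.prems(3) b w by auto
    have c: "c \<noteq> \<zero>\<^bsub>K\<^esub>" using w cy cl b by auto
    have "subspace K V (W \<inter> lspan K V B)"
      using insert.prems(2) by (auto simp: subspace_def intro: lspan.intros)
    then obtain B' where B': "finite B'" "B' \<subseteq> W \<inter> lspan K V B" "W \<inter> lspan K V B \<subseteq> lspan K V B'"
      using insert.IH[of "W \<inter> lspan K V B"] b by auto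
    have "x \<in> lspan K V (insert w B')" if x: "x \<in> W" for x
    proof -
      obtain d z where dz: "d \<in> carrier K" "z \<in> lspan K V B" "x = z \<oplus>\<^bsub>V\<^esub> d \<odot>\<^bsub>V\<^esub> b"
        using lspan_insertE[of x b B] insert.prems(3) b x by auto
      define q where "q = d \<otimes>\<^bsub>K\<^esub> inv\<^bsub>K\<^esub> c"
      have q: "q \<in> carrier K" using smult_inverse_cancel(2)[OF cy(1) c b(1)] dz by (simp add: q_def)
      have qc: "q \<otimes>\<^bsub>K\<^esub> c = d"
        using dz cy c R.field_Units smult_inverse_cancel(2)[OF cy(1) c b(1)] by (simp add: q_def R.m_assoc)
      have yz: "y \<in> carrier V" "z \<in> carrier V" using cl cy dz by auto
      define u where "u = x \<oplus>\<^bsub>V\<^esub> (\<ominus>\<^bsub>K\<^esub> q) \<odot>\<^bsub>V\<^esub> w"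
      have qw: "q \<odot>\<^bsub>V\<^esub> w = q \<odot>\<^bsub>V\<^esub> y \<oplus>\<^bsub>V\<^esub> d \<odot>\<^bsub>V\<^esub> b"
        using q qc cy yz b by (simp add: smult_r_distr smult_assoc1[symmetric])
      have "u = z \<oplus>\<^bsub>V\<^esub> (\<ominus>\<^bsub>K\<^esub> q) \<odot>\<^bsub>V\<^esub> y"
        unfolding u_def using q qw yz dz b w W 
        by (simp add: smult_l_minus M.minus_add M.a_ac subset_iff) (simp add: M.a_assoc[symmetric] M.r_neg)
      then have "u \<in> lspan K V B" using cy dz q by (auto intro!: lspan_add lspan_smult)
      moreover have "u \<in> W" using x w q insert.prems(2) unfolding u_def subspace_def by auto
      ultimately have "u \<in> lspan K V B'" using B' by blast
      then have "u \<in> lspan K V (insert w B')" using lspan_mono[of B' "insert w B'"] by blast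
      moreover have "x = u \<oplus>\<^bsub>V\<^esub> q \<odot>\<^bsub>V\<^esub> w"
        unfolding u_def using q x w W
        by (simp add: smult_l_minus M.a_assoc subset_iff M.l_neg)
      ultimately show ?thesis using q by (simp add: lspan.intros)
    qed
    then have "W \<subseteq> lspan K V (insert w B')" ..
    moreover have "insert w B' \<subseteq> W" "finite (insert w B')" using B' w by auto
    ultimately show ?thesis by blast
  qed
qed

lemma finite_dimensional_subspace:
  assumes "finite_dimensional K V" "subspace K V W"
  obtains B where "finite B" "B \<subseteq> W" "W \<subseteq> lspan K V B"
proof -
  obtain B where "finite B" "B \<subseteq> carrier V" "carrier V \<subseteq> lspan K V B"
    using assms(1) finite_dimensional_iff_lspan by blast
  moreover from assms(2) have "W \<subseteq> carrier V" by (simp add: subspace_def)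
  ultimately show ?thesis using subspace_finite_span[of B W] assms(2) that by blast
qed

text \<open>A subspace that is maximal among those avoiding \<open>v\<close> is a complement of the line through \<open>v\<close>, and the
  coefficient of \<open>v\<close> is the form.\<close>

lemma ex_linear_form:
  assumes v: "v \<in> carrier V" "v \<noteq> \<zero>\<^bsub>V\<^esub>"
  shows "\<exists>t. linear_form K V t \<and> t v = \<one>\<^bsub>K\<^esub>"
proof -
  let ?S = "{W. subspace K V W \<and> v \<notin> W}"
  have "{\<zero>\<^bsub>V\<^esub>} \<in> ?S" using v by (auto simp: subspace_def)
  then have ne: "?S \<noteq> {}" by blast
  have chain: "\<Union>c \<in> ?S" if "c \<noteq> {}" "subset.chain ?S c" for c
  proof -
    have ss: "subspace K V W" if "W \<in> c" for W using \<open>subset.chain ?S c\<close> that by (auto simp: subset.chain_def)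
    have "subspace K V (\<Union>c)"
    proof (rule subspaceI)
      show "\<Union>c \<subseteq> carrier V" using ss unfolding subspace_def by blast
      show "\<zero>\<^bsub>V\<^esub> \<in> \<Union>c" using ss \<open>c \<noteq> {}\<close> by (auto simp: subspace_def)
      show "k \<odot>\<^bsub>V\<^esub> u \<in> \<Union>c" if "k \<in> carrier K" "u \<in> \<Union>c" for k u
        using that ss unfolding subspace_def by (meson UnionE UnionI)
      fix u w assume "u \<in> \<Union>c" "w \<in> \<Union>c"
      then obtain U W where UW: "U \<in> c" "W \<in> c" "u \<in> U" "w \<in> W" by blast
      then have "U \<subseteq> W \<or> W \<subseteq> U" using \<open>subset.chain ?S c\<close> by (auto simp: subset.chain_def)
      then have "u \<oplus>\<^bsub>V\<^esub> w \<in> U \<or> u \<oplus>\<^bsub>V\<^esub> w \<in> W" using UW ss[of U] ss[of W] by (auto simp: subspace_def)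
      then show "u \<oplus>\<^bsub>V\<^esub> w \<in> \<Union>c" using UW by blast
    qed
    then show ?thesis using that by (auto simp: subset.chain_def)
  qed
  obtain W where W: "W \<in> ?S" and max: "\<And>W'. W' \<in> ?S \<Longrightarrow> W \<subseteq> W' \<Longrightarrow> W' = W"
    using subset_Zorn_nonempty[OF ne chain] by blast
  have ssW: "subspace K V W" and vW: "v \<notin> W" and WV: "W \<subseteq> carrier V" using W by (auto simp: subspace_def)
  have dec: "\<exists>c w. c \<in> carrier K \<and> w \<in> W \<and> x = w \<oplus>\<^bsub>V\<^esub> c \<odot>\<^bsub>V\<^esub> v" if x: "x \<in> carrier V" for x
  proof (cases "x \<in> W")
    case True
    then show ?thesis using x v by (intro exI[of _ "\<zero>\<^bsub>K\<^esub>"] exI[of _ x]) auto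
  next
    case False
    let ?W = "lspan K V (insert x W)"
    have "subspace K V ?W"
      using lspan_closed[of _ "insert x W"] x WV by (intro subspaceI) (auto intro: lspan.intros)
    moreover have "W \<subseteq> ?W" "x \<in> ?W" by (auto intro: lspan_base)
    ultimately have "v \<in> ?W" using max[of ?W] False by blast
    then obtain c y where cy: "c \<in> carrier K" "y \<in> lspan K V W" "v = y \<oplus>\<^bsub>V\<^esub> c \<odot>\<^bsub>V\<^esub> x"
      using lspan_insertE[of v x W] x WV by auto
    have y: "y \<in> W" using lspan_least[OF ssW _ cy(2)] by blast
    have c: "c \<noteq> \<zero>\<^bsub>K\<^esub>" using cy y vW x WV by auto
    note i = smult_inverse_cancel[OF cy(1) c x]
    define w where "w = (\<ominus>\<^bsub>K\<^esub> (inv\<^bsub>K\<^esub> c)) \<odot>\<^bsub>V\<^esub> y"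
    have "w \<in> W" using ssW y i by (auto simp: w_def subspace_def)
    moreover have "inv\<^bsub>K\<^esub> c \<odot>\<^bsub>V\<^esub> v = inv\<^bsub>K\<^esub> c \<odot>\<^bsub>V\<^esub> y \<oplus>\<^bsub>V\<^esub> x"
      using cy i x y WV by (simp add: smult_r_distr subset_iff)
    then have "x = w \<oplus>\<^bsub>V\<^esub> inv\<^bsub>K\<^esub> c \<odot>\<^bsub>V\<^esub> v"
      using i x y WV by (simp add: w_def smult_l_minus subset_iff M.a_assoc[symmetric] M.l_neg)
    ultimately show ?thesis using i by blast
  qed
  have uniq: "c = d" if *: "w \<in> W" "u \<in> W" "c \<in> carrier K" "d \<in> carrier K"
    "w \<oplus>\<^bsub>V\<^esub> c \<odot>\<^bsub>V\<^esub> v = u \<oplus>\<^bsub>V\<^esub> d \<odot>\<^bsub>V\<^esub> v" for c d w u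
  proof (rule ccontr)
    assume "c \<noteq> d"
    define e where "e = c \<ominus>\<^bsub>K\<^esub> d"
    have e: "e \<in> carrier K" "e \<noteq> \<zero>\<^bsub>K\<^esub>" using * \<open>c \<noteq> d\<close> by (auto simp: e_def)
    have wu: "w \<in> carrier V" "u \<in> carrier V" using * WV by auto
    have c': "c = d \<oplus>\<^bsub>K\<^esub> e" using * by (simp add: e_def R.minus_eq R.a_ac R.r_neg1 R.r_neg)
    have "w \<oplus>\<^bsub>V\<^esub> (d \<odot>\<^bsub>V\<^esub> v \<oplus>\<^bsub>V\<^esub> e \<odot>\<^bsub>V\<^esub> v) = u \<oplus>\<^bsub>V\<^esub> d \<odot>\<^bsub>V\<^esub> v"
      using * e v unfolding c' by (simp add: smult_l_distr)
    then have "d \<odot>\<^bsub>V\<^esub> v \<oplus>\<^bsub>V\<^esub> (w \<oplus>\<^bsub>V\<^esub> e \<odot>\<^bsub>V\<^esub> v) = d \<odot>\<^bsub>V\<^esub> v \<oplus>\<^bsub>V\<^esub> u"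
      using wu e * v by (simp add: M.a_ac)
    then have "w \<oplus>\<^bsub>V\<^esub> e \<odot>\<^bsub>V\<^esub> v = u" using wu e * v by simp
    then have "e \<odot>\<^bsub>V\<^esub> v = u \<ominus>\<^bsub>V\<^esub> w"
      using wu e v by (metis M.add.inv_solve_left' M.add.m_comm M.minus_eq smult_closed M.add.inv_closed)
    then have "e \<odot>\<^bsub>V\<^esub> v \<in> W" using subspace_minus[OF ssW] * by simp
    then have "inv\<^bsub>K\<^esub> e \<odot>\<^bsub>V\<^esub> (e \<odot>\<^bsub>V\<^esub> v) \<in> W"
      using ssW smult_inverse_cancel(2)[OF e v(1)] by (auto simp: subspace_def)
    then show False using smult_inverse_cancel(1)[OF e v(1)] vW by simp
  qed
  from dec obtain t w where t: "\<And>x. x \<in> carrier V \<Longrightarrow> t x \<in> carrier K \<and> w x \<in> W \<and> x = w x \<oplus>\<^bsub>V\<^esub> t x \<odot>\<^bsub>V\<^esub> v"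
    by metis
  have tI: "t x = c" if "x \<in> carrier V" "u \<in> W" "c \<in> carrier K" "x = u \<oplus>\<^bsub>V\<^esub> c \<odot>\<^bsub>V\<^esub> v" for x u c
    using uniq[of "w x" u "t x" c] t[of x] that by auto
  have "linear_form K V t"
    unfolding linear_form_def
  proof (intro conjI ballI)
    show "t \<in> carrier V \<rightarrow> carrier K" using t by auto
    fix x y assume xy: "x \<in> carrier V" "y \<in> carrier V"
    have cl: "w x \<in> carrier V" "w y \<in> carrier V" "t x \<in> carrier K" "t y \<in> carrier K" using t xy WV by auto
    have "x \<oplus>\<^bsub>V\<^esub> y = (w x \<oplus>\<^bsub>V\<^esub> t x \<odot>\<^bsub>V\<^esub> v) \<oplus>\<^bsub>V\<^esub> (w y \<oplus>\<^bsub>V\<^esub> t y \<odot>\<^bsub>V\<^esub> v)" using t xy by simp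
    also have "\<dots> = (w x \<oplus>\<^bsub>V\<^esub> w y) \<oplus>\<^bsub>V\<^esub> (t x \<oplus>\<^bsub>K\<^esub> t y) \<odot>\<^bsub>V\<^esub> v"
      using cl v by (simp add: smult_l_distr M.a_ac)
    finally show "t (x \<oplus>\<^bsub>V\<^esub> y) = t x \<oplus>\<^bsub>K\<^esub> t y"
      using t[OF xy(1)] t[OF xy(2)] xy cl v ssW
      by (intro tI[of _ "w x \<oplus>\<^bsub>V\<^esub> w y"]) (simp_all add: subspace_def)
  next
    fix c x assume cx: "c \<in> carrier K" "x \<in> carrier V"
    have cl: "w x \<in> carrier V" "t x \<in> carrier K" using t cx WV by auto
    have "c \<odot>\<^bsub>V\<^esub> x = c \<odot>\<^bsub>V\<^esub> (w x \<oplus>\<^bsub>V\<^esub> t x \<odot>\<^bsub>V\<^esub> v)" using t cx by simp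
    also have "\<dots> = c \<odot>\<^bsub>V\<^esub> w x \<oplus>\<^bsub>V\<^esub> (c \<otimes>\<^bsub>K\<^esub> t x) \<odot>\<^bsub>V\<^esub> v"
      using cl cx v by (simp add: smult_r_distr smult_assoc1)
    finally show "t (c \<odot>\<^bsub>V\<^esub> x) = c \<otimes>\<^bsub>K\<^esub> t x"
      using t[OF cx(2)] cx cl v ssW
      by (intro tI[of _ "c \<odot>\<^bsub>V\<^esub> w x"]) (simp_all add: subspace_def)
  qed
  moreover have "t v = \<one>\<^bsub>K\<^esub>"
    using tI[of v "\<zero>\<^bsub>V\<^esub>" "\<one>\<^bsub>K\<^esub>"] ssW v by (auto simp: subspace_def)
  ultimately show ?thesis by blast
qed

end

section \<open>Categories with domains and codomains\<close>

text \<open>With domain and codomain as functions, the side conditions of the category laws become equations that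
  rewriting can discharge.\<close>

context category begin

definition arr :: "'m \<Rightarrow> bool" where
  "arr f \<longleftrightarrow> (\<exists>X \<in> Obj C. \<exists>Y \<in> Obj C. f \<in> mor C X Y)"

definition src :: "'m \<Rightarrow> 'o" where
  "src f = (THE X. X \<in> Obj C \<and> (\<exists>Y \<in> Obj C. f \<in> mor C X Y))"

definition tgt :: "'m \<Rightarrow> 'o" where
  "tgt f = (THE Y. Y \<in> Obj C \<and> (\<exists>X \<in> Obj C. f \<in> mor C X Y))"

abbreviation in_hom :: "'m \<Rightarrow> 'o \<Rightarrow> 'o \<Rightarrow> bool" where
  "in_hom f X Y \<equiv> arr f \<and> src f = X \<and> tgt f = Y"

lemma src_tgt_eqI:
  assumes "X \<in> Obj C" "Y \<in> Obj C" "f \<in> mor C X Y"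
  shows "src f = X" "tgt f = Y"
proof -
  show "src f = X" unfolding src_def
    by (rule the_equality) (use assms mor_disjoint in blast)+
  show "tgt f = Y" unfolding tgt_def
    by (rule the_equality) (use assms mor_disjoint in blast)+
qed

lemma mor_iff: "\<lbrakk> X \<in> Obj C; Y \<in> Obj C \<rbrakk> \<Longrightarrow> f \<in> mor C X Y \<longleftrightarrow> in_hom f X Y"
  by (metis arr_def src_tgt_eqI)

lemma arr_obj [simp]: "arr f \<Longrightarrow> src f \<in> Obj C" "arr f \<Longrightarrow> tgt f \<in> Obj C"
  by (metis arr_def src_tgt_eqI)+

lemma in_homI: "\<lbrakk> f \<in> mor C X Y; X \<in> Obj C; Y \<in> Obj C \<rbrakk> \<Longrightarrow> in_hom f X Y"
  by (simp add: mor_iff)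

lemma in_mor [simp]: "arr f \<Longrightarrow> src f = X \<Longrightarrow> tgt f = Y \<Longrightarrow> f \<in> mor C X Y"
  using mor_iff by auto

lemma ident_simps [simp]:
  assumes "X \<in> Obj C"
  shows "arr (Ident C X)" "src (Ident C X) = X" "tgt (Ident C X) = X"
  using in_homI[OF ident_mor] assms by auto

lemma comp_simps [simp]:
  assumes "arr f" "arr g" "tgt f = src g"
  shows "arr (g \<bullet> f)" "src (g \<bullet> f) = src f" "tgt (g \<bullet> f) = tgt g"
  using in_homI[OF comp_mor[of "src f" "src g" "tgt g" f g]] assms by auto

lemma comp_ident [simp]:
  "arr f \<Longrightarrow> tgt f = Y \<Longrightarrow> Ident C Y \<bullet> f = f" "arr f \<Longrightarrow> src f = X \<Longrightarrow> f \<bullet> Ident C X = f"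
  using comp_ident_left[of "src f" "tgt f" f] comp_ident_right[of "src f" "tgt f" f] by auto

lemma comp_assoc' [simp]:
  "\<lbrakk> arr f; arr g; arr h; tgt f = src g; tgt g = src h \<rbrakk> \<Longrightarrow> (h \<bullet> g) \<bullet> f = h \<bullet> g \<bullet> f"
  using comp_assoc[of "src f" "src g" "src h" "tgt h"] by auto

text \<open>Rewriting modulo associativity: an equation between composites may be applied inside a longer one.\<close>

lemma comp_reduce:
  assumes "g \<bullet> f = h" "arr f" "arr g" "arr k" "tgt f = src g" "tgt k = src f"
  shows "g \<bullet> f \<bullet> k = h \<bullet> k"
  using assms comp_assoc'[of k f g] by simp

subsection \<open>Isomorphisms\<close>

definition iso :: "'m \<Rightarrow> bool" where
  "iso f \<longleftrightarrow> (\<exists>g. arr f \<and> arr g \<and> src g = tgt f \<and> tgt g = src f \<and>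
     g \<bullet> f = Ident C (src f) \<and> f \<bullet> g = Ident C (tgt f))"

lemma iso_arr [simp]: "iso f \<Longrightarrow> arr f" unfolding iso_def by (elim exE conjE)

lemma isoI:
  "\<lbrakk> arr f; arr g; src g = tgt f; tgt g = src f; g \<bullet> f = Ident C (src f); f \<bullet> g = Ident C (tgt f) \<rbrakk> \<Longrightarrow> iso f"
  unfolding iso_def by (intro exI conjI)

lemma is_iso_iff: "\<lbrakk> X \<in> Obj C; Y \<in> Obj C \<rbrakk> \<Longrightarrow> is_iso C X Y f \<longleftrightarrow> iso f \<and> src f = X \<and> tgt f = Y"
  unfolding is_iso_def iso_def Bex_def by (simp add: mor_iff) metis

lemma inverse_unique:
  assumes "arr f" "in_hom g (tgt f) (src f)" "in_hom h (tgt f) (src f)"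
    "g \<bullet> f = Ident C (src f)" "f \<bullet> h = Ident C (tgt f)"
  shows "g = h"
proof -
  have "g = g \<bullet> f \<bullet> h" using assms by simp
  also have "\<dots> = (g \<bullet> f) \<bullet> h" using assms by (subst comp_assoc') auto
  also have "\<dots> = h" using assms by simp
  finally show ?thesis .
qed

lemma minv_eqI:
  assumes "arr f" "in_hom g (tgt f) (src f)" "g \<bullet> f = Ident C (src f)" "f \<bullet> g = Ident C (tgt f)"
  shows "minv C f = g"
  unfolding minv_def
proof (rule the_equality)
  show "\<exists>X \<in> Obj C. \<exists>Y \<in> Obj C. f \<in> mor C X Y \<and> g \<in> mor C Y X \<and> g \<bullet> f = Ident C X \<and> f \<bullet> g = Ident C Y"
    using assms by (intro bexI[of _ "src f"] bexI[of _ "tgt f"]) auto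
  fix h assume "\<exists>X \<in> Obj C. \<exists>Y \<in> Obj C. f \<in> mor C X Y \<and> h \<in> mor C Y X \<and> h \<bullet> f = Ident C X \<and> f \<bullet> h = Ident C Y"
  then have "in_hom h (tgt f) (src f)" "h \<bullet> f = Ident C (src f)" by (auto simp: mor_iff)
  then show "h = g" using assms by (intro inverse_unique[of f h g]) auto
qed

lemma minv_simps [simp]:
  assumes "iso f"
  shows "arr (minv C f)" "src (minv C f) = tgt f" "tgt (minv C f) = src f"
    and minv_comp: "minv C f \<bullet> f = Ident C (src f)" and comp_minv: "f \<bullet> minv C f = Ident C (tgt f)"
proof -
  obtain g where "arr f \<and> arr g \<and> src g = tgt f \<and> tgt g = src f \<and>
     g \<bullet> f = Ident C (src f) \<and> f \<bullet> g = Ident C (tgt f)"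
    using assms unfolding iso_def ..
  then have g: "arr f" "in_hom g (tgt f) (src f)" "g \<bullet> f = Ident C (src f)" "f \<bullet> g = Ident C (tgt f)"
    by simp_all
  then have "minv C f = g" by (rule minv_eqI)
  with g show "arr (minv C f)" "src (minv C f) = tgt f" "tgt (minv C f) = src f"
    "minv C f \<bullet> f = Ident C (src f)" "f \<bullet> minv C f = Ident C (tgt f)" by simp_all
qed

lemma minv_cancel [simp]:
  assumes "iso f" "arr k"
  shows "tgt k = src f \<Longrightarrow> minv C f \<bullet> f \<bullet> k = k" "tgt k = tgt f \<Longrightarrow> f \<bullet> minv C f \<bullet> k = k"
  using assms by (simp_all add: comp_reduce[OF minv_comp] comp_reduce[OF comp_minv])

lemma iso_minv [simp]: "iso f \<Longrightarrow> iso (minv C f)"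
  by (rule isoI[of _ f]) (simp_all add: minv_comp comp_minv)

lemma minv_minv [simp]: "iso f \<Longrightarrow> minv C (minv C f) = f"
  by (rule minv_eqI) (simp_all add: minv_comp comp_minv)

lemma iso_ident [simp]: "X \<in> Obj C \<Longrightarrow> iso (Ident C X)"
  by (rule isoI[of _ "Ident C X"]) simp_all

lemma iso_comp [simp]: "\<lbrakk> iso f; iso g; tgt f = src g \<rbrakk> \<Longrightarrow> iso (g \<bullet> f)"
  by (rule isoI[of _ "minv C f \<bullet> minv C g"]) (simp_all add: minv_comp comp_minv)

lemma minv_comp_distrib: "\<lbrakk> iso f; iso g; tgt f = src g \<rbrakk> \<Longrightarrow> minv C (g \<bullet> f) = minv C f \<bullet> minv C g"
  by (rule minv_eqI) (simp_all add: minv_comp comp_minv)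

lemma iso_cancel_left: "\<lbrakk> iso f; arr g; arr h; tgt g = src f; tgt h = src f; f \<bullet> g = f \<bullet> h \<rbrakk> \<Longrightarrow> g = h"
  by (metis minv_cancel(1))

lemma iso_cancel_right:
  assumes "iso f" "arr g" "arr h" "src g = tgt f" "src h = tgt f" "g \<bullet> f = h \<bullet> f"
  shows "g = h"
proof -
  have "g = (g \<bullet> f) \<bullet> minv C f" using assms(1-5) by (simp add: comp_minv)
  also have "\<dots> = (h \<bullet> f) \<bullet> minv C f" using assms(6) by simp
  also have "\<dots> = h" using assms(1-5) by (simp add: comp_minv)
  finally show ?thesis .
qed

lemma isomorphicI: "\<lbrakk> iso f; src f = X; tgt f = Y \<rbrakk> \<Longrightarrow> isomorphic C X Y"
  unfolding isomorphic_def by (intro exI[of _ f]) (use is_iso_iff in force)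

lemma isomorphicE:
  assumes "isomorphic C X Y" "X \<in> Obj C" "Y \<in> Obj C"
  obtains f where "iso f" "src f = X" "tgt f = Y"
  using assms is_iso_iff unfolding isomorphic_def by blast

lemma isomorphic_sym: "\<lbrakk> isomorphic C X Y; X \<in> Obj C; Y \<in> Obj C \<rbrakk> \<Longrightarrow> isomorphic C Y X"
  by (erule isomorphicE) (auto intro: isomorphicI[OF iso_minv])

lemma isomorphic_trans:
  assumes "isomorphic C X Y" "isomorphic C Y Z" "X \<in> Obj C" "Y \<in> Obj C" "Z \<in> Obj C"
  shows "isomorphic C X Z"
proof -
  obtain f where "iso f" "src f = X" "tgt f = Y" using assms isomorphicE by metis
  moreover obtain g where "iso g" "src g = Y" "tgt g = Z" using assms isomorphicE by metis
  ultimately show ?thesis by (intro isomorphicI[of "g \<bullet> f"]) auto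
qed

subsection \<open>Monomorphisms and epimorphisms\<close>

lemma is_mono_iff:
  assumes "X \<in> Obj C" "Y \<in> Obj C"
  shows "is_mono C X Y f \<longleftrightarrow> in_hom f X Y \<and>
    (\<forall>g h. arr g \<longrightarrow> arr h \<longrightarrow> tgt g = X \<longrightarrow> tgt h = X \<longrightarrow> src h = src g \<longrightarrow> f \<bullet> g = f \<bullet> h \<longrightarrow> g = h)"
proof
  assume "is_mono C X Y f"
  then have f: "in_hom f X Y" using assms by (simp add: is_mono_def mor_iff)
  have c: "\<And>W g h. \<lbrakk> W \<in> Obj C; g \<in> mor C W X; h \<in> mor C W X; f \<bullet> g = f \<bullet> h \<rbrakk> \<Longrightarrow> g = h"
    using \<open>is_mono C X Y f\<close> unfolding is_mono_def by blast
  have "g = h" if "arr g" "arr h" "tgt g = X" "tgt h = X" "src h = src g" "f \<bullet> g = f \<bullet> h" for g h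
    using that by (intro c[of "src g" g h]) simp_all
  then show "in_hom f X Y \<and>
    (\<forall>g h. arr g \<longrightarrow> arr h \<longrightarrow> tgt g = X \<longrightarrow> tgt h = X \<longrightarrow> src h = src g \<longrightarrow> f \<bullet> g = f \<bullet> h \<longrightarrow> g = h)"
    using f by blast
qed (use assms in \<open>simp add: is_mono_def mor_iff\<close>)

lemma is_epi_iff:
  assumes "X \<in> Obj C" "Y \<in> Obj C"
  shows "is_epi C X Y f \<longleftrightarrow> in_hom f X Y \<and>
    (\<forall>g h. arr g \<longrightarrow> arr h \<longrightarrow> src g = Y \<longrightarrow> src h = Y \<longrightarrow> tgt h = tgt g \<longrightarrow> g \<bullet> f = h \<bullet> f \<longrightarrow> g = h)"
proof
  assume "is_epi C X Y f"
  then have f: "in_hom f X Y" using assms by (simp add: is_epi_def mor_iff)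
  have c: "\<And>W g h. \<lbrakk> W \<in> Obj C; g \<in> mor C Y W; h \<in> mor C Y W; g \<bullet> f = h \<bullet> f \<rbrakk> \<Longrightarrow> g = h"
    using \<open>is_epi C X Y f\<close> unfolding is_epi_def by blast
  have "g = h" if "arr g" "arr h" "src g = Y" "src h = Y" "tgt h = tgt g" "g \<bullet> f = h \<bullet> f" for g h
    using that by (intro c[of "tgt g" g h]) simp_all
  then show "in_hom f X Y \<and>
    (\<forall>g h. arr g \<longrightarrow> arr h \<longrightarrow> src g = Y \<longrightarrow> src h = Y \<longrightarrow> tgt h = tgt g \<longrightarrow> g \<bullet> f = h \<bullet> f \<longrightarrow> g = h)"
    using f by blast
qed (use assms in \<open>simp add: is_epi_def mor_iff\<close>)

definition mono :: "'m \<Rightarrow> bool" where "mono f \<longleftrightarrow> arr f \<and> is_mono C (src f) (tgt f) f"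

definition epi :: "'m \<Rightarrow> bool" where "epi f \<longleftrightarrow> arr f \<and> is_epi C (src f) (tgt f) f"

lemma mono_arr [simp]: "mono f \<Longrightarrow> arr f" and epi_arr [simp]: "epi f \<Longrightarrow> arr f"
  by (auto simp: mono_def epi_def)

lemma monoD: "\<lbrakk> mono f; f \<bullet> g = f \<bullet> h; arr g; arr h; tgt g = src f; tgt h = src f; src h = src g \<rbrakk> \<Longrightarrow> g = h"
  unfolding mono_def by (auto simp: is_mono_iff)

lemma epiD: "\<lbrakk> epi f; g \<bullet> f = h \<bullet> f; arr g; arr h; src g = tgt f; src h = tgt f; tgt h = tgt g \<rbrakk> \<Longrightarrow> g = h"
  unfolding epi_def by (auto simp: is_epi_iff)

lemma monoI:
  assumes "arr f"
    "\<And>g h. \<lbrakk> arr g; arr h; tgt g = src f; tgt h = src f; src h = src g; f \<bullet> g = f \<bullet> h \<rbrakk> \<Longrightarrow> g = h"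
  shows "mono f"
  unfolding mono_def using assms by (auto simp: is_mono_iff)

lemma epiI:
  assumes "arr f"
    "\<And>g h. \<lbrakk> arr g; arr h; src g = tgt f; src h = tgt f; tgt h = tgt g; g \<bullet> f = h \<bullet> f \<rbrakk> \<Longrightarrow> g = h"
  shows "epi f"
  unfolding epi_def using assms by (auto simp: is_epi_iff)

lemma is_mono_iff_mono: "\<lbrakk> X \<in> Obj C; Y \<in> Obj C \<rbrakk> \<Longrightarrow> is_mono C X Y f \<longleftrightarrow> mono f \<and> src f = X \<and> tgt f = Y"
  unfolding mono_def by (auto simp: is_mono_def mor_iff)

lemma is_epi_iff_epi: "\<lbrakk> X \<in> Obj C; Y \<in> Obj C \<rbrakk> \<Longrightarrow> is_epi C X Y f \<longleftrightarrow> epi f \<and> src f = X \<and> tgt f = Y"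
  unfolding epi_def by (auto simp: is_epi_def mor_iff)

lemma mono_comp:
  assumes "mono f" "mono g" "tgt f = src g" shows "mono (g \<bullet> f)"
proof (rule monoI)
  fix h k assume *: "arr h" "arr k" "tgt h = src (g \<bullet> f)" "tgt k = src (g \<bullet> f)" "src k = src h"
    "(g \<bullet> f) \<bullet> h = (g \<bullet> f) \<bullet> k"
  have "g \<bullet> f \<bullet> h = g \<bullet> f \<bullet> k" using *(1-5) assms by (simp flip: comp_assoc' add: *(6))
  then have "f \<bullet> h = f \<bullet> k" by (rule monoD[OF assms(2)]) (use * assms in simp_all)
  then show "h = k" by (rule monoD[OF assms(1)]) (use * assms in simp_all)
qed (use assms in simp)

lemma epi_comp:
  assumes "epi f" "epi g" "tgt f = src g" shows "epi (g \<bullet> f)"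
proof (rule epiI)
  fix h k assume *: "arr h" "arr k" "src h = tgt (g \<bullet> f)" "src k = tgt (g \<bullet> f)" "tgt k = tgt h"
    "h \<bullet> g \<bullet> f = k \<bullet> g \<bullet> f"
  then have "(h \<bullet> g) \<bullet> f = (k \<bullet> g) \<bullet> f" using assms by simp
  then have "h \<bullet> g = k \<bullet> g" by (rule epiD[OF assms(1)]) (use * assms in simp_all)
  then show "h = k" by (rule epiD[OF assms(2)]) (use * assms in simp_all)
qed (use assms in simp)

lemma epi_of_comp:
  assumes "epi (g \<bullet> f)" "arr f" "arr g" "tgt f = src g" shows "epi g"
proof (rule epiI)
  fix h k assume *: "arr h" "arr k" "src h = tgt g" "src k = tgt g" "tgt k = tgt h" "h \<bullet> g = k \<bullet> g"
  have "h \<bullet> g \<bullet> f = (h \<bullet> g) \<bullet> f" using *(1-5) assms by simp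
  also have "\<dots> = k \<bullet> g \<bullet> f" using * assms by simp
  finally show "h = k" by (rule epiD[OF assms(1)]) (use * assms in simp_all)
qed (use assms in simp)

lemma iso_mono: "iso f \<Longrightarrow> mono f"
  by (rule monoI) (simp, rule iso_cancel_left)

lemma iso_epi: "iso f \<Longrightarrow> epi f"
  by (rule epiI) (simp, rule iso_cancel_right)

lemma is_projective_iff:
  "is_projective C P \<longleftrightarrow> P \<in> Obj C \<and>
     (\<forall>e f. epi e \<longrightarrow> arr f \<longrightarrow> src f = P \<longrightarrow> tgt f = tgt e \<longrightarrow> (\<exists>g. in_hom g P (src e) \<and> e \<bullet> g = f))"
    (is "_ \<longleftrightarrow> _ \<and> ?R")
proof (cases "P \<in> Obj C")
  case P: True
  show ?thesis
  proof
    assume L: "is_projective C P"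
    have ?R
    proof (intro allI impI)
      fix e f assume *: "epi e" "arr f" "src f = P" "tgt f = tgt e"
      then have "is_epi C (src e) (tgt e) e" by (simp add: is_epi_iff_epi)
      moreover have "f \<in> mor C P (tgt e)" "src e \<in> Obj C" "tgt e \<in> Obj C" using * by simp_all
      ultimately have "\<exists>g \<in> mor C P (src e). e \<bullet> g = f" using L unfolding is_projective_def by blast
      then obtain g where "g \<in> mor C P (src e)" "e \<bullet> g = f" ..
      then show "\<exists>g. in_hom g P (src e) \<and> e \<bullet> g = f" using P *(1) by (intro exI[of _ g]) (simp add: mor_iff)
    qed
    then show "P \<in> Obj C \<and> ?R" using P by blast
  next
    assume R: "P \<in> Obj C \<and> ?R"
    show "is_projective C P"
      unfolding is_projective_def
    proof (intro conjI P ballI allI impI)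
      fix X Y e f assume "X \<in> Obj C" "Y \<in> Obj C" "is_epi C X Y e" "f \<in> mor C P Y"
      then have "epi e" "src e = X" "in_hom f P (tgt e)" using P by (simp_all add: is_epi_iff_epi mor_iff)
      then obtain g where "in_hom g P (src e)" "e \<bullet> g = f" using R by blast
      then show "\<exists>g \<in> mor C P X. e \<bullet> g = f" using \<open>src e = X\<close> by (intro bexI[of _ g]) simp_all
    qed
  qed
next
  case False
  then show ?thesis by (simp add: is_projective_def)
qed

lemma projective_lift:
  assumes "is_projective C P" "epi e" "arr f" "src f = P" "tgt f = tgt e"
  obtains g where "in_hom g P (src e)" "e \<bullet> g = f"
  using assms is_projective_iff by blast

end

section \<open>Tensoring with a rigid object\<close>

context monoidal_category begin

declare tens_obj [simp] unit_obj [simp] tens_ident [simp]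

lemma tens_simps [simp]:
  assumes "arr f" "arr g"
  shows "arr (f \<star> g)" "src (f \<star> g) = src f \<boxtimes> src g" "tgt (f \<star> g) = tgt f \<boxtimes> tgt g"
proof -
  have "in_hom (f \<star> g) (src f \<boxtimes> src g) (tgt f \<boxtimes> tgt g)"
    by (rule in_homI[OF tens_mor]) (use assms in simp_all)
  then show "arr (f \<star> g)" "src (f \<star> g) = src f \<boxtimes> src g" "tgt (f \<star> g) = tgt f \<boxtimes> tgt g" by simp_all
qed

lemma interchange:
  assumes "arr f" "arr g" "arr f'" "arr g'" "tgt f = src f'" "tgt g = src g'"
  shows "(f' \<star> g') \<bullet> (f \<star> g) = (f' \<bullet> f) \<star> (g' \<bullet> g)"
  by (rule tens_comp[symmetric, of "src f" "src g" "src f'" "src g'" "tgt f'" "tgt g'"]) (use assms in simp_all)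

lemma interchange':
  assumes "arr f" "arr g" "arr f'" "arr g'" "tgt f = src f'" "tgt g = src g'" "arr k" "tgt k = src f \<boxtimes> src g"
  shows "(f' \<star> g') \<bullet> (f \<star> g) \<bullet> k = ((f' \<bullet> f) \<star> (g' \<bullet> g)) \<bullet> k"
  by (rule comp_reduce[OF interchange]) (use assms in simp_all)

lemma whisker_left: "\<lbrakk> X \<in> Obj C; arr f; arr g; tgt f = src g \<rbrakk> \<Longrightarrow> Ident C X \<star> (g \<bullet> f) = (Ident C X \<star> g) \<bullet> (Ident C X \<star> f)"
  by (simp add: interchange)

lemma whisker_right: "\<lbrakk> X \<in> Obj C; arr f; arr g; tgt f = src g \<rbrakk> \<Longrightarrow> (g \<bullet> f) \<star> Ident C X = (g \<star> Ident C X) \<bullet> (f \<star> Ident C X)"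
  by (simp add: interchange)

lemma iso_tens [simp]: "\<lbrakk> iso f; iso g \<rbrakk> \<Longrightarrow> iso (f \<star> g)"
  by (rule isoI[of _ "minv C f \<star> minv C g"]) (simp_all add: interchange minv_comp comp_minv)

lemma minv_tens: "\<lbrakk> iso f; iso g \<rbrakk> \<Longrightarrow> minv C (f \<star> g) = minv C f \<star> minv C g"
  by (rule minv_eqI) (simp_all add: interchange minv_comp comp_minv)

lemma minv_ident [simp]: "X \<in> Obj C \<Longrightarrow> minv C (Ident C X) = Ident C X"
  by (rule minv_eqI) simp_all

lemma assoc_simps [simp]:
  assumes "X \<in> Obj C" "Y \<in> Obj C" "Z \<in> Obj C"
  shows "iso (Assoc C X Y Z)" "src (Assoc C X Y Z) = (X \<boxtimes> Y) \<boxtimes> Z" "tgt (Assoc C X Y Z) = X \<boxtimes> (Y \<boxtimes> Z)"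
  using assoc_iso[OF assms] assms by (simp_all add: is_iso_iff)

lemma unitor_simps [simp]:
  assumes "X \<in> Obj C"
  shows "iso (LUnitor C X)" "src (LUnitor C X) = TUnit C \<boxtimes> X" "tgt (LUnitor C X) = X"
    "iso (RUnitor C X)" "src (RUnitor C X) = X \<boxtimes> TUnit C" "tgt (RUnitor C X) = X"
  using lunitor_iso[OF assms] runitor_iso[OF assms] assms by (simp_all add: is_iso_iff)

lemma assoc_nat:
  assumes "arr f" "arr g" "arr h"
  shows "Assoc C (tgt f) (tgt g) (tgt h) \<bullet> ((f \<star> g) \<star> h) = (f \<star> (g \<star> h)) \<bullet> Assoc C (src f) (src g) (src h)"
  by (rule assoc_natural) (use assms in simp_all)

lemma assoc_inv_nat:
  assumes "arr f" "arr g" "arr h"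
  shows "minv C (Assoc C (tgt f) (tgt g) (tgt h)) \<bullet> (f \<star> (g \<star> h)) =
    ((f \<star> g) \<star> h) \<bullet> minv C (Assoc C (src f) (src g) (src h))"
proof -
  let ?a = "Assoc C (src f) (src g) (src h)" and ?b = "Assoc C (tgt f) (tgt g) (tgt h)"
  have "((f \<star> g) \<star> h) \<bullet> minv C ?a = minv C ?b \<bullet> (?b \<bullet> ((f \<star> g) \<star> h)) \<bullet> minv C ?a"
    using assms by simp
  also have "\<dots> = minv C ?b \<bullet> ((f \<star> (g \<star> h)) \<bullet> ?a) \<bullet> minv C ?a" using assms by (simp only: assoc_nat)
  also have "\<dots> = minv C ?b \<bullet> (f \<star> (g \<star> h))" using assms by (simp add: comp_minv)
  finally show ?thesis by (rule sym)
qed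

lemma lunitor_nat: "\<lbrakk> arr f; tgt f = Y \<rbrakk> \<Longrightarrow> LUnitor C Y \<bullet> (Ident C (TUnit C) \<star> f) = f \<bullet> LUnitor C (src f)"
  by (rule lunitor_natural) auto

lemma lunitor_inv_nat:
  assumes "arr f"
  shows "minv C (LUnitor C (tgt f)) \<bullet> f = (Ident C (TUnit C) \<star> f) \<bullet> minv C (LUnitor C (src f))"
proof -
  let ?l = "LUnitor C (tgt f)" and ?k = "LUnitor C (src f)" and ?f = "Ident C (TUnit C) \<star> f"
  have "?f \<bullet> minv C ?k = minv C ?l \<bullet> (?l \<bullet> ?f) \<bullet> minv C ?k" using assms by simp
  also have "\<dots> = minv C ?l \<bullet> (f \<bullet> ?k) \<bullet> minv C ?k" using assms by (simp only: lunitor_nat)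
  also have "\<dots> = minv C ?l \<bullet> f" using assms by (simp add: comp_minv)
  finally show ?thesis by (rule sym)
qed

lemma tens_unit_cancel:
  assumes "arr f" "arr g" "tgt f = tgt g" "src f = src g"
    and "Ident C (TUnit C) \<star> f = Ident C (TUnit C) \<star> g"
  shows "f = g"
proof (rule iso_cancel_right[of "LUnitor C (src f)"])
  show "f \<bullet> LUnitor C (src f) = g \<bullet> LUnitor C (src f)"
    using lunitor_nat[of f "tgt f"] lunitor_nat[of g "tgt f"] assms by simp
qed (use assms in simp_all)

text \<open>Kelly's derivation of the unit coherence for a product from the pentagon and the triangle: both sides agree
  after tensoring with the unit object, which is a faithful operation.\<close>

lemma lunitor_tens:
  assumes X: "X \<in> Obj C" and Y: "Y \<in> Obj C"
  shows "LUnitor C (X \<boxtimes> Y) \<bullet> Assoc C (TUnit C) X Y = LUnitor C X \<star> Ident C Y"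
proof -
  let ?I = "TUnit C" and ?i = "Ident C (TUnit C)" and ?y = "Ident C Y"
  let ?m = "Assoc C ?I (?I \<boxtimes> X) Y \<bullet> (Assoc C ?I ?I X \<star> ?y)"
  have "(?i \<star> (LUnitor C (X \<boxtimes> Y) \<bullet> Assoc C ?I X Y)) \<bullet> ?m
      = (?i \<star> LUnitor C (X \<boxtimes> Y)) \<bullet> (?i \<star> Assoc C ?I X Y) \<bullet> ?m"
    using X Y by (simp add: whisker_left)
  also have "\<dots> = (?i \<star> LUnitor C (X \<boxtimes> Y)) \<bullet> Assoc C ?I ?I (X \<boxtimes> Y) \<bullet> Assoc C (?I \<boxtimes> ?I) X Y"
    using X Y by (simp add: pentagon)
  also have "\<dots> = (RUnitor C ?I \<star> Ident C (X \<boxtimes> Y)) \<bullet> Assoc C (?I \<boxtimes> ?I) X Y"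
    by (rule comp_reduce[OF triangle]) (use X Y in simp_all)
  also have "\<dots> = Assoc C ?I X Y \<bullet> ((RUnitor C ?I \<star> Ident C X) \<star> ?y)"
    using assoc_nat[of "RUnitor C ?I" "Ident C X" "?y"] X Y by simp
  also have "\<dots> = Assoc C ?I X Y \<bullet> ((?i \<star> LUnitor C X) \<star> ?y) \<bullet> (Assoc C ?I ?I X \<star> ?y)"
    using X Y by (simp add: triangle[symmetric] whisker_right)
  also have "\<dots> = ((?i \<star> (LUnitor C X \<star> ?y)) \<bullet> Assoc C ?I (?I \<boxtimes> X) Y) \<bullet> (Assoc C ?I ?I X \<star> ?y)"
    using assoc_nat[of ?i "LUnitor C X" ?y] X Y by (simp flip: comp_assoc')
  also have "\<dots> = (?i \<star> (LUnitor C X \<star> ?y)) \<bullet> ?m"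
    using X Y by simp
  finally have "?i \<star> (LUnitor C (X \<boxtimes> Y) \<bullet> Assoc C ?I X Y) = ?i \<star> (LUnitor C X \<star> ?y)"
    by (rule iso_cancel_right[rotated -1]) (use X Y in simp_all)
  then show ?thesis
    by (rule tens_unit_cancel[rotated -1]) (use X Y in simp_all)
qed

definition coev :: "'o \<Rightarrow> 'o \<Rightarrow> 'm \<Rightarrow> 'o \<Rightarrow> 'm" where
  "coev X' X d Z = Assoc C X X' Z \<bullet> (d \<star> Ident C Z) \<bullet> minv C (LUnitor C Z)"

definition ev :: "'o \<Rightarrow> 'o \<Rightarrow> 'm \<Rightarrow> 'o \<Rightarrow> 'm" where
  "ev X' X e Z = LUnitor C Z \<bullet> (e \<star> Ident C Z) \<bullet> minv C (Assoc C X' X Z)"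

end

text \<open>The unit and the counit of the adjunction between \<open>X' \<boxtimes> -\<close> and \<open>X \<boxtimes> -\<close>, and its triangle identities.\<close>

locale duality = monoidal_category +
  fixes X' X e d
  assumes dual: "is_duality C X' X e d"
begin

lemma dual_simps [simp]:
  "X \<in> Obj C" "X' \<in> Obj C"
  "arr e" "src e = X' \<boxtimes> X" "tgt e = TUnit C"
  "arr d" "src d = TUnit C" "tgt d = X \<boxtimes> X'"
proof -
  have "X \<in> Obj C" "X' \<in> Obj C" "e \<in> mor C (X' \<boxtimes> X) (TUnit C)" "d \<in> mor C (TUnit C) (X \<boxtimes> X')"
    using dual unfolding is_duality_def by blast+
  then show "X \<in> Obj C" "X' \<in> Obj C" "arr e" "src e = X' \<boxtimes> X" "tgt e = TUnit C"
    "arr d" "src d = TUnit C" "tgt d = X \<boxtimes> X'"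
    by (simp_all add: mor_iff)
qed

abbreviation "\<eta> Z \<equiv> coev X' X d Z"
abbreviation "\<epsilon> Z \<equiv> ev X' X e Z"

lemma coev_simps [simp]:
  assumes "Z \<in> Obj C"
  shows "arr (\<eta> Z)" "src (\<eta> Z) = Z" "tgt (\<eta> Z) = X \<boxtimes> (X' \<boxtimes> Z)"
  using assms by (simp_all add: coev_def)

lemma ev_simps [simp]:
  assumes "Z \<in> Obj C"
  shows "arr (\<epsilon> Z)" "src (\<epsilon> Z) = X' \<boxtimes> (X \<boxtimes> Z)" "tgt (\<epsilon> Z) = Z"
  using assms by (simp_all add: ev_def)

lemma coev_nat:
  assumes "arr g" "src g = Y" "tgt g = Z"
  shows "\<eta> Z \<bullet> g = (Ident C X \<star> (Ident C X' \<star> g)) \<bullet> \<eta> Y"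
proof -
  have [simp]: "Y \<in> Obj C" "Z \<in> Obj C" using assms by auto
  have "\<eta> Z \<bullet> g = Assoc C X X' Z \<bullet> (d \<star> Ident C Z) \<bullet> minv C (LUnitor C Z) \<bullet> g"
    using assms by (simp add: coev_def)
  also have "\<dots> = Assoc C X X' Z \<bullet> ((d \<star> Ident C Z) \<bullet> (Ident C (TUnit C) \<star> g)) \<bullet> minv C (LUnitor C Y)"
    using lunitor_inv_nat[of g] assms by simp
  also have "(d \<star> Ident C Z) \<bullet> (Ident C (TUnit C) \<star> g) = (Ident C (X \<boxtimes> X') \<star> g) \<bullet> (d \<star> Ident C Y)"
    using assms by (simp add: interchange)
  also have "Assoc C X X' Z \<bullet> ((Ident C (X \<boxtimes> X') \<star> g) \<bullet> (d \<star> Ident C Y)) \<bullet> minv C (LUnitor C Y)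
    = (Assoc C X X' Z \<bullet> (Ident C (X \<boxtimes> X') \<star> g)) \<bullet> (d \<star> Ident C Y) \<bullet> minv C (LUnitor C Y)"
    using assms by simp
  also have "Assoc C X X' Z \<bullet> (Ident C (X \<boxtimes> X') \<star> g) = (Ident C X \<star> (Ident C X' \<star> g)) \<bullet> Assoc C X X' Y"
    using assoc_nat[of "Ident C X" "Ident C X'" g] assms by simp
  finally show ?thesis using assms by (simp add: coev_def)
qed

lemma ev_nat:
  assumes "arr g" "src g = Y" "tgt g = Z"
  shows "\<epsilon> Z \<bullet> (Ident C X' \<star> (Ident C X \<star> g)) = g \<bullet> \<epsilon> Y"
proof -
  have [simp]: "Y \<in> Obj C" "Z \<in> Obj C" using assms by auto
  have "\<epsilon> Z \<bullet> (Ident C X' \<star> (Ident C X \<star> g))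
      = LUnitor C Z \<bullet> (e \<star> Ident C Z) \<bullet> minv C (Assoc C X' X Z) \<bullet> (Ident C X' \<star> (Ident C X \<star> g))"
    using assms by (simp add: ev_def)
  also have "\<dots> = LUnitor C Z \<bullet> ((e \<star> Ident C Z) \<bullet> (Ident C (X' \<boxtimes> X) \<star> g)) \<bullet> minv C (Assoc C X' X Y)"
    using assoc_inv_nat[of "Ident C X'" "Ident C X" g] assms by simp
  also have "(e \<star> Ident C Z) \<bullet> (Ident C (X' \<boxtimes> X) \<star> g) = (Ident C (TUnit C) \<star> g) \<bullet> (e \<star> Ident C Y)"
    using assms by (simp add: interchange)
  also have "LUnitor C Z \<bullet> ((Ident C (TUnit C) \<star> g) \<bullet> (e \<star> Ident C Y)) \<bullet> minv C (Assoc C X' X Y)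
    = (LUnitor C Z \<bullet> (Ident C (TUnit C) \<star> g)) \<bullet> (e \<star> Ident C Y) \<bullet> minv C (Assoc C X' X Y)"
    using assms by simp
  also have "LUnitor C Z \<bullet> (Ident C (TUnit C) \<star> g) = g \<bullet> LUnitor C Y"
    using lunitor_nat[of g Z] assms by simp
  finally show ?thesis using assms by (simp add: ev_def)
qed

text \<open>By coherence the composite is the first zigzag identity of the duality, tensored with \<open>Y\<close>.\<close>

lemma triangle_unit:
  assumes Y: "Y \<in> Obj C"
  shows "(Ident C X \<star> \<epsilon> Y) \<bullet> \<eta> (X \<boxtimes> Y) = Ident C (X \<boxtimes> Y)"
proof -
  note [simp] = Y
  let ?I = "TUnit C" and ?x = "Ident C X" and ?y = "Ident C Y"
  have b: "(?x \<star> minv C (Assoc C X' X Y)) \<bullet> Assoc C X X' (X \<boxtimes> Y)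
      = Assoc C X (X' \<boxtimes> X) Y \<bullet> (Assoc C X X' X \<star> ?y) \<bullet> minv C (Assoc C (X \<boxtimes> X') X Y)"
  proof (rule iso_cancel_right[of "Assoc C (X \<boxtimes> X') X Y"])
    have "((?x \<star> minv C (Assoc C X' X Y)) \<bullet> Assoc C X X' (X \<boxtimes> Y)) \<bullet> Assoc C (X \<boxtimes> X') X Y
        = (?x \<star> minv C (Assoc C X' X Y)) \<bullet> (?x \<star> Assoc C X' X Y) \<bullet> Assoc C X (X' \<boxtimes> X) Y \<bullet> (Assoc C X X' X \<star> ?y)"
      by (simp add: pentagon)
    also have "\<dots> = Assoc C X (X' \<boxtimes> X) Y \<bullet> (Assoc C X X' X \<star> ?y)"
      by (simp add: interchange' minv_comp)
    finally show "((?x \<star> minv C (Assoc C X' X Y)) \<bullet> Assoc C X X' (X \<boxtimes> Y)) \<bullet> Assoc C (X \<boxtimes> X') X Y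
        = (Assoc C X (X' \<boxtimes> X) Y \<bullet> (Assoc C X X' X \<star> ?y) \<bullet> minv C (Assoc C (X \<boxtimes> X') X Y)) \<bullet> Assoc C (X \<boxtimes> X') X Y"
      by (simp add: minv_comp)
  qed simp_all
  have c: "minv C (Assoc C (X \<boxtimes> X') X Y) \<bullet> (d \<star> Ident C (X \<boxtimes> Y)) = ((d \<star> ?x) \<star> ?y) \<bullet> minv C (Assoc C ?I X Y)"
    using assoc_inv_nat[of d ?x ?y] by simp
  have "minv C (LUnitor C (X \<boxtimes> Y) \<bullet> Assoc C ?I X Y) = minv C (LUnitor C X \<star> ?y)"
    by (simp add: lunitor_tens)
  then have d: "minv C (Assoc C ?I X Y) \<bullet> minv C (LUnitor C (X \<boxtimes> Y)) = minv C (LUnitor C X) \<star> ?y"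
    by (simp add: minv_comp_distrib minv_tens)
  have e: "(?x \<star> (e \<star> ?y)) \<bullet> Assoc C X (X' \<boxtimes> X) Y = Assoc C X ?I Y \<bullet> ((?x \<star> e) \<star> ?y)"
    using assoc_nat[of ?x e ?y] by simp
  have "(?x \<star> \<epsilon> Y) \<bullet> \<eta> (X \<boxtimes> Y) = (?x \<star> LUnitor C Y) \<bullet> (?x \<star> (e \<star> ?y)) \<bullet>
      ((?x \<star> minv C (Assoc C X' X Y)) \<bullet> Assoc C X X' (X \<boxtimes> Y)) \<bullet> (d \<star> Ident C (X \<boxtimes> Y)) \<bullet> minv C (LUnitor C (X \<boxtimes> Y))"
    by (simp add: ev_def coev_def whisker_left)
  also have "\<dots> = (?x \<star> LUnitor C Y) \<bullet> ((?x \<star> (e \<star> ?y)) \<bullet> Assoc C X (X' \<boxtimes> X) Y) \<bullet> (Assoc C X X' X \<star> ?y) \<bullet>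
      (minv C (Assoc C (X \<boxtimes> X') X Y) \<bullet> (d \<star> Ident C (X \<boxtimes> Y))) \<bullet> minv C (LUnitor C (X \<boxtimes> Y))"
    by (simp only: b) simp
  also have "\<dots> = ((?x \<star> LUnitor C Y) \<bullet> Assoc C X ?I Y) \<bullet> ((?x \<star> e) \<star> ?y) \<bullet> (Assoc C X X' X \<star> ?y) \<bullet>
      ((d \<star> ?x) \<star> ?y) \<bullet> (minv C (Assoc C ?I X Y) \<bullet> minv C (LUnitor C (X \<boxtimes> Y)))"
    by (simp only: c e) simp
  also have "\<dots> = (RUnitor C X \<star> ?y) \<bullet> ((?x \<star> e) \<star> ?y) \<bullet> (Assoc C X X' X \<star> ?y) \<bullet>
      ((d \<star> ?x) \<star> ?y) \<bullet> (minv C (LUnitor C X) \<star> ?y)"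
    by (simp add: d triangle)
  also have "\<dots> = (RUnitor C X \<bullet> (?x \<star> e) \<bullet> Assoc C X X' X \<bullet> (d \<star> ?x) \<bullet> minv C (LUnitor C X)) \<star> ?y"
    by (simp add: whisker_right)
  also have "\<dots> = Ident C (X \<boxtimes> Y)"
    using dual by (simp add: is_duality_def)
  finally show ?thesis .
qed

text \<open>By coherence the composite is the second zigzag identity of the duality, tensored with \<open>W\<close>.\<close>

lemma triangle_counit:
  assumes W: "W \<in> Obj C"
  shows "\<epsilon> (X' \<boxtimes> W) \<bullet> (Ident C X' \<star> \<eta> W) = Ident C (X' \<boxtimes> W)"
proof -
  note [simp] = W
  let ?I = "TUnit C" and ?x = "Ident C X'" and ?w = "Ident C W"
  have b: "minv C (Assoc C X' X (X' \<boxtimes> W)) \<bullet> (?x \<star> Assoc C X X' W)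
      = Assoc C (X' \<boxtimes> X) X' W \<bullet> (minv C (Assoc C X' X X') \<star> ?w) \<bullet> minv C (Assoc C X' (X \<boxtimes> X') W)"
    (is "?l = ?r")
  proof (rule iso_cancel_left[of "Assoc C X' X (X' \<boxtimes> W)"])
    have "Assoc C X' X (X' \<boxtimes> W) \<bullet> ?r = (Assoc C X' X (X' \<boxtimes> W) \<bullet> Assoc C (X' \<boxtimes> X) X' W) \<bullet>
        (minv C (Assoc C X' X X') \<star> ?w) \<bullet> minv C (Assoc C X' (X \<boxtimes> X') W)"
      by simp
    also have "\<dots> = (?x \<star> Assoc C X X' W) \<bullet> Assoc C X' (X \<boxtimes> X') W \<bullet> (Assoc C X' X X' \<star> ?w) \<bullet>
        (minv C (Assoc C X' X X') \<star> ?w) \<bullet> minv C (Assoc C X' (X \<boxtimes> X') W)"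
      by (simp only: pentagon[OF dual_simps(2) dual_simps(1) dual_simps(2) W]) simp
    also have "\<dots> = ?x \<star> Assoc C X X' W"
      by (simp add: interchange' comp_minv)
    finally show "Assoc C X' X (X' \<boxtimes> W) \<bullet> ?l = Assoc C X' X (X' \<boxtimes> W) \<bullet> ?r"
      by simp
  qed simp_all
  have c: "(e \<star> Ident C (X' \<boxtimes> W)) \<bullet> Assoc C (X' \<boxtimes> X) X' W = Assoc C ?I X' W \<bullet> ((e \<star> ?x) \<star> ?w)"
    using assoc_nat[of e ?x ?w] by simp
  have d: "minv C (Assoc C X' (X \<boxtimes> X') W) \<bullet> (?x \<star> (d \<star> ?w)) = ((?x \<star> d) \<star> ?w) \<bullet> minv C (Assoc C X' ?I W)"
    using assoc_inv_nat[of ?x d ?w] by simp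
  have "minv C ((?x \<star> LUnitor C W) \<bullet> Assoc C X' ?I W) = minv C (RUnitor C X' \<star> ?w)"
    by (simp add: triangle)
  then have e: "minv C (Assoc C X' ?I W) \<bullet> (?x \<star> minv C (LUnitor C W)) = minv C (RUnitor C X') \<star> ?w"
    by (simp add: minv_comp_distrib minv_tens)
  have "\<epsilon> (X' \<boxtimes> W) \<bullet> (?x \<star> \<eta> W) = LUnitor C (X' \<boxtimes> W) \<bullet> (e \<star> Ident C (X' \<boxtimes> W)) \<bullet>
      (minv C (Assoc C X' X (X' \<boxtimes> W)) \<bullet> (?x \<star> Assoc C X X' W)) \<bullet> (?x \<star> (d \<star> ?w)) \<bullet> (?x \<star> minv C (LUnitor C W))"
    by (simp add: ev_def coev_def whisker_left)
  also have "\<dots> = LUnitor C (X' \<boxtimes> W) \<bullet> ((e \<star> Ident C (X' \<boxtimes> W)) \<bullet> Assoc C (X' \<boxtimes> X) X' W) \<bullet>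
      (minv C (Assoc C X' X X') \<star> ?w) \<bullet> (minv C (Assoc C X' (X \<boxtimes> X') W) \<bullet> (?x \<star> (d \<star> ?w))) \<bullet> (?x \<star> minv C (LUnitor C W))"
    by (simp only: b) simp
  also have "\<dots> = (LUnitor C (X' \<boxtimes> W) \<bullet> Assoc C ?I X' W) \<bullet> ((e \<star> ?x) \<star> ?w) \<bullet>
      (minv C (Assoc C X' X X') \<star> ?w) \<bullet> ((?x \<star> d) \<star> ?w) \<bullet> (minv C (Assoc C X' ?I W) \<bullet> (?x \<star> minv C (LUnitor C W)))"
    by (simp only: c d) simp
  also have "\<dots> = (LUnitor C X' \<star> ?w) \<bullet> ((e \<star> ?x) \<star> ?w) \<bullet>
      (minv C (Assoc C X' X X') \<star> ?w) \<bullet> ((?x \<star> d) \<star> ?w) \<bullet> (minv C (RUnitor C X') \<star> ?w)"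
    by (simp add: e lunitor_tens)
  also have "\<dots> = (LUnitor C X' \<bullet> (e \<star> ?x) \<bullet> minv C (Assoc C X' X X') \<bullet> (?x \<star> d) \<bullet> minv C (RUnitor C X')) \<star> ?w"
    by (simp add: whisker_right)
  also have "\<dots> = Ident C (X' \<boxtimes> W)"
    using dual by (simp add: is_duality_def)
  finally show ?thesis .
qed

lemma counit_transpose:
  assumes "arr u" "src u = X' \<boxtimes> Z" "Z \<in> Obj C"
  shows "\<epsilon> (tgt u) \<bullet> (Ident C X' \<star> ((Ident C X \<star> u) \<bullet> \<eta> Z)) = u"
proof -
  have "\<epsilon> (tgt u) \<bullet> (Ident C X' \<star> ((Ident C X \<star> u) \<bullet> \<eta> Z))
      = (\<epsilon> (tgt u) \<bullet> (Ident C X' \<star> (Ident C X \<star> u))) \<bullet> (Ident C X' \<star> \<eta> Z)"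
    using assms by (simp add: whisker_left)
  also have "\<dots> = u \<bullet> \<epsilon> (X' \<boxtimes> Z) \<bullet> (Ident C X' \<star> \<eta> Z)" using assms by (simp add: ev_nat)
  finally show ?thesis using assms by (simp add: triangle_counit)
qed

lemma unit_transpose:
  assumes "arr u" "tgt u = X \<boxtimes> Z" "Z \<in> Obj C"
  shows "(Ident C X \<star> (\<epsilon> Z \<bullet> (Ident C X' \<star> u))) \<bullet> \<eta> (src u) = u"
proof -
  have "(Ident C X \<star> (\<epsilon> Z \<bullet> (Ident C X' \<star> u))) \<bullet> \<eta> (src u)
      = (Ident C X \<star> \<epsilon> Z) \<bullet> (Ident C X \<star> (Ident C X' \<star> u)) \<bullet> \<eta> (src u)"
    using assms by (simp add: whisker_left)
  also have "\<dots> = (Ident C X \<star> \<epsilon> Z) \<bullet> \<eta> (X \<boxtimes> Z) \<bullet> u" using assms by (simp add: coev_nat)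
  also have "\<dots> = Ident C (X \<boxtimes> Z) \<bullet> u"
    by (rule comp_reduce[OF triangle_unit]) (use assms in simp_all)
  finally show ?thesis using assms by simp
qed

text \<open>A left adjoint preserves epimorphisms: transposing \<open>u \<bullet> (X' \<boxtimes> p)\<close> gives the transpose of \<open>u\<close> composed with \<open>p\<close>.\<close>

lemma tens_left_epi:
  assumes p: "epi p" shows "epi (Ident C X' \<star> p)"
proof (rule epiI)
  fix u w assume *: "arr u" "arr w" "src u = tgt (Ident C X' \<star> p)" "src w = tgt (Ident C X' \<star> p)" "tgt w = tgt u"
    and eq: "u \<bullet> (Ident C X' \<star> p) = w \<bullet> (Ident C X' \<star> p)"
  have t: "((Ident C X \<star> v) \<bullet> \<eta> (tgt p)) \<bullet> p = (Ident C X \<star> (v \<bullet> (Ident C X' \<star> p))) \<bullet> \<eta> (src p)"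
    if "arr v" "src v = X' \<boxtimes> tgt p" for v
    using that p by (simp add: coev_nat whisker_left)
  have "(Ident C X \<star> u) \<bullet> \<eta> (tgt p) = (Ident C X \<star> w) \<bullet> \<eta> (tgt p)"
    by (rule epiD[OF p]) (use t[of u] t[of w] * eq p in simp_all)
  then show "u = w"
    using counit_transpose[of u "tgt p"] counit_transpose[of w "tgt p"] * p by simp
qed (use p in simp)

lemma tens_left_mono:
  assumes k: "mono k" shows "mono (Ident C X \<star> k)"
proof (rule monoI)
  fix u w assume *: "arr u" "arr w" "tgt u = src (Ident C X \<star> k)" "tgt w = src (Ident C X \<star> k)" "src w = src u"
    and eq: "(Ident C X \<star> k) \<bullet> u = (Ident C X \<star> k) \<bullet> w"
  have t: "k \<bullet> \<epsilon> (src k) \<bullet> (Ident C X' \<star> v) = \<epsilon> (tgt k) \<bullet> (Ident C X' \<star> ((Ident C X \<star> k) \<bullet> v))"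
    if "arr v" "tgt v = X \<boxtimes> src k" for v
  proof -
    have "k \<bullet> \<epsilon> (src k) \<bullet> (Ident C X' \<star> v) = (k \<bullet> \<epsilon> (src k)) \<bullet> (Ident C X' \<star> v)" using that k by simp
    also have "\<dots> = (\<epsilon> (tgt k) \<bullet> (Ident C X' \<star> (Ident C X \<star> k))) \<bullet> (Ident C X' \<star> v)"
      using k by (simp only: ev_nat mono_arr)
    finally show ?thesis using that k by (simp add: whisker_left)
  qed
  have "\<epsilon> (src k) \<bullet> (Ident C X' \<star> u) = \<epsilon> (src k) \<bullet> (Ident C X' \<star> w)"
    by (rule monoD[OF k]) (use t[of u] t[of w] * eq k in simp_all)
  then show "u = w"
    using unit_transpose[of u "src k"] unit_transpose[of w "src k"] * k by simp
qed (use k in simp)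

end

locale rigid_category = monoidal_category +
  assumes ex_left_dual: "X \<in> Obj C \<Longrightarrow> \<exists>X' e d. is_duality C X' X e d"
    and ex_right_dual: "X \<in> Obj C \<Longrightarrow> \<exists>X' e d. is_duality C X X' e d"
begin

lemma tens_epi: 
  assumes "V \<in> Obj C" "epi p" shows "epi (Ident C V \<star> p)"
proof -
  obtain W e d where "is_duality C V W e d" using ex_right_dual assms by blast
  then interpret duality C V W e d by unfold_locales
  show ?thesis using assms by (rule_tac tens_left_epi)
qed

text \<open>\<open>Hom(W \<boxtimes> P, -)\<close> is \<open>Hom(P, W' \<boxtimes> -)\<close> for a right dual \<open>W'\<close>, and both \<open>W' \<boxtimes> -\<close> and \<open>Hom(P, -)\<close> preserve epimorphisms.\<close>

lemma projective_tens_left: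
  assumes W: "W \<in> Obj C" and P: "is_projective C P"
  shows "is_projective C (W \<boxtimes> P)"
proof -
  obtain W' e d where "is_duality C W W' e d" using ex_right_dual W by blast
  then interpret duality C W W' e d by unfold_locales
  have [simp]: "P \<in> Obj C" using P by (simp add: is_projective_def)
  show ?thesis
    unfolding is_projective_iff
  proof (intro conjI allI impI)
    fix p f assume *: "epi p" "arr f" "src f = W \<boxtimes> P" "tgt f = tgt p"
    obtain g where g: "in_hom g P (src (Ident C W' \<star> p))" "(Ident C W' \<star> p) \<bullet> g = (Ident C W' \<star> f) \<bullet> \<eta> P"
      by (rule projective_lift[OF P, of "Ident C W' \<star> p" "(Ident C W' \<star> f) \<bullet> \<eta> P"]) (use * tens_epi in simp_all)
    have "p \<bullet> \<epsilon> (src p) \<bullet> (Ident C W \<star> g) = (p \<bullet> \<epsilon> (src p)) \<bullet> (Ident C W \<star> g)"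
      using * g by simp
    also have "\<dots> = (\<epsilon> (tgt p) \<bullet> (Ident C W \<star> (Ident C W' \<star> p))) \<bullet> (Ident C W \<star> g)"
      using * by (simp only: ev_nat epi_arr)
    also have "\<dots> = \<epsilon> (tgt p) \<bullet> (Ident C W \<star> ((Ident C W' \<star> p) \<bullet> g))"
      using * g(1) by (simp add: whisker_left)
    also have "\<dots> = f" using counit_transpose[of f P] * g(2) by simp
    finally show "\<exists>g. in_hom g (W \<boxtimes> P) (src p) \<and> p \<bullet> g = f"
      using * g(1) by (intro exI[of _ "\<epsilon> (src p) \<bullet> (Ident C W \<star> g)"]) simp
  qed simp
qed

end

subsection \<open>The reversed tensor product\<close>

text \<open>Reversal exchanges left and right duals and keeps the underlying category, so what holds for tensoring on the
  left transfers to tensoring on the right.\<close>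

definition tensor_rev :: "('k, 'o, 'm, 'z) moncat_scheme \<Rightarrow> ('k, 'o, 'm, 'z) moncat_scheme" where
  "tensor_rev C = C \<lparr> Tens := \<lambda>X Y. Y \<boxtimes>\<^bsub>C\<^esub> X, TensM := \<lambda>f g. g \<star>\<^bsub>C\<^esub> f,
     Assoc := \<lambda>X Y Z. minv C (Assoc C Z Y X), LUnitor := RUnitor C, RUnitor := LUnitor C \<rparr>"

lemma tensor_rev_simps [simp]:
  "Obj (tensor_rev C) = Obj C" "Hom (tensor_rev C) = Hom C" "Ident (tensor_rev C) = Ident C"
  "Comp (tensor_rev C) = Comp C" "TUnit (tensor_rev C) = TUnit C"
  "Tens (tensor_rev C) X Y = Y \<boxtimes>\<^bsub>C\<^esub> X" "TensM (tensor_rev C) f g = g \<star>\<^bsub>C\<^esub> f"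
  "Assoc (tensor_rev C) X Y Z = minv C (Assoc C Z Y X)"
  "LUnitor (tensor_rev C) = RUnitor C" "RUnitor (tensor_rev C) = LUnitor C"
  "minv (tensor_rev C) = minv C" "is_iso (tensor_rev C) = is_iso C" "is_projective (tensor_rev C) = is_projective C"
  by (simp_all add: tensor_rev_def fun_eq_iff minv_def is_iso_def is_projective_def is_epi_def)

lemma category_tensor_rev: "category D \<Longrightarrow> category (tensor_rev D)"
  unfolding category_def by simp

lemma (in monoidal_category) monoidal_tensor_rev: "monoidal_category (tensor_rev C)"
proof (intro monoidal_category.intro category_tensor_rev category_axioms)
  show "monoidal_category_axioms (tensor_rev C)"
    unfolding monoidal_category_axioms_def tensor_rev_simps
  proof (intro conjI allI impI, goal_cases)
    case (3 X Y X' Y' f g)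
    then show ?case by (simp add: mor_iff)
  next
    case (5 X Y X' Y' X'' Y'' f g f' g')
    then show ?case by (simp add: mor_iff interchange)
  next
    case (6 X Y Z)
    then show ?case by (simp add: is_iso_iff)
  next
    case (7 X Y Z X' Y' Z' f g h)
    then show ?case using assoc_inv_nat[of h g f] by (simp add: mor_iff)
  next
    case (9 X Y f)
    then show ?case by (rule runitor_natural)
  next
    case (11 X Y f)
    then show ?case by (rule lunitor_natural)
  next
    case (12 W X Y Z)
    then have "minv C (Assoc C Z Y (X \<boxtimes> W) \<bullet> Assoc C (Z \<boxtimes> Y) X W) =
        minv C ((Ident C Z \<star> Assoc C Y X W) \<bullet> Assoc C Z (Y \<boxtimes> X) W \<bullet> (Assoc C Z Y X \<star> Ident C W))"
      by (simp add: pentagon)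
    then show ?case using 12 by (simp add: minv_comp_distrib minv_tens)
  next
    case (13 X Y)
    then have "(RUnitor C Y \<star> Ident C X) \<bullet> minv C (Assoc C Y (TUnit C) X) =
        ((Ident C Y \<star> LUnitor C X) \<bullet> Assoc C Y (TUnit C) X) \<bullet> minv C (Assoc C Y (TUnit C) X)"
      by (simp only: triangle)
    then show ?case using 13 by (simp add: comp_minv)
  qed (simp_all add: lunitor_iso runitor_iso)
qed

lemma (in monoidal_category) duality_tensor_rev:
  assumes "is_duality C X' X e d" shows "is_duality (tensor_rev C) X X' e d"
  using assms unfolding is_duality_def by simp

context rigid_category begin

lemma rigid_tensor_rev: "rigid_category (tensor_rev C)"
proof (intro rigid_category.intro monoidal_tensor_rev rigid_category_axioms.intro)
  fix X assume "X \<in> Obj (tensor_rev C)"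
  then have X: "X \<in> Obj C" by simp
  show "\<exists>X' e d. is_duality (tensor_rev C) X' X e d"
    using ex_right_dual[OF X] duality_tensor_rev by blast
  show "\<exists>X' e d. is_duality (tensor_rev C) X X' e d"
    using ex_left_dual[OF X] duality_tensor_rev by blast
qed

lemma projective_tens_right:
  assumes "W \<in> Obj C" "is_projective C P"
  shows "is_projective C (P \<boxtimes> W)"
  using rigid_category.projective_tens_left[OF rigid_tensor_rev, of W P] assms by simp

end

section \<open>Linear and abelian categories\<close>

context linear_category begin

lemma vspace_hom: "\<lbrakk> X \<in> Obj C; Y \<in> Obj C \<rbrakk> \<Longrightarrow> vspace K (Hom C X Y)"
  by (intro vspace.intro hom_module field_axioms)

lemma hom_abelian_group: "\<lbrakk> X \<in> Obj C; Y \<in> Obj C \<rbrakk> \<Longrightarrow> abelian_group (Hom C X Y)"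
  using hom_module module.axioms(2) by blast

lemma zero_simps [simp]:
  assumes "X \<in> Obj C" "Y \<in> Obj C"
  shows "arr \<zero>\<^bsub>Hom C X Y\<^esub>" "src \<zero>\<^bsub>Hom C X Y\<^esub> = X" "tgt \<zero>\<^bsub>Hom C X Y\<^esub> = Y"
proof -
  interpret H: abelian_group "Hom C X Y" using assms by (rule hom_abelian_group)
  show "arr \<zero>\<^bsub>Hom C X Y\<^esub>" "src \<zero>\<^bsub>Hom C X Y\<^esub> = X" "tgt \<zero>\<^bsub>Hom C X Y\<^esub> = Y"
    using in_homI[OF H.zero_closed assms] by simp_all
qed

lemma add_simps [simp]:
  assumes "arr f" "arr g" "src f = X" "tgt f = Y" "src g = X" "tgt g = Y"
  shows "arr (f \<oplus>\<^bsub>Hom C X Y\<^esub> g)" "src (f \<oplus>\<^bsub>Hom C X Y\<^esub> g) = X" "tgt (f \<oplus>\<^bsub>Hom C X Y\<^esub> g) = Y"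
proof -
  have XY: "X \<in> Obj C" "Y \<in> Obj C" using assms by auto
  interpret H: abelian_group "Hom C X Y" using XY by (rule hom_abelian_group)
  have "f \<in> mor C X Y" "g \<in> mor C X Y" using assms by simp_all
  then show "arr (f \<oplus>\<^bsub>Hom C X Y\<^esub> g)" "src (f \<oplus>\<^bsub>Hom C X Y\<^esub> g) = X" "tgt (f \<oplus>\<^bsub>Hom C X Y\<^esub> g) = Y"
    using in_homI[OF H.add.m_closed XY] by simp_all
qed

lemma neg_simps [simp]:
  assumes "arr f" "src f = X" "tgt f = Y"
  shows "arr (\<ominus>\<^bsub>Hom C X Y\<^esub> f)" "src (\<ominus>\<^bsub>Hom C X Y\<^esub> f) = X" "tgt (\<ominus>\<^bsub>Hom C X Y\<^esub> f) = Y"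
proof -
  have XY: "X \<in> Obj C" "Y \<in> Obj C" using assms by auto
  interpret H: abelian_group "Hom C X Y" using XY by (rule hom_abelian_group)
  have "f \<in> mor C X Y" using assms by simp
  then show "arr (\<ominus>\<^bsub>Hom C X Y\<^esub> f)" "src (\<ominus>\<^bsub>Hom C X Y\<^esub> f) = X" "tgt (\<ominus>\<^bsub>Hom C X Y\<^esub> f) = Y"
    using in_homI[OF H.a_inv_closed XY] by simp_all
qed

lemma smult_simps [simp]:
  assumes "c \<in> carrier K" "arr f" "src f = X" "tgt f = Y"
  shows "arr (c \<odot>\<^bsub>Hom C X Y\<^esub> f)" "src (c \<odot>\<^bsub>Hom C X Y\<^esub> f) = X" "tgt (c \<odot>\<^bsub>Hom C X Y\<^esub> f) = Y"
proof -
  have XY: "X \<in> Obj C" "Y \<in> Obj C" using assms by auto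
  interpret H: module K "Hom C X Y" using XY by (rule hom_module)
  have "f \<in> mor C X Y" using assms by simp
  then show "arr (c \<odot>\<^bsub>Hom C X Y\<^esub> f)" "src (c \<odot>\<^bsub>Hom C X Y\<^esub> f) = X" "tgt (c \<odot>\<^bsub>Hom C X Y\<^esub> f) = Y"
    using in_homI[OF H.smult_closed[OF assms(1)] XY] by simp_all
qed

lemma sub_simps [simp]:
  assumes "arr f" "arr g" "src f = X" "tgt f = Y" "src g = X" "tgt g = Y"
  shows "arr (f \<ominus>\<^bsub>Hom C X Y\<^esub> g)" "src (f \<ominus>\<^bsub>Hom C X Y\<^esub> g) = X" "tgt (f \<ominus>\<^bsub>Hom C X Y\<^esub> g) = Y"
  using assms by (simp_all add: a_minus_def)

lemma add_comp:
  assumes "arr f" "arr g" "arr h" "tgt f = Y" "src g = Y" "tgt g = Z" "src h = Y" "tgt h = Z"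
  shows "(g \<oplus>\<^bsub>Hom C Y Z\<^esub> h) \<bullet> f = (g \<bullet> f) \<oplus>\<^bsub>Hom C (src f) Z\<^esub> (h \<bullet> f)"
  by (rule comp_add_left) (use assms in auto)

lemma comp_add:
  assumes "arr f" "arr g" "arr h" "src h = Y" "src g = X" "tgt g = Y" "src f = X" "tgt f = Y"
  shows "h \<bullet> (f \<oplus>\<^bsub>Hom C X Y\<^esub> g) = (h \<bullet> f) \<oplus>\<^bsub>Hom C X (tgt h)\<^esub> (h \<bullet> g)"
  by (rule comp_add_right) (use assms in auto)

lemma smult_comp:
  assumes "c \<in> carrier K" "arr f" "arr g" "tgt f = Y" "src g = Y" "tgt g = Z"
  shows "(c \<odot>\<^bsub>Hom C Y Z\<^esub> g) \<bullet> f = c \<odot>\<^bsub>Hom C (src f) Z\<^esub> (g \<bullet> f)"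
  by (rule comp_smult_left) (use assms in auto)

lemma comp_smult:
  assumes "c \<in> carrier K" "arr f" "arr h" "src h = Y" "src f = X" "tgt f = Y"
  shows "h \<bullet> (c \<odot>\<^bsub>Hom C X Y\<^esub> f) = c \<odot>\<^bsub>Hom C X (tgt h)\<^esub> (h \<bullet> f)"
  by (rule comp_smult_right) (use assms in auto)

lemma comp_zero [simp]:
  assumes "arr h" "src h = Y" "X \<in> Obj C"
  shows "h \<bullet> \<zero>\<^bsub>Hom C X Y\<^esub> = \<zero>\<^bsub>Hom C X (tgt h)\<^esub>"
proof -
  have Y: "Y \<in> Obj C" using assms by auto
  interpret H: module K "Hom C X Y" using assms(3) Y by (rule hom_module)
  interpret H': module K "Hom C X (tgt h)" using assms by (intro hom_module) simp_all
  have z: "arr \<zero>\<^bsub>Hom C X Y\<^esub>" "src \<zero>\<^bsub>Hom C X Y\<^esub> = X" "tgt \<zero>\<^bsub>Hom C X Y\<^esub> = Y" using assms Y by simp_all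
  have "h \<bullet> \<zero>\<^bsub>Hom C X Y\<^esub> = h \<bullet> (\<zero>\<^bsub>K\<^esub> \<odot>\<^bsub>Hom C X Y\<^esub> \<zero>\<^bsub>Hom C X Y\<^esub>)" by simp
  also have "\<dots> = \<zero>\<^bsub>K\<^esub> \<odot>\<^bsub>Hom C X (tgt h)\<^esub> (h \<bullet> \<zero>\<^bsub>Hom C X Y\<^esub>)" using assms z by (intro comp_smult) simp_all
  also have "\<dots> = \<zero>\<^bsub>Hom C X (tgt h)\<^esub>" using assms z by (intro H'.smult_l_null) simp_all
  finally show ?thesis .
qed

lemma zero_comp [simp]:
  assumes "arr f" "tgt f = Y" "Z \<in> Obj C"
  shows "\<zero>\<^bsub>Hom C Y Z\<^esub> \<bullet> f = \<zero>\<^bsub>Hom C (src f) Z\<^esub>"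
proof -
  have Y: "Y \<in> Obj C" using assms by auto
  interpret H: module K "Hom C Y Z" using Y assms(3) by (rule hom_module)
  interpret H': module K "Hom C (src f) Z" using assms by (intro hom_module) simp_all
  have z: "arr \<zero>\<^bsub>Hom C Y Z\<^esub>" "src \<zero>\<^bsub>Hom C Y Z\<^esub> = Y" "tgt \<zero>\<^bsub>Hom C Y Z\<^esub> = Z" using assms Y by simp_all
  have "\<zero>\<^bsub>Hom C Y Z\<^esub> \<bullet> f = (\<zero>\<^bsub>K\<^esub> \<odot>\<^bsub>Hom C Y Z\<^esub> \<zero>\<^bsub>Hom C Y Z\<^esub>) \<bullet> f" by simp
  also have "\<dots> = \<zero>\<^bsub>K\<^esub> \<odot>\<^bsub>Hom C (src f) Z\<^esub> (\<zero>\<^bsub>Hom C Y Z\<^esub> \<bullet> f)" using assms z by (intro smult_comp) simp_all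
  also have "\<dots> = \<zero>\<^bsub>Hom C (src f) Z\<^esub>" using assms z by (intro H'.smult_l_null) simp_all
  finally show ?thesis .
qed

lemma sub_eq_zero_iff:
  assumes "arr f" "arr g" "src f = X" "tgt f = Y" "src g = X" "tgt g = Y"
  shows "f \<ominus>\<^bsub>Hom C X Y\<^esub> g = \<zero>\<^bsub>Hom C X Y\<^esub> \<longleftrightarrow> f = g"
proof -
  interpret H: abelian_group "Hom C X Y" using assms by (intro hom_abelian_group) auto
  have fg: "f \<in> mor C X Y" "g \<in> mor C X Y" using assms by simp_all
  show ?thesis unfolding a_minus_def
    using fg H.minus_equality[of f "\<ominus>\<^bsub>Hom C X Y\<^esub> g"] H.r_neg[of g] H.minus_minus[of g] by (metis H.a_inv_closed)
qed

lemma comp_neg: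
  assumes "arr f" "arr h" "src h = Y" "src f = X" "tgt f = Y"
  shows "h \<bullet> (\<ominus>\<^bsub>Hom C X Y\<^esub> f) = \<ominus>\<^bsub>Hom C X (tgt h)\<^esub> (h \<bullet> f)"
proof -
  have XY: "X \<in> Obj C" "Y \<in> Obj C" using assms by auto
  interpret H: abelian_group "Hom C X Y" using XY by (rule hom_abelian_group)
  interpret H': abelian_group "Hom C X (tgt h)" using XY assms by (intro hom_abelian_group) auto
  have "f \<in> mor C X Y" using assms by simp
  then have "(\<ominus>\<^bsub>Hom C X Y\<^esub> f) \<oplus>\<^bsub>Hom C X Y\<^esub> f = \<zero>\<^bsub>Hom C X Y\<^esub>" by (rule H.l_neg)
  then have "h \<bullet> ((\<ominus>\<^bsub>Hom C X Y\<^esub> f) \<oplus>\<^bsub>Hom C X Y\<^esub> f) = \<zero>\<^bsub>Hom C X (tgt h)\<^esub>"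
    using assms XY by simp
  then have "(h \<bullet> (\<ominus>\<^bsub>Hom C X Y\<^esub> f)) \<oplus>\<^bsub>Hom C X (tgt h)\<^esub> (h \<bullet> f) = \<zero>\<^bsub>Hom C X (tgt h)\<^esub>"
    using assms by (simp add: comp_add)
  then show ?thesis using assms by (intro H'.minus_equality[symmetric]) simp_all
qed

lemma neg_comp:
  assumes "arr f" "arr g" "tgt f = Y" "src g = Y" "tgt g = Z"
  shows "(\<ominus>\<^bsub>Hom C Y Z\<^esub> g) \<bullet> f = \<ominus>\<^bsub>Hom C (src f) Z\<^esub> (g \<bullet> f)"
proof -
  have YZ: "Y \<in> Obj C" "Z \<in> Obj C" using assms by auto
  interpret H: abelian_group "Hom C Y Z" using YZ by (rule hom_abelian_group)
  interpret H': abelian_group "Hom C (src f) Z" using YZ assms by (intro hom_abelian_group) auto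
  have "g \<in> mor C Y Z" using assms by simp
  then have "(\<ominus>\<^bsub>Hom C Y Z\<^esub> g) \<oplus>\<^bsub>Hom C Y Z\<^esub> g = \<zero>\<^bsub>Hom C Y Z\<^esub>" by (rule H.l_neg)
  then have "((\<ominus>\<^bsub>Hom C Y Z\<^esub> g) \<oplus>\<^bsub>Hom C Y Z\<^esub> g) \<bullet> f = \<zero>\<^bsub>Hom C (src f) Z\<^esub>"
    using assms YZ by simp
  then have "((\<ominus>\<^bsub>Hom C Y Z\<^esub> g) \<bullet> f) \<oplus>\<^bsub>Hom C (src f) Z\<^esub> (g \<bullet> f) = \<zero>\<^bsub>Hom C (src f) Z\<^esub>"
    using assms by (simp add: add_comp)
  then show ?thesis using assms by (intro H'.minus_equality[symmetric]) simp_all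
qed

lemma comp_sub:
  assumes "arr f" "arr g" "arr h" "src h = Y" "src g = X" "tgt g = Y" "src f = X" "tgt f = Y"
  shows "h \<bullet> (f \<ominus>\<^bsub>Hom C X Y\<^esub> g) = (h \<bullet> f) \<ominus>\<^bsub>Hom C X (tgt h)\<^esub> (h \<bullet> g)"
  using assms by (simp add: a_minus_def comp_add comp_neg)

lemma sub_comp:
  assumes "arr f" "arr g" "arr h" "tgt f = Y" "src g = Y" "tgt g = Z" "src h = Y" "tgt h = Z"
  shows "(g \<ominus>\<^bsub>Hom C Y Z\<^esub> h) \<bullet> f = (g \<bullet> f) \<ominus>\<^bsub>Hom C (src f) Z\<^esub> (h \<bullet> f)"
  using assms by (simp add: a_minus_def add_comp neg_comp)

lemma mono_zeroI:
  assumes "arr f" "\<And>g. \<lbrakk> arr g; tgt g = src f; f \<bullet> g = \<zero>\<^bsub>Hom C (src g) (tgt f)\<^esub> \<rbrakk> \<Longrightarrow> g = \<zero>\<^bsub>Hom C (src g) (src f)\<^esub>"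
  shows "mono f"
proof (rule monoI[OF assms(1)])
  fix g h assume *: "arr g" "arr h" "tgt g = src f" "tgt h = src f" "src h = src g" "f \<bullet> g = f \<bullet> h"
  let ?d = "g \<ominus>\<^bsub>Hom C (src g) (src f)\<^esub> h"
  have "f \<bullet> ?d = (f \<bullet> g) \<ominus>\<^bsub>Hom C (src g) (tgt f)\<^esub> (f \<bullet> h)" using assms(1) *(1-5) by (intro comp_sub) simp_all
  also have "\<dots> = \<zero>\<^bsub>Hom C (src g) (tgt f)\<^esub>" using assms(1) *(1-5) by (subst sub_eq_zero_iff) (simp_all add: *(6))
  finally have z: "f \<bullet> ?d = \<zero>\<^bsub>Hom C (src g) (tgt f)\<^esub>" .
  have d: "arr ?d" "src ?d = src g" "tgt ?d = src f" using *(1-5) by simp_all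
  have "?d = \<zero>\<^bsub>Hom C (src g) (src f)\<^esub>" by (rule assms(2)[OF d(1,3), unfolded d(2), OF z])
  then show "g = h" by (rule iffD1[OF sub_eq_zero_iff, rotated -1]) (use *(1-5) in simp_all)
qed

lemma epi_zeroI:
  assumes "arr f" "\<And>g. \<lbrakk> arr g; src g = tgt f; g \<bullet> f = \<zero>\<^bsub>Hom C (src f) (tgt g)\<^esub> \<rbrakk> \<Longrightarrow> g = \<zero>\<^bsub>Hom C (tgt f) (tgt g)\<^esub>"
  shows "epi f"
proof (rule epiI[OF assms(1)])
  fix g h assume *: "arr g" "arr h" "src g = tgt f" "src h = tgt f" "tgt h = tgt g" "g \<bullet> f = h \<bullet> f"
  let ?d = "g \<ominus>\<^bsub>Hom C (tgt f) (tgt g)\<^esub> h"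
  have "?d \<bullet> f = (g \<bullet> f) \<ominus>\<^bsub>Hom C (src f) (tgt g)\<^esub> (h \<bullet> f)" using assms(1) *(1-5) by (intro sub_comp) simp_all
  also have "\<dots> = \<zero>\<^bsub>Hom C (src f) (tgt g)\<^esub>" using assms(1) *(1-5) by (subst sub_eq_zero_iff) (simp_all add: *(6))
  finally have z: "?d \<bullet> f = \<zero>\<^bsub>Hom C (src f) (tgt g)\<^esub>" .
  have d: "arr ?d" "tgt ?d = tgt g" "src ?d = tgt f" using *(1-5) by simp_all
  have "?d = \<zero>\<^bsub>Hom C (tgt f) (tgt g)\<^esub>" by (rule assms(2)[OF d(1,3), unfolded d(2), OF z])
  then show "g = h" by (rule iffD1[OF sub_eq_zero_iff, rotated -1]) (use *(1-5) in simp_all)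
qed

lemma mono_zeroD:
  assumes "mono f" "arr g" "tgt g = src f" "f \<bullet> g = \<zero>\<^bsub>Hom C (src g) (tgt f)\<^esub>"
  shows "g = \<zero>\<^bsub>Hom C (src g) (src f)\<^esub>"
  by (rule monoD[OF assms(1)]) (use assms in simp_all)

lemma epi_zeroD:
  assumes "epi f" "arr g" "src g = tgt f" "g \<bullet> f = \<zero>\<^bsub>Hom C (src f) (tgt g)\<^esub>"
  shows "g = \<zero>\<^bsub>Hom C (tgt f) (tgt g)\<^esub>"
  by (rule epiD[OF assms(1)]) (use assms in simp_all)

lemma zero_object_iff: "is_zero_object C Z \<longleftrightarrow> Z \<in> Obj C \<and> Ident C Z = \<zero>\<^bsub>Hom C Z Z\<^esub>"
proof
  assume "is_zero_object C Z"
  then have Z: "Z \<in> Obj C" "\<exists>!f. f \<in> mor C Z Z" by (simp_all add: is_zero_object_def)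
  then have "Ident C Z \<in> mor C Z Z" "\<zero>\<^bsub>Hom C Z Z\<^esub> \<in> mor C Z Z" by simp_all
  then show "Z \<in> Obj C \<and> Ident C Z = \<zero>\<^bsub>Hom C Z Z\<^esub>" using Z by blast
next
  assume Z: "Z \<in> Obj C \<and> Ident C Z = \<zero>\<^bsub>Hom C Z Z\<^esub>"
  have a: "f = \<zero>\<^bsub>Hom C X Z\<^esub>" if "X \<in> Obj C" "f \<in> mor C X Z" for X f
  proof -
    have f: "in_hom f X Z" using that Z by (simp add: mor_iff)
    then have "f = Ident C Z \<bullet> f" by simp
    also have "\<dots> = \<zero>\<^bsub>Hom C X Z\<^esub>" using Z f by simp
    finally show ?thesis .
  qed
  have b: "f = \<zero>\<^bsub>Hom C Z X\<^esub>" if "X \<in> Obj C" "f \<in> mor C Z X" for X f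
  proof -
    have f: "in_hom f Z X" using that Z by (simp add: mor_iff)
    then have "f = f \<bullet> Ident C Z" by simp
    also have "\<dots> = \<zero>\<^bsub>Hom C Z X\<^esub>" using Z f by simp
    finally show ?thesis .
  qed
  show "is_zero_object C Z"
    unfolding is_zero_object_def
  proof (intro conjI ballI)
    fix X assume X: "X \<in> Obj C"
    show "\<exists>!f. f \<in> mor C X Z" using X Z by (intro ex1I[of _ "\<zero>\<^bsub>Hom C X Z\<^esub>"] a) simp_all
    show "\<exists>!f. f \<in> mor C Z X" using X Z by (intro ex1I[of _ "\<zero>\<^bsub>Hom C Z X\<^esub>"] b) simp_all
  qed (use Z in blast)
qed

lemma arr_from_zero: "\<lbrakk> is_zero_object C Z; arr f; src f = Z \<rbrakk> \<Longrightarrow> f = \<zero>\<^bsub>Hom C Z (tgt f)\<^esub>"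
  by (metis comp_ident(2) comp_zero zero_object_iff)

text \<open>Arguments about one-sided inverses only need that an ascending chain of subspaces of the endomorphism algebra
  stops: the kernels of the powers of left multiplication by \<open>e\<close> form such a chain.\<close>

lemma right_inverse_is_left_inverse:
  assumes P: "P \<in> Obj C" and fd: "finite_dimensional K (Hom C P P)"
    and e: "in_hom e P P" and s: "in_hom s P P" and es: "e \<bullet> s = Ident C P"
  shows "s \<bullet> e = Ident C P"
proof -
  interpret H: vspace K "Hom C P P" using P by (intro vspace_hom)
  define E where "E n = (\<lambda>a. e \<bullet> a) ^^ n" for n
  define Ss where "Ss n = (\<lambda>a. s \<bullet> a) ^^ n" for n
  let ?z = "\<zero>\<^bsub>Hom C P P\<^esub>"
  have E_arr: "in_hom (E n a) P P" if "in_hom a P P" for n a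
    using that e by (induction n) (simp_all add: E_def)
  have S_arr: "in_hom (Ss n a) P P" if "in_hom a P P" for n a
    using that s by (induction n) (simp_all add: Ss_def)
  have E_zero: "E n ?z = ?z" for n
    using e P by (induction n) (simp_all add: E_def)
  have E_add: "E n (a \<oplus>\<^bsub>Hom C P P\<^esub> b) = E n a \<oplus>\<^bsub>Hom C P P\<^esub> E n b" if "in_hom a P P" "in_hom b P P" for n a b
  proof (induction n)
    case (Suc n)
    then show ?case using that e comp_add[of "E n a" "E n b" e P P] E_arr by (simp add: E_def)
  qed (simp add: E_def)
  have E_smult: "E n (c \<odot>\<^bsub>Hom C P P\<^esub> a) = c \<odot>\<^bsub>Hom C P P\<^esub> E n a" if "in_hom a P P" "c \<in> carrier K" for n a c
  proof (induction n)
    case (Suc n)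
    then show ?case using that e comp_smult[of c "E n a" e P P] E_arr by (simp add: E_def)
  qed (simp add: E_def)
  have E_mono: "E m a = ?z" if "E n a = ?z" "n \<le> m" for n m a
  proof -
    have "E m a = E (m - n) (E n a)" using that(2) by (simp add: E_def flip: funpow_add[THEN fun_cong, unfolded o_def])
    then show ?thesis using that E_zero by simp
  qed
  have E_S: "E n (Ss n a) = a" if "in_hom a P P" for n a
  proof (induction n)
    case (Suc n)
    have "E (Suc n) (Ss (Suc n) a) = E n (e \<bullet> s \<bullet> Ss n a)" by (simp add: E_def Ss_def funpow_swap1)
    also have "e \<bullet> s \<bullet> Ss n a = Ident C P \<bullet> Ss n a"
      by (rule comp_reduce[OF es]) (use e s S_arr[OF that] in simp_all)
    finally show ?case using Suc S_arr[OF that] by simp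
  qed (simp add: E_def Ss_def)
  define W where "W = {a. in_hom a P P \<and> (\<exists>n. E n a = ?z)}"
  have kz: "subspace K (Hom C P P) {a. in_hom a P P \<and> E n a = ?z}" for n
    using P by (intro subspaceI) (auto simp: E_zero E_add E_smult)
  have "subspace K (Hom C P P) W"
  proof (rule subspaceI)
    show "W \<subseteq> mor C P P" by (auto simp: W_def)
    show "?z \<in> W" using P E_zero by (auto simp: W_def)
    show "c \<odot>\<^bsub>Hom C P P\<^esub> a \<in> W" if c: "c \<in> carrier K" and "a \<in> W" for c a
    proof -
      obtain n where "in_hom a P P" "E n a = ?z" using \<open>a \<in> W\<close> by (auto simp: W_def)
      then have "in_hom (c \<odot>\<^bsub>Hom C P P\<^esub> a) P P" "E n (c \<odot>\<^bsub>Hom C P P\<^esub> a) = ?z"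
        using c by (simp_all add: E_smult)
      then show ?thesis unfolding W_def by blast
    qed
    fix a b assume "a \<in> W" "b \<in> W"
    then obtain n m where nm: "in_hom a P P" "in_hom b P P" "E n a = ?z" "E m b = ?z" by (auto simp: W_def)
    then have "E (max n m) a = ?z" "E (max n m) b = ?z" using E_mono by (meson max.cobounded1 max.cobounded2)+
    then have "E (max n m) (a \<oplus>\<^bsub>Hom C P P\<^esub> b) = ?z" using nm P by (simp add: E_add)
    then show "a \<oplus>\<^bsub>Hom C P P\<^esub> b \<in> W" using nm by (auto simp: W_def)
  qed
  then obtain B where B: "finite B" "B \<subseteq> W" "W \<subseteq> lspan K (Hom C P P) B"
    by (rule H.finite_dimensional_subspace[OF fd])
  from B(2) have "\<forall>b \<in> B. \<exists>n. E n b = ?z" by (auto simp: W_def)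
  from bchoice[OF this] obtain n where n: "\<forall>b \<in> B. E (n b) b = ?z" ..
  define N where "N = Max (insert 0 (n ` B))"
  have "E N b = ?z" if "b \<in> B" for b
  proof (rule E_mono)
    show "E (n b) b = ?z" using n that by (rule bspec)
    show "n b \<le> N" unfolding N_def using B(1) that by (intro Max_ge) simp_all
  qed
  then have BN: "B \<subseteq> {a. in_hom a P P \<and> E N a = ?z}" using B(2) unfolding W_def by blast
  have WN: "E N a = ?z" if "a \<in> W" for a
    using lspan_least[OF kz BN subsetD[OF B(3) that]] by simp
  let ?x = "(s \<bullet> e) \<ominus>\<^bsub>Hom C P P\<^esub> Ident C P"
  have x: "in_hom ?x P P" using e s P by simp
  have "e \<bullet> s \<bullet> e = Ident C P \<bullet> e" by (rule comp_reduce[OF es]) (use e s in simp_all)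
  then have ex: "e \<bullet> ?x = ?z"
    using e s P by (simp add: comp_sub sub_eq_zero_iff)
  have "E (Suc N) (Ss N ?x) = ?z" using ex E_S[OF x, of N] by (simp add: E_def)
  then have "Ss N ?x \<in> W" using S_arr[OF x] by (auto simp: W_def)
  from WN[OF this] have "?x = ?z" unfolding E_S[OF x] .
  then show ?thesis by (rule iffD1[OF sub_eq_zero_iff, rotated -1]) (use e s P in simp_all)
qed

subsection \<open>Kernels, cokernels and images\<close>

definition ker_of :: "'m \<Rightarrow> 'm \<Rightarrow> bool" where
  "ker_of k f \<longleftrightarrow> mono k \<and> arr f \<and> tgt k = src f \<and> f \<bullet> k = \<zero>\<^bsub>Hom C (src k) (tgt f)\<^esub> \<and>
     (\<forall>g. arr g \<longrightarrow> tgt g = src f \<longrightarrow> f \<bullet> g = \<zero>\<^bsub>Hom C (src g) (tgt f)\<^esub> \<longrightarrow> (\<exists>u. in_hom u (src g) (src k) \<and> k \<bullet> u = g))"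

definition coker_of :: "'m \<Rightarrow> 'm \<Rightarrow> bool" where
  "coker_of c f \<longleftrightarrow> epi c \<and> arr f \<and> src c = tgt f \<and> c \<bullet> f = \<zero>\<^bsub>Hom C (src f) (tgt c)\<^esub> \<and>
     (\<forall>g. arr g \<longrightarrow> src g = tgt f \<longrightarrow> g \<bullet> f = \<zero>\<^bsub>Hom C (src f) (tgt g)\<^esub> \<longrightarrow> (\<exists>u. in_hom u (tgt c) (tgt g) \<and> u \<bullet> c = g))"

lemma ker_ofD:
  assumes "ker_of k f"
  shows "mono k" "arr k" "arr f" "tgt k = src f" "f \<bullet> k = \<zero>\<^bsub>Hom C (src k) (tgt f)\<^esub>"
  using assms by (simp_all add: ker_of_def)

lemma ker_of_factor:
  assumes "ker_of k f" "arr g" "tgt g = src f" "f \<bullet> g = \<zero>\<^bsub>Hom C (src g) (tgt f)\<^esub>"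
  obtains u where "in_hom u (src g) (src k)" "k \<bullet> u = g"
  using assms unfolding ker_of_def by blast

lemma coker_ofD:
  assumes "coker_of c f"
  shows "epi c" "arr c" "arr f" "src c = tgt f" "c \<bullet> f = \<zero>\<^bsub>Hom C (src f) (tgt c)\<^esub>"
  using assms by (simp_all add: coker_of_def)

lemma coker_of_factor:
  assumes "coker_of c f" "arr g" "src g = tgt f" "g \<bullet> f = \<zero>\<^bsub>Hom C (src f) (tgt g)\<^esub>"
  obtains u where "in_hom u (tgt c) (tgt g)" "u \<bullet> c = g"
  using assms unfolding coker_of_def by blast

lemma is_kernel_imp_ker_of:
  assumes "is_kernel C X Y f N i" "in_hom f X Y"
  shows "ker_of i f" "in_hom i N X"
proof -
  have XY: "X \<in> Obj C" "Y \<in> Obj C" using assms by auto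
  have N: "N \<in> Obj C" and i': "i \<in> mor C N X" and z: "f \<bullet> i = \<zero>\<^bsub>Hom C N Y\<^esub>"
    and u: "\<And>W g. \<lbrakk> W \<in> Obj C; g \<in> mor C W X; f \<bullet> g = \<zero>\<^bsub>Hom C W Y\<^esub> \<rbrakk> \<Longrightarrow> \<exists>!u. u \<in> mor C W N \<and> i \<bullet> u = g"
    using assms(1) unfolding is_kernel_def by blast+
  have i: "in_hom i N X" using i' N XY by (simp add: mor_iff)
  have ex: "\<exists>u. in_hom u (src g) (src i) \<and> i \<bullet> u = g"
    if "arr g" "tgt g = X" "f \<bullet> g = \<zero>\<^bsub>Hom C (src g) Y\<^esub>" for g
  proof -
    have "\<exists>u. u \<in> mor C (src g) N \<and> i \<bullet> u = g" 
      by (rule ex1_implies_ex, rule u) (use that in simp_all)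
    then show ?thesis using that N i by (simp add: mor_iff)
  qed
  have "mono i"
  proof (rule monoI)
    fix g h assume *: "arr g" "arr h" "tgt g = src i" "tgt h = src i" "src h = src g" "i \<bullet> g = i \<bullet> h"
    have "f \<bullet> i \<bullet> g = \<zero>\<^bsub>Hom C N Y\<^esub> \<bullet> g"
      by (rule comp_reduce[OF z]) (use * i assms in simp_all)
    then have "\<exists>!u. u \<in> mor C (src g) N \<and> i \<bullet> u = i \<bullet> g"
      using u[of "src g" "i \<bullet> g"] *(1-5) i XY by simp
    moreover have "g \<in> mor C (src g) N" "h \<in> mor C (src g) N" using * i by simp_all
    ultimately show "g = h" using *(6) by metis
  qed (use i in simp)
  then show "ker_of i f" "in_hom i N X" using i assms z ex by (simp_all add: ker_of_def)
qed

lemma is_cokernel_imp_coker_of: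
  assumes "is_cokernel C X Y f Q p" "in_hom f X Y"
  shows "coker_of p f" "in_hom p Y Q"
proof -
  have XY: "X \<in> Obj C" "Y \<in> Obj C" using assms by auto
  have Q: "Q \<in> Obj C" and p': "p \<in> mor C Y Q" and z: "p \<bullet> f = \<zero>\<^bsub>Hom C X Q\<^esub>"
    and u: "\<And>W g. \<lbrakk> W \<in> Obj C; g \<in> mor C Y W; g \<bullet> f = \<zero>\<^bsub>Hom C X W\<^esub> \<rbrakk> \<Longrightarrow> \<exists>!u. u \<in> mor C Q W \<and> u \<bullet> p = g"
    using assms(1) unfolding is_cokernel_def by blast+
  have p: "in_hom p Y Q" using p' Q XY by (simp add: mor_iff)
  have ex: "\<exists>u. in_hom u (tgt p) (tgt g) \<and> u \<bullet> p = g"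
    if "arr g" "src g = Y" "g \<bullet> f = \<zero>\<^bsub>Hom C X (tgt g)\<^esub>" for g
  proof -
    have "\<exists>u. u \<in> mor C Q (tgt g) \<and> u \<bullet> p = g" 
      by (rule ex1_implies_ex, rule u) (use that in simp_all)
    then show ?thesis using that Q p by (simp add: mor_iff)
  qed
  have "epi p"
  proof (rule epiI)
    fix g h assume *: "arr g" "arr h" "src g = tgt p" "src h = tgt p" "tgt h = tgt g" "g \<bullet> p = h \<bullet> p"
    have "(g \<bullet> p) \<bullet> f = g \<bullet> \<zero>\<^bsub>Hom C X Q\<^esub>" using *(1-5) p assms by (simp flip: z)
    then have "\<exists>!u. u \<in> mor C Q (tgt g) \<and> u \<bullet> p = g \<bullet> p"
      using u[of "tgt g" "g \<bullet> p"] *(1-5) p XY by simp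
    moreover have "g \<in> mor C Q (tgt g)" "h \<in> mor C Q (tgt g)" using * p by simp_all
    ultimately show "g = h" using *(6) by metis
  qed (use p in simp)
  then show "coker_of p f" "in_hom p Y Q" using p assms z ex by (simp_all add: coker_of_def)
qed

end

context abelian_linear_category begin

lemma ex_ker: assumes "arr f" obtains k where "ker_of k f"
proof -
  obtain N i where "is_kernel C (src f) (tgt f) f N i" using kernels[of "src f" "tgt f" f] assms by auto
  then show ?thesis using is_kernel_imp_ker_of(1) assms that by blast
qed

lemma ex_coker: assumes "arr f" obtains c where "coker_of c f"
proof -
  obtain Q p where "is_cokernel C (src f) (tgt f) f Q p" using cokernels[of "src f" "tgt f" f] assms by auto
  then show ?thesis using is_cokernel_imp_coker_of(1) assms that by blast
qed

text \<open>A monomorphism \<open>m\<close> is the kernel of some \<open>g\<close>, and \<open>g\<close> factors through the cokernel of \<open>m\<close>.\<close>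

lemma mono_is_ker_of_coker:
  assumes m: "mono m" and c: "coker_of c m"
  shows "ker_of m c"
proof -
  note cD = coker_ofD[OF c]
  have "is_mono C (src m) (tgt m) m" using m by (simp add: is_mono_iff_mono)
  then obtain Z g where Z: "Z \<in> Obj C" "g \<in> mor C (tgt m) Z" "is_kernel C (tgt m) Z g (src m) m"
    using mono_normal[of "src m" "tgt m" m] m by auto
  then have g: "in_hom g (tgt m) Z" using m by (simp add: mor_iff)
  then have gm: "ker_of m g" using is_kernel_imp_ker_of(1) Z by blast
  obtain u where u: "in_hom u (tgt c) (tgt g)" "u \<bullet> c = g"
    by (rule coker_of_factor[OF c, of g]) (use g ker_ofD[OF gm] in simp_all)
  show ?thesis
    unfolding ker_of_def
  proof (intro conjI allI impI)
    fix h assume h: "arr h" "tgt h = src c" "c \<bullet> h = \<zero>\<^bsub>Hom C (src h) (tgt c)\<^esub>"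
    have "g \<bullet> h = u \<bullet> c \<bullet> h" using u(1) h(1,2) cD by (simp flip: u(2))
    also have "\<dots> = \<zero>\<^bsub>Hom C (src h) (tgt g)\<^esub>" using u(1) h by simp
    finally show "\<exists>w. in_hom w (src h) (src m) \<and> m \<bullet> w = h"
      using ker_of_factor[OF gm, of h] h g cD by metis
  qed (use m cD in simp_all)
qed

lemma epi_is_coker_of_ker:
  assumes p: "epi p" and k: "ker_of k p"
  shows "coker_of p k"
proof -
  note kD = ker_ofD[OF k]
  have "is_epi C (src p) (tgt p) p" using p by (simp add: is_epi_iff_epi)
  then obtain W g where W: "W \<in> Obj C" "g \<in> mor C W (src p)" "is_cokernel C W (src p) g (tgt p) p"
    using epi_normal[of "src p" "tgt p" p] p by auto
  then have g: "in_hom g W (src p)" using p by (simp add: mor_iff)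
  then have gp: "coker_of p g" using is_cokernel_imp_coker_of(1) W by blast
  obtain u where u: "in_hom u (src g) (src k)" "k \<bullet> u = g"
    by (rule ker_of_factor[OF k, of g]) (use g coker_ofD[OF gp] in simp_all)
  show ?thesis
    unfolding coker_of_def
  proof (intro conjI allI impI)
    fix h assume h: "arr h" "src h = tgt k" "h \<bullet> k = \<zero>\<^bsub>Hom C (src k) (tgt h)\<^esub>"
    have "h \<bullet> g = (h \<bullet> k) \<bullet> u" using u(1) h(1,2) kD by (simp add: u(2))
    also have "\<dots> = \<zero>\<^bsub>Hom C (src g) (tgt h)\<^esub>" using u(1) h by simp
    finally show "\<exists>w. in_hom w (tgt p) (tgt h) \<and> w \<bullet> p = h"
      using coker_of_factor[OF gp, of h] h g kD by metis
  qed (use p kD in simp_all)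
qed

lemma mono_epi_iso:
  assumes m: "mono f" and e: "epi f" shows "iso f"
proof -
  have f: "arr f" using m by simp
  obtain c where c: "coker_of c f" using ex_coker[OF f] .
  note cD = coker_ofD[OF c]
  have cz: "c = \<zero>\<^bsub>Hom C (tgt f) (tgt c)\<^esub>" by (rule epi_zeroD[OF e]) (use cD in simp_all)
  have "c \<bullet> Ident C (tgt f) = \<zero>\<^bsub>Hom C (tgt f) (tgt c)\<^esub>" using cD cz f by simp
  then obtain u where u: "in_hom u (tgt f) (src f)" "f \<bullet> u = Ident C (tgt f)"
    using ker_of_factor[OF mono_is_ker_of_coker[OF m c], of "Ident C (tgt f)"] f cD by auto
  have "u \<bullet> f = Ident C (src f)"
  proof (rule monoD[OF m])
    have "f \<bullet> u \<bullet> f = Ident C (tgt f) \<bullet> f" by (rule comp_reduce[OF u(2)]) (use u f in simp_all)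
    then show "f \<bullet> u \<bullet> f = f \<bullet> Ident C (src f)" using f by simp
  qed (use u f in simp_all)
  then show ?thesis using u f by (intro isoI[of f u]) simp_all
qed

text \<open>Take for \<open>m\<close> the kernel of the cokernel of \<open>f\<close>. If \<open>u \<bullet> e = 0\<close>, then \<open>f\<close> factors through the smaller subobject given by
  the kernel of \<open>u\<close>, which is again the kernel of its cokernel; so it contains \<open>m\<close>, and \<open>u = 0\<close>.\<close>

lemma image_factorization:
  assumes f: "arr f"
  obtains m e where "mono m" "epi e" "tgt e = src m" "src e = src f" "tgt m = tgt f" "f = m \<bullet> e"
proof -
  obtain p where p: "coker_of p f" using ex_coker[OF f] .
  note pD = coker_ofD[OF p]
  obtain m where m: "ker_of m p" using ex_ker[OF pD(2)] .
  note mD = ker_ofD[OF m]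
  obtain e where e: "in_hom e (src f) (src m)" "m \<bullet> e = f"
    by (rule ker_of_factor[OF m, of f]) (use pD f in simp_all)
  have "epi e"
  proof (rule epi_zeroI)
    fix u assume u: "arr u" "src u = tgt e" "u \<bullet> e = \<zero>\<^bsub>Hom C (src e) (tgt u)\<^esub>"
    obtain k where k: "ker_of k u" using ex_ker[OF u(1)] .
    note kD = ker_ofD[OF k]
    obtain e' where e': "in_hom e' (src e) (src k)" "k \<bullet> e' = e"
      by (rule ker_of_factor[OF k, of e]) (use u e in simp_all)
    have mk: "mono (m \<bullet> k)" by (rule mono_comp) (use mD kD u e in simp_all)
    obtain q where q: "coker_of q (m \<bullet> k)" using ex_coker[OF mono_arr[OF mk]] .
    note qD = coker_ofD[OF q]
    have mk_simps: "src (m \<bullet> k) = src k" "tgt (m \<bullet> k) = tgt f" using mD kD u e pD by simp_all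
    have "q \<bullet> f = (q \<bullet> m \<bullet> k) \<bullet> e'"
      using mD kD u(1,2) e qD(2) e'(1) mk_simps qD(4) pD by (simp add: e'(2) e(2))
    also have "\<dots> = \<zero>\<^bsub>Hom C (src f) (tgt q)\<^esub>"
      using qD e' e mk_simps by simp
    finally obtain t where t: "in_hom t (tgt p) (tgt q)" "t \<bullet> p = q"
      using coker_of_factor[OF p, of q] qD mk_simps by metis
    have "q \<bullet> m = (t \<bullet> p) \<bullet> m" by (simp only: t(2))
    also have "\<dots> = t \<bullet> p \<bullet> m" by (rule comp_assoc') (use t(1) mD pD in simp_all)
    also have "\<dots> = \<zero>\<^bsub>Hom C (src m) (tgt q)\<^esub>" using t(1) mD pD by simp
    finally obtain w where w: "in_hom w (src m) (src k)" "(m \<bullet> k) \<bullet> w = m"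
      using ker_of_factor[OF mono_is_ker_of_coker[OF mk q], of m] mD qD mk_simps pD by auto
    have kw: "k \<bullet> w = Ident C (src m)"
      by (rule monoD[OF mD(1)]) (use w mD kD u e in simp_all)
    have "u = u \<bullet> k \<bullet> w" using u e by (simp add: kw)
    also have "\<dots> = \<zero>\<^bsub>Hom C (src k) (tgt u)\<^esub> \<bullet> w"
      by (rule comp_reduce[OF kD(5)]) (use kD w u e in simp_all)
    also have "\<dots> = \<zero>\<^bsub>Hom C (tgt e) (tgt u)\<^esub>" using w u e by simp
    finally show "u = \<zero>\<^bsub>Hom C (tgt e) (tgt u)\<^esub>" .
  qed (use e in simp)
  then show ?thesis by (rule that[of m e, rotated]) (use mD e pD in simp_all)
qed

text \<open>Exactness of \<open>Hom(P, -)\<close> at the middle term of a right exact sequence.\<close>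

lemma projective_lift_coker:
  assumes P: "is_projective C P" and c: "coker_of c r"
    and f: "arr f" "src f = P" "tgt f = tgt r" "c \<bullet> f = \<zero>\<^bsub>Hom C P (tgt c)\<^esub>"
  obtains g where "in_hom g P (src r)" "r \<bullet> g = f"
proof -
  note cD = coker_ofD[OF c]
  obtain m e where me: "mono m" "epi e" "tgt e = src m" "src e = src r" "tgt m = tgt r" "r = m \<bullet> e"
    using image_factorization[OF cD(3)] .
  have cm: "c \<bullet> m = \<zero>\<^bsub>Hom C (src m) (tgt c)\<^esub>"
  proof (rule epiD[OF me(2)])
    show "(c \<bullet> m) \<bullet> e = \<zero>\<^bsub>Hom C (src m) (tgt c)\<^esub> \<bullet> e" using me cD by simp
  qed (use me cD in simp_all)
  have "coker_of c m"
    unfolding coker_of_def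
  proof (intro conjI allI impI)
    fix g assume g: "arr g" "src g = tgt m" "g \<bullet> m = \<zero>\<^bsub>Hom C (src m) (tgt g)\<^esub>"
    have "g \<bullet> r = (g \<bullet> m) \<bullet> e" using me g(1,2) by simp
    also have "\<dots> = \<zero>\<^bsub>Hom C (src r) (tgt g)\<^esub>" using me g by simp
    finally show "\<exists>u. in_hom u (tgt c) (tgt g) \<and> u \<bullet> c = g"
      using coker_of_factor[OF c, of g] g me by metis
  qed (use me cD cm in simp_all)
  then have "ker_of m c" by (rule mono_is_ker_of_coker[OF me(1)])
  then obtain u where u: "in_hom u P (src m)" "m \<bullet> u = f"
    using ker_of_factor[of m c f] f cD by metis
  obtain g where g: "in_hom g P (src e)" "e \<bullet> g = u"
    by (rule projective_lift[OF P me(2), of u]) (use u me(1-5) in simp_all)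
  have "r \<bullet> g = m \<bullet> e \<bullet> g" unfolding me(6) by (rule comp_assoc') (use g me(1-5) in simp_all)
  also have "\<dots> = f" by (simp only: g(2) u(2))
  finally show ?thesis by (rule that[rotated]) (use g me(4) in simp)
qed

subsection \<open>Simple objects\<close>

lemma simple_nonzero: "is_simple C S \<Longrightarrow> S \<in> Obj C \<and> Ident C S \<noteq> \<zero>\<^bsub>Hom C S S\<^esub>"
  unfolding is_simple_def zero_object_iff by blast

lemma simple_mono:
  assumes S: "is_simple C S" and f: "arr f" "src f = S" "f \<noteq> \<zero>\<^bsub>Hom C S (tgt f)\<^esub>"
  shows "mono f"
proof (rule mono_zeroI[OF f(1)])
  fix g assume g: "arr g" "tgt g = src f" "f \<bullet> g = \<zero>\<^bsub>Hom C (src g) (tgt f)\<^esub>"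
  obtain k where k: "ker_of k f" using ex_ker[OF f(1)] .
  note kD = ker_ofD[OF k]
  obtain u where u: "in_hom u (src g) (src k)" "k \<bullet> u = g" using ker_of_factor[OF k g] .
  have "is_mono C (src k) S k" using kD f by (subst is_mono_iff_mono) auto
  then have "is_zero_object C (src k) \<or> is_iso C (src k) S k" using S kD unfolding is_simple_def by simp
  moreover have "\<not> is_iso C (src k) S k"
  proof
    assume "is_iso C (src k) S k"
    then have "iso k" using kD f by (subst (asm) is_iso_iff) auto
    then have "f = \<zero>\<^bsub>Hom C (tgt k) (tgt f)\<^esub>"
      by (intro epi_zeroD iso_epi) (use kD in simp_all)
    then show False using f kD(4) by simp
  qed
  ultimately have "is_zero_object C (src k)" by blast
  then have "k = \<zero>\<^bsub>Hom C (src k) (tgt k)\<^esub>" by (rule arr_from_zero) (use kD in simp_all)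
  then have "g = \<zero>\<^bsub>Hom C (src k) (tgt k)\<^esub> \<bullet> u" using u(2) by (simp only:)
  also have "\<dots> = \<zero>\<^bsub>Hom C (src g) (src f)\<^esub>" using u(1) kD by simp
  finally show "g = \<zero>\<^bsub>Hom C (src g) (src f)\<^esub>" .
qed

lemma simple_epi:
  assumes S: "is_simple C S" and f: "arr f" "tgt f = S" "f \<noteq> \<zero>\<^bsub>Hom C (src f) S\<^esub>"
  shows "epi f"
proof -
  obtain m e where me: "mono m" "epi e" "tgt e = src m" "src e = src f" "tgt m = tgt f" "f = m \<bullet> e"
    using image_factorization[OF f(1)] .
  have "is_mono C (src m) S m" using me(1-5) f by (subst is_mono_iff_mono) auto
  then have "is_zero_object C (src m) \<or> is_iso C (src m) S m" using S me(1) unfolding is_simple_def by simp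
  moreover have "\<not> is_zero_object C (src m)"
  proof
    assume "is_zero_object C (src m)"
    then have "m = \<zero>\<^bsub>Hom C (src m) (tgt m)\<^esub>" by (rule arr_from_zero) (use me(1) in simp_all)
    then have "f = \<zero>\<^bsub>Hom C (src m) (tgt m)\<^esub> \<bullet> e" using me(6) by (simp only:)
    also have "\<dots> = \<zero>\<^bsub>Hom C (src f) S\<^esub>" using me(1-5) f(1,2) simple_nonzero[OF S] by simp
    finally show False using f(3) by simp
  qed
  ultimately have "is_iso C (src m) S m" by blast
  then have "iso m" by (subst (asm) is_iso_iff) (use me(1-5) f in auto)
  then show ?thesis unfolding me(6) by (intro epi_comp iso_epi me)
qed

lemma simple_iso:
  assumes "is_simple C S" "is_simple C T" "in_hom f S T" "f \<noteq> \<zero>\<^bsub>Hom C S T\<^esub>"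
  shows "iso f"
  using assms by (intro mono_epi_iso simple_mono[of S] simple_epi[of T]) simp_all

end

section \<open>Projective covers of simple objects\<close>

context finite_linear_category begin

lemma projective_epi_endo_iso:
  assumes P: "is_projective C P" and e: "in_hom e P P" "epi e"
  shows "iso e"
proof -
  have PO: "P \<in> Obj C" using P by (simp add: is_projective_def)
  obtain s where s: "in_hom s P P" "e \<bullet> s = Ident C P"
    by (rule projective_lift[OF P e(2), of "Ident C P"]) (use e PO in simp_all)
  have "s \<bullet> e = Ident C P"
    by (rule right_inverse_is_left_inverse[OF PO hom_finite_dimensional[OF PO PO] e(1) s])
  then show ?thesis using e s by (intro isoI[of e s]) simp_all
qed

lemma composition_series:
  assumes X: "X \<in> Obj C" "Ident C X \<noteq> \<zero>\<^bsub>Hom C X X\<^esub>"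
  obtains n Y i where "is_zero_object C (Y 0)" "Y (Suc n) = X"
    "\<And>j. j \<le> n \<Longrightarrow> mono (i j) \<and> src (i j) = Y j \<and> tgt (i j) = Y (Suc j)"
    "\<And>j. j \<le> n \<Longrightarrow> \<exists>S p. coker_of p (i j) \<and> tgt p = S \<and> is_simple C S"
proof -
  obtain N Y i where Y: "\<forall>j \<le> N. Y j \<in> Obj C" "is_zero_object C (Y 0)" "Y N = X"
    and i: "\<forall>j < N. is_mono C (Y j) (Y (Suc j)) (i j) \<and>
           (\<exists>S p. is_cokernel C (Y j) (Y (Suc j)) (i j) S p \<and> is_simple C S)"
    using finite_length[OF X(1)] unfolding has_finite_length_def by blast
  have "N \<noteq> 0"
  proof
    assume "N = 0"
    then have "is_zero_object C X" using Y by simp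
    then show False using X by (simp add: zero_object_iff)
  qed
  then obtain n where n: "N = Suc n" using not0_implies_Suc by blast
  have YO: "Y j \<in> Obj C" "Y (Suc j) \<in> Obj C" if "j \<le> n" for j using Y(1) that n by simp_all
  have m: "mono (i j) \<and> src (i j) = Y j \<and> tgt (i j) = Y (Suc j)" if "j \<le> n" for j
  proof -
    have "is_mono C (Y j) (Y (Suc j)) (i j)" using i that n by simp
    then show ?thesis using is_mono_iff_mono[OF YO[OF that]] by blast
  qed
  moreover have "\<exists>S p. coker_of p (i j) \<and> tgt p = S \<and> is_simple C S" if le: "j \<le> n" for j
  proof -
    obtain S p where Sp: "is_cokernel C (Y j) (Y (Suc j)) (i j) S p" "is_simple C S"
      using i le n by (metis less_Suc_eq_le)
    have "in_hom (i j) (Y j) (Y (Suc j))" using m[OF le] by simp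
    from is_cokernel_imp_coker_of[OF Sp(1) this] show ?thesis using Sp(2) by blast
  qed
  ultimately show ?thesis using that[of Y n i] Y n by simp
qed

lemma ex_simple_quotient:
  assumes X: "X \<in> Obj C" "Ident C X \<noteq> \<zero>\<^bsub>Hom C X X\<^esub>"
  obtains e where "epi e" "src e = X" "is_simple C (tgt e)"
proof -
  obtain n Y i where Y: "Y (Suc n) = X"
    and m: "\<And>j. j \<le> n \<Longrightarrow> mono (i j) \<and> src (i j) = Y j \<and> tgt (i j) = Y (Suc j)"
    and c: "\<And>j. j \<le> n \<Longrightarrow> \<exists>S p. coker_of p (i j) \<and> tgt p = S \<and> is_simple C S"
    using composition_series[OF X] by blast
  obtain p where p: "coker_of p (i n)" "is_simple C (tgt p)" using c[of n] by blast
  have "src p = X" using coker_ofD(4)[OF p(1)] m[of n] Y by simp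
  then show ?thesis using that[of p] p coker_ofD(1)[OF p(1)] by blast
qed

text \<open>The second term of a composition series is the cokernel of a zero morphism, hence simple.\<close>

lemma ex_simple_subobject:
  assumes X: "X \<in> Obj C" "Ident C X \<noteq> \<zero>\<^bsub>Hom C X X\<^esub>"
  obtains m where "mono m" "tgt m = X" "is_simple C (src m)"
proof -
  obtain n Y i where Y0: "is_zero_object C (Y 0)" and Y: "Y (Suc n) = X"
    and m: "\<And>j. j \<le> n \<Longrightarrow> mono (i j) \<and> src (i j) = Y j \<and> tgt (i j) = Y (Suc j)"
    and c: "\<And>j. j \<le> n \<Longrightarrow> \<exists>S p. coker_of p (i j) \<and> tgt p = S \<and> is_simple C S"
    using composition_series[OF X] by blast
  obtain p where p: "coker_of p (i 0)" "is_simple C (tgt p)" using c[of 0] by blast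
  note pD = coker_ofD[OF p(1)]
  have i0: "arr (i 0)" "src (i 0) = Y 0" "tgt (i 0) = Y 1" using m[of 0] by simp_all
  have Y1: "Y 1 \<in> Obj C" using i0 by (metis arr_obj(2))
  have "i 0 = \<zero>\<^bsub>Hom C (Y 0) (Y 1)\<^esub>" using arr_from_zero[OF Y0 i0(1,2)] i0(3) by simp
  then have "Ident C (Y 1) \<bullet> i 0 = \<zero>\<^bsub>Hom C (src (i 0)) (tgt (Ident C (Y 1)))\<^esub>" using i0 Y1 by simp
  then obtain u where u: "in_hom u (tgt p) (Y 1)" "u \<bullet> p = Ident C (Y 1)"
    using coker_of_factor[OF p(1), of "Ident C (Y 1)"] i0 Y1 by auto
  have "p \<bullet> u = Ident C (tgt p)"
  proof (rule epiD[OF pD(1)])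
    have "(p \<bullet> u) \<bullet> p = p \<bullet> u \<bullet> p" using u(1) pD i0 by (intro comp_assoc') simp_all
    also have "\<dots> = p \<bullet> Ident C (Y 1)" by (simp only: u(2))
    also have "\<dots> = Ident C (tgt p) \<bullet> p" using pD i0 Y1 by simp
    finally show "(p \<bullet> u) \<bullet> p = Ident C (tgt p) \<bullet> p" .
  qed (use u(1) pD i0 in simp_all)
  then have "iso u" using u pD i0 by (intro isoI[of u p]) simp_all
  then have base: "\<exists>m. mono m \<and> tgt m = Y 1 \<and> is_simple C (src m)"
    by (intro exI[of _ u]) (use u(1) p(2) in \<open>simp add: iso_mono\<close>)
  have "\<exists>m. mono m \<and> tgt m = Y (Suc j) \<and> is_simple C (src m)" if "j \<le> n" for j
    using that
  proof (induction j)
    case 0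
    then show ?case using base by simp
  next
    case (Suc j)
    then obtain k where k: "mono k" "tgt k = Y (Suc j)" "is_simple C (src k)" by auto
    have j: "mono (i (Suc j))" "src (i (Suc j)) = Y (Suc j)" "tgt (i (Suc j)) = Y (Suc (Suc j))"
      using m[OF Suc.prems] by simp_all
    have "mono (i (Suc j) \<bullet> k)" "tgt (i (Suc j) \<bullet> k) = Y (Suc (Suc j))" "src (i (Suc j) \<bullet> k) = src k"
      using j k by (simp_all add: mono_comp)
    then show ?case using k(3) by metis
  qed
  from this[of n] show ?thesis using that Y by auto
qed

text \<open>Over a simple object the superfluity of a projective cover says that a morphism into the cover is already epic
  if it does not become zero in the simple object.\<close>

definition simple_cover :: "'c \<Rightarrow> 'c \<Rightarrow> 'd \<Rightarrow> bool" where
  "simple_cover S P p \<longleftrightarrow> is_simple C S \<and> is_projective C P \<and> epi p \<and> src p = P \<and> tgt p = S \<and>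
     (\<forall>g. arr g \<longrightarrow> tgt g = P \<longrightarrow> p \<bullet> g \<noteq> \<zero>\<^bsub>Hom C (src g) S\<^esub> \<longrightarrow> epi g)"

lemma ex_simple_cover:
  assumes S: "is_simple C S"
  shows "\<exists>P p. simple_cover S P p"
proof -
  have SO: "S \<in> Obj C" using S by (simp add: is_simple_def)
  obtain P p where P: "is_projective C P" "is_epi C P S p"
    and c: "\<forall>Y \<in> Obj C. \<forall>g \<in> mor C Y P. is_epi C Y S (p \<bullet> g) \<longrightarrow> is_epi C Y P g"
    using projective_covers[OF SO] unfolding is_projective_cover_def by blast
  have PO: "P \<in> Obj C" using P(1) by (simp add: is_projective_def)
  have p: "epi p" "src p = P" "tgt p = S" using P(2) by (simp_all add: is_epi_iff_epi PO SO)
  have "epi g" if g: "arr g" "tgt g = P" "p \<bullet> g \<noteq> \<zero>\<^bsub>Hom C (src g) S\<^esub>" for g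
  proof -
    have pg: "arr (p \<bullet> g)" "src (p \<bullet> g) = src g" "tgt (p \<bullet> g) = S" using p g(1,2) by simp_all
    then have "epi (p \<bullet> g)" using g(3) by (intro simple_epi[OF S]) simp_all
    then have "is_epi C (src g) S (p \<bullet> g)" using pg SO g(1) by (subst is_epi_iff_epi) simp_all
    then have "is_epi C (src g) P g" using c g(1,2) by simp
    then show ?thesis using g PO by (simp add: is_epi_iff_epi)
  qed
  then show ?thesis using S P(1) p unfolding simple_cover_def by blast
qed

lemma simple_coverD:
  assumes "simple_cover S P p"
  shows "is_simple C S" "is_projective C P" "epi p" "arr p" "src p = P" "tgt p = S" "P \<in> Obj C" "S \<in> Obj C"
    "p \<noteq> \<zero>\<^bsub>Hom C P S\<^esub>"
proof -
  show *: "is_simple C S" "is_projective C P" "epi p" "arr p" "src p = P" "tgt p = S" "P \<in> Obj C" "S \<in> Obj C"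
    using assms unfolding simple_cover_def is_simple_def is_projective_def by simp_all
  show "p \<noteq> \<zero>\<^bsub>Hom C P S\<^esub>"
  proof
    assume z: "p = \<zero>\<^bsub>Hom C P S\<^esub>"
    have "Ident C S = \<zero>\<^bsub>Hom C (tgt p) (tgt (Ident C S))\<^esub>"
      by (rule epi_zeroD[OF *(3)]) (use * in \<open>simp_all add: z\<close>)
    then show False using simple_nonzero[OF *(1)] * by simp
  qed
qed

lemma simple_cover_epi:
  "\<lbrakk> simple_cover S P p; arr g; tgt g = P; p \<bullet> g \<noteq> \<zero>\<^bsub>Hom C (src g) S\<^esub> \<rbrakk> \<Longrightarrow> epi g"
  unfolding simple_cover_def by blast

text \<open>The endomorphism algebra of \<open>P\<close> is local: \<open>p\<close> is the sum of \<open>p \<bullet> e\<close> and \<open>p \<bullet> (1 - e)\<close>, so one of the two is nonzero; the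
  corresponding endomorphism is then epic, and an epic endomorphism of a projective object with finite-dimensional
  endomorphism algebra is invertible.\<close>

lemma simple_cover_local:
  assumes c: "simple_cover S P p" and e: "in_hom e P P"
  shows "iso e \<or> iso (Ident C P \<ominus>\<^bsub>Hom C P P\<^esub> e)"
proof -
  note D = simple_coverD[OF c]
  let ?d = "Ident C P \<ominus>\<^bsub>Hom C P P\<^esub> e"
  have d: "in_hom ?d P P" using e D by simp
  have "p \<bullet> e \<noteq> \<zero>\<^bsub>Hom C P S\<^esub> \<or> p \<bullet> ?d \<noteq> \<zero>\<^bsub>Hom C P S\<^esub>"
  proof (rule ccontr)
    assume "\<not> ?thesis"
    then have z: "p \<bullet> e = \<zero>\<^bsub>Hom C P S\<^esub>" "p \<bullet> ?d = \<zero>\<^bsub>Hom C P S\<^esub>" by simp_all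
    have "p \<bullet> ?d = p \<ominus>\<^bsub>Hom C P S\<^esub> (p \<bullet> e)" using e D by (simp add: comp_sub)
    then have "p \<ominus>\<^bsub>Hom C P S\<^esub> (p \<bullet> e) = \<zero>\<^bsub>Hom C P S\<^esub>" by (simp only: z(2))
    then have "p = p \<bullet> e" by (rule iffD1[OF sub_eq_zero_iff, rotated -1]) (use e D in simp_all)
    then show False using z(1) D by simp
  qed
  then show ?thesis
  proof
    assume "p \<bullet> e \<noteq> \<zero>\<^bsub>Hom C P S\<^esub>"
    then have "epi e" using e by (intro simple_cover_epi[OF c]) simp_all
    then show ?thesis using projective_epi_endo_iso[OF D(2) e] by blast
  next
    assume "p \<bullet> ?d \<noteq> \<zero>\<^bsub>Hom C P S\<^esub>"
    then have "epi ?d" using d by (intro simple_cover_epi[OF c]) simp_all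
    then show ?thesis using projective_epi_endo_iso[OF D(2) d] by blast
  qed
qed

text \<open>\<open>1 - e\<close> kills the nonzero morphism \<open>v\<close>, so by locality it is \<open>e\<close> that is invertible.\<close>

lemma simple_cover_fixed_iso:
  assumes c: "simple_cover S P p" and e: "in_hom e P P" and v: "arr v" "tgt v = P" "v \<noteq> \<zero>\<^bsub>Hom C (src v) P\<^esub>"
    and ev: "e \<bullet> v = v"
  shows "iso e"
proof (rule ccontr)
  note D = simple_coverD[OF c]
  let ?d = "Ident C P \<ominus>\<^bsub>Hom C P P\<^esub> e"
  assume "\<not> iso e"
  then have "iso ?d" using simple_cover_local[OF c e] by blast
  moreover have "?d \<bullet> v = \<zero>\<^bsub>Hom C (src v) P\<^esub>"
    using e D v(1,2) ev by (simp add: sub_comp sub_eq_zero_iff)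
  ultimately have "v = \<zero>\<^bsub>Hom C (src v) (src ?d)\<^esub>"
    using e D v(1,2) by (intro mono_zeroD[OF iso_mono]) simp_all
  then show False using v e D by simp
qed

text \<open>The simple object \<open>S\<close> is the top of \<open>P\<close>: the kernel of \<open>e\<close> is a proper subobject, and by superfluity \<open>p\<close> vanishes on every
  proper subobject.\<close>

lemma simple_cover_top:
  assumes c: "simple_cover S P p" and e: "epi e" "src e = P" "Ident C (tgt e) \<noteq> \<zero>\<^bsub>Hom C (tgt e) (tgt e)\<^esub>"
  obtains w where "in_hom w (tgt e) S" "w \<bullet> e = p"
proof -
  note D = simple_coverD[OF c]
  have ea: "arr e" using e(1) by simp
  obtain k where k: "ker_of k e" using ex_ker[OF ea] .
  note kD = ker_ofD[OF k]
  have "p \<bullet> k = \<zero>\<^bsub>Hom C (src k) S\<^esub>"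
  proof (rule ccontr)
    assume "p \<bullet> k \<noteq> \<zero>\<^bsub>Hom C (src k) S\<^esub>"
    then have "epi k" using kD e by (intro simple_cover_epi[OF c]) simp_all
    then have "e = \<zero>\<^bsub>Hom C (tgt k) (tgt e)\<^esub>" using kD by (intro epi_zeroD) simp_all
    then have "Ident C (tgt e) \<bullet> e = \<zero>\<^bsub>Hom C (src e) (tgt e)\<^esub>" using kD ea by simp
    then have "Ident C (tgt e) = \<zero>\<^bsub>Hom C (tgt e) (tgt (Ident C (tgt e)))\<^esub>"
      using ea by (intro epi_zeroD[OF e(1)]) simp_all
    then show False using e ea by simp
  qed
  then have "p \<bullet> k = \<zero>\<^bsub>Hom C (src k) (tgt p)\<^esub>" using D by simp
  then obtain w where "in_hom w (tgt e) (tgt p)" "w \<bullet> e = p"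
    using coker_of_factor[OF epi_is_coker_of_ker[OF e(1) k], of p] D kD e by metis
  then show ?thesis using that D by simp
qed

end

section \<open>Categories in which projective objects are injective\<close>

locale quasi_frobenius_category = finite_linear_category +
  assumes projective_extend:
    "\<lbrakk> is_projective C P; mono f; arr g; src g = src f; tgt g = P \<rbrakk> \<Longrightarrow> \<exists>h. in_hom h (tgt f) P \<and> h \<bullet> f = g"
begin

text \<open>A simple subobject \<open>v\<close> that meets another subobject \<open>m\<close> trivially stays a subobject of the cokernel of \<open>m\<close>.
  Injectivity then yields an endomorphism that fixes \<open>v\<close> and kills \<open>m\<close>, contrary to locality.\<close>

lemma simple_cover_socle:
  assumes c: "simple_cover S P p" and v: "mono v" "tgt v = P" "is_simple C (src v)"
    and m: "mono m" "tgt m = P" "m \<noteq> \<zero>\<^bsub>Hom C (src m) P\<^esub>"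
  obtains w where "in_hom w (src v) (src m)" "m \<bullet> w = v"
proof -
  note D = simple_coverD[OF c]
  obtain q where q: "coker_of q m" using ex_coker[OF mono_arr[OF m(1)]] .
  note qD = coker_ofD[OF q]
  have v0: "v \<noteq> \<zero>\<^bsub>Hom C (src v) P\<^esub>"
  proof
    assume z: "v = \<zero>\<^bsub>Hom C (src v) P\<^esub>"
    have "v \<bullet> Ident C (src v) = \<zero>\<^bsub>Hom C (src v) (tgt v)\<^esub>" using z v by simp
    then have "Ident C (src v) = \<zero>\<^bsub>Hom C (src (Ident C (src v))) (src v)\<^esub>"
      using v by (intro mono_zeroD) simp_all
    then show False using simple_nonzero[OF v(3)] by simp
  qed
  have "q \<bullet> v = \<zero>\<^bsub>Hom C (src v) (tgt q)\<^esub>"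
  proof (rule ccontr)
    assume ne: "q \<bullet> v \<noteq> \<zero>\<^bsub>Hom C (src v) (tgt q)\<^esub>"
    have qv: "arr (q \<bullet> v)" "src (q \<bullet> v) = src v" "tgt (q \<bullet> v) = tgt q" using qD v m by simp_all
    then have "mono (q \<bullet> v)" using simple_mono[OF v(3), of "q \<bullet> v"] ne by simp
    then obtain h where h: "in_hom h (tgt q) P" "h \<bullet> q \<bullet> v = v"
      using projective_extend[OF D(2), of "q \<bullet> v" v] qv v by auto
    let ?e = "h \<bullet> q"
    have e: "in_hom ?e P P" using h qD m by simp
    have "?e \<bullet> v = h \<bullet> q \<bullet> v" using h(1) qD v m by (intro comp_assoc') simp_all
    then have "iso ?e" using h(2) v v0 by (intro simple_cover_fixed_iso[OF c e, of v]) simp_all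
    moreover have "?e \<bullet> m = \<zero>\<^bsub>Hom C (src m) P\<^esub>" using h(1) qD m by simp
    ultimately have "m = \<zero>\<^bsub>Hom C (src m) (src ?e)\<^esub>" using e m by (intro mono_zeroD[OF iso_mono]) simp_all
    then show False using e m by simp
  qed
  then show ?thesis
    by (rule_tac ker_of_factor[OF mono_is_ker_of_coker[OF m(1) q], of v])
      (use v qD m in simp_all, use that in blast)
qed

text \<open>The socle of a projective cover determines the cover, hence its top: an isomorphism between socles extends
  in both directions by injectivity, and by locality the two extensions are mutually inverse up to automorphisms.\<close>

lemma simple_cover_socle_inj:
  assumes c: "simple_cover S P p" and c': "simple_cover S' P' p'"
    and v: "mono v" "tgt v = P" "src v = T" and v': "mono v'" "tgt v' = P'" "src v' = T" and T: "is_simple C T"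
  shows "isomorphic C S S'"
proof -
  note D = simple_coverD[OF c] and D' = simple_coverD[OF c']
  have v0: "u \<noteq> \<zero>\<^bsub>Hom C (src u) (tgt u)\<^esub>" if "mono u" "src u = T" for u
  proof
    assume z: "u = \<zero>\<^bsub>Hom C (src u) (tgt u)\<^esub>"
    have "u \<bullet> Ident C T = \<zero>\<^bsub>Hom C (src u) (tgt u)\<^esub>" using z that by simp
    then have "Ident C T = \<zero>\<^bsub>Hom C (src (Ident C T)) (src u)\<^esub>"
      using that simple_nonzero[OF T] by (intro mono_zeroD[OF that(1)]) simp_all
    then show False using simple_nonzero[OF T] that by simp
  qed
  obtain f where f: "in_hom f P P'" "f \<bullet> v = v'" using projective_extend[OF D'(2) v(1), of v'] v v' by auto
  obtain g where g: "in_hom g P' P" "g \<bullet> v' = v" using projective_extend[OF D(2) v'(1), of v] v v' by auto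
  have fg: "in_hom (f \<bullet> g) P' P'" using f g by simp
  have "(f \<bullet> g) \<bullet> v' = f \<bullet> g \<bullet> v'" using f(1) g(1) v' by (intro comp_assoc') simp_all
  then have "(f \<bullet> g) \<bullet> v' = v'" by (simp only: f(2) g(2))
  then have "iso (f \<bullet> g)" using simple_cover_fixed_iso[OF c' fg, of v'] v' v0[OF v'(1,3)] by simp
  then have "epi f" using epi_of_comp[OF iso_epi] f g by simp
  then have e: "epi (p' \<bullet> f)" using f D' by (intro epi_comp) simp_all
  have es: "src (p' \<bullet> f) = P" "tgt (p' \<bullet> f) = S'" using f D' by simp_all
  obtain w where w: "in_hom w S' S" "w \<bullet> p' \<bullet> f = p"
    using simple_cover_top[OF c e] es simple_nonzero[OF D'(1)] by metis
  have "w \<noteq> \<zero>\<^bsub>Hom C S' S\<^esub>"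
  proof
    assume "w = \<zero>\<^bsub>Hom C S' S\<^esub>"
    then have "p = \<zero>\<^bsub>Hom C P S\<^esub>" using w(2) es D epi_arr[OF e] zero_comp[of "p' \<bullet> f" S' S] by simp
    then show False using D by simp
  qed
  then have "iso w" using simple_iso[OF D'(1) D(1) w(1)] by simp
  then show ?thesis using w D D' isomorphic_sym isomorphicI by metis
qed

end

text \<open>If \<open>s\<close> is a section of \<open>q\<close>, then \<open>1 - s \<bullet> q\<close> factors through the kernel of \<open>q\<close>, and the factor is the retraction.\<close>

lemma (in abelian_linear_category) ker_splits:
  assumes k: "ker_of k q" and q: "epi q" "is_projective C (tgt q)"
  obtains r where "in_hom r (tgt k) (src k)" "r \<bullet> k = Ident C (src k)"
proof -
  note kD = ker_ofD[OF k]
  let ?Y = "src q" and ?Z = "tgt q"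
  have obj: "?Y \<in> Obj C" "?Z \<in> Obj C" using q by simp_all
  obtain s where s: "in_hom s ?Z ?Y" "q \<bullet> s = Ident C ?Z"
    by (rule projective_lift[OF q(2,1), of "Ident C ?Z"]) (use obj in simp_all)
  let ?i = "Ident C ?Y \<ominus>\<^bsub>Hom C ?Y ?Y\<^esub> (s \<bullet> q)"
  have i: "in_hom ?i ?Y ?Y" using s(1) kD(3) obj by simp
  have sc: "q \<bullet> s \<bullet> q = Ident C ?Z \<bullet> q"
    by (rule comp_reduce[OF s(2)]) (use s(1) kD(3) in simp_all)
  have "q \<bullet> ?i = (q \<bullet> Ident C ?Y) \<ominus>\<^bsub>Hom C ?Y ?Z\<^esub> (q \<bullet> s \<bullet> q)"
    by (rule comp_sub) (use s(1) kD(3) obj in simp_all)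
  also have "\<dots> = \<zero>\<^bsub>Hom C ?Y ?Z\<^esub>"
    unfolding sc by (subst sub_eq_zero_iff) (use kD(3) obj in simp_all)
  finally have "q \<bullet> ?i = \<zero>\<^bsub>Hom C (src ?i) ?Z\<^esub>" using i by simp
  then obtain r where r: "in_hom r (src ?i) (src k)" "k \<bullet> r = ?i"
    by (rule_tac ker_of_factor[OF k, of ?i]) (use i in simp_all)
  have "r \<bullet> k = Ident C (src k)"
  proof (rule monoD[OF kD(1)])
    have "k \<bullet> r \<bullet> k = ?i \<bullet> k" by (rule comp_reduce[OF r(2)]) (use r(1) i kD(2,4) in simp_all)
    also have "\<dots> = (Ident C ?Y \<bullet> k) \<ominus>\<^bsub>Hom C (src k) ?Y\<^esub> ((s \<bullet> q) \<bullet> k)"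
      by (rule sub_comp) (use s(1) kD(2-4) obj in simp_all)
    also have "(s \<bullet> q) \<bullet> k = s \<bullet> q \<bullet> k"
      by (rule comp_assoc') (use s(1) kD(2-4) in simp_all)
    also have "\<dots> = \<zero>\<^bsub>Hom C (src k) ?Y\<^esub>" unfolding kD(5) using s(1) kD(2) by simp
    also have "(Ident C ?Y \<bullet> k) \<ominus>\<^bsub>Hom C (src k) ?Y\<^esub> \<zero>\<^bsub>Hom C (src k) ?Y\<^esub> = k"
    proof -
      interpret H: abelian_group "Hom C (src k) ?Y" using obj kD(2) by (intro hom_abelian_group) simp_all
      have "k \<in> mor C (src k) ?Y" using kD(2,4) by (intro in_mor) simp_all
      then show ?thesis using kD(2,4) by (simp add: H.minus_eq)
    qed
    finally show "k \<bullet> r \<bullet> k = k \<bullet> Ident C (src k)" using kD(2) by simp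
  qed (use r(1) i kD(2,4) in simp_all)
  then show ?thesis using that[of r] r(1) i kD(4) by simp
qed

section \<open>Projective objects of a finite tensor category are injective\<close>

sublocale finite_tensor_category \<subseteq> rigid_category
  by unfold_locales (rule left_duals right_duals, assumption)+

context finite_tensor_category begin

lemma tens_zero:
  assumes "V \<in> Obj C" "X \<in> Obj C" "Y \<in> Obj C"
  shows "Ident C V \<star> \<zero>\<^bsub>Hom C X Y\<^esub> = \<zero>\<^bsub>Hom C (V \<boxtimes> X) (V \<boxtimes> Y)\<^esub>"
proof -
  interpret H: module K "Hom C X Y" using assms by (intro hom_module)
  interpret H': module K "Hom C (V \<boxtimes> X) (V \<boxtimes> Y)" using assms by (intro hom_module) simp_all
  have "Ident C V \<star> \<zero>\<^bsub>Hom C X Y\<^esub> = Ident C V \<star> (\<zero>\<^bsub>K\<^esub> \<odot>\<^bsub>Hom C X Y\<^esub> \<zero>\<^bsub>Hom C X Y\<^esub>)" by simp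
  also have "\<dots> = \<zero>\<^bsub>K\<^esub> \<odot>\<^bsub>Hom C (V \<boxtimes> X) (V \<boxtimes> Y)\<^esub> (Ident C V \<star> \<zero>\<^bsub>Hom C X Y\<^esub>)"
    using assms by (intro tens_smult_right) simp_all
  also have "\<dots> = \<zero>\<^bsub>Hom C (V \<boxtimes> X) (V \<boxtimes> Y)\<^esub>" using assms by (intro H'.smult_l_null) simp_all
  finally show ?thesis .
qed

text \<open>Tensoring on the left has a left adjoint, so it preserves kernels.\<close>

lemma tens_ker:
  assumes V: "V \<in> Obj C" and k: "ker_of k p"
  shows "ker_of (Ident C V \<star> k) (Ident C V \<star> p)"
proof -
  obtain V' e d where "is_duality C V' V e d" using ex_left_dual V by blast
  then interpret duality C V' V e d by unfold_locales
  note kD = ker_ofD[OF k]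
  show ?thesis
    unfolding ker_of_def
  proof (intro conjI allI impI)
    show "mono (Ident C V \<star> k)" by (rule tens_left_mono[OF kD(1)])
    show "(Ident C V \<star> p) \<bullet> (Ident C V \<star> k) = \<zero>\<^bsub>Hom C (src (Ident C V \<star> k)) (tgt (Ident C V \<star> p))\<^esub>"
      using kD by (simp add: interchange tens_zero)
    fix g assume g: "arr g" "tgt g = src (Ident C V \<star> p)"
      "(Ident C V \<star> p) \<bullet> g = \<zero>\<^bsub>Hom C (src g) (tgt (Ident C V \<star> p))\<^esub>"
    let ?g = "\<epsilon> (src p) \<bullet> (Ident C V' \<star> g)"
    have gt: "in_hom ?g (V' \<boxtimes> src g) (src p)" using g kD by simp
    have "p \<bullet> ?g = (p \<bullet> \<epsilon> (src p)) \<bullet> (Ident C V' \<star> g)" using g(1,2) kD by simp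
    also have "\<dots> = (\<epsilon> (tgt p) \<bullet> (Ident C V' \<star> (Ident C V \<star> p))) \<bullet> (Ident C V' \<star> g)"
      using kD by (simp only: ev_nat)
    also have "\<dots> = \<epsilon> (tgt p) \<bullet> (Ident C V' \<star> ((Ident C V \<star> p) \<bullet> g))"
      using g(1,2) kD by (simp add: whisker_left)
    also have "\<dots> = \<zero>\<^bsub>Hom C (V' \<boxtimes> src g) (tgt p)\<^esub>" using g kD by (simp add: tens_zero)
    finally have "p \<bullet> ?g = \<zero>\<^bsub>Hom C (src ?g) (tgt p)\<^esub>" using gt by simp
    then obtain u where u: "in_hom u (V' \<boxtimes> src g) (src k)" "k \<bullet> u = ?g"
      using ker_of_factor[OF k, of ?g] gt by metis
    have "(Ident C V \<star> k) \<bullet> (Ident C V \<star> u) \<bullet> \<eta> (src g) = (Ident C V \<star> (k \<bullet> u)) \<bullet> \<eta> (src g)"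
      using u(1) kD g(1,2) by (simp add: whisker_left)
    also have "\<dots> = g" using unit_transpose[of g "src p"] g kD by (simp add: u(2))
    finally show "\<exists>u. in_hom u (src g) (src (Ident C V \<star> k)) \<and> (Ident C V \<star> k) \<bullet> u = g"
      using u(1) g(1,2) kD by (intro exI[of _ "(Ident C V \<star> u) \<bullet> \<eta> (src g)"]) simp
  qed (use V kD in simp_all)
qed

text \<open>Let \<open>T = P \<boxtimes> (P' \<boxtimes> -)\<close> with \<open>P'\<close> a left dual of \<open>P\<close>. Every value of the exact functor \<open>T\<close> is projective, so
  \<open>T\<close> splits every monomorphism \<open>f\<close>; and the zigzag identity of the duality recovers \<open>g\<close> from \<open>T g\<close>, which extends along \<open>T f\<close>.\<close>

theorem projective_is_injective:
  assumes P: "is_projective C P" and f: "mono f" and g: "arr g" "src g = src f" "tgt g = P"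
  shows "\<exists>h. in_hom h (tgt f) P \<and> h \<bullet> f = g"
proof -
  have PO: "P \<in> Obj C" using P by (simp add: is_projective_def)
  obtain P' e d where dual': "is_duality C P' P e d" using ex_left_dual PO by blast
  then interpret duality C P' P e d by unfold_locales
  have f': "arr f" using f by simp
  obtain c where c: "coker_of c f" using ex_coker[OF f'] .
  note cD = coker_ofD[OF c]
  let ?T = "\<lambda>u. Ident C P \<star> (Ident C P' \<star> u)"
  have T: "ker_of (?T f) (?T c)" by (intro tens_ker mono_is_ker_of_coker[OF f c]) simp_all
  have Tc: "epi (?T c)" by (intro tens_epi cD) simp_all
  have "is_projective C (tgt (?T c))" using projective_tens_right[OF _ P, of "P' \<boxtimes> tgt c"] cD by simp
  then obtain r where r: "in_hom r (tgt (?T f)) (src (?T f))" "r \<bullet> ?T f = Ident C (src (?T f))"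
    using ker_splits[OF T Tc] by blast
  let ?X = "P \<boxtimes> (P' \<boxtimes> src f)" and ?Y = "P \<boxtimes> (P' \<boxtimes> tgt f)"
  have Tf_simps: "in_hom (?T f) ?X ?Y" and obj: "?X \<in> Obj C" "?Y \<in> Obj C" using f' by simp_all
  have rf: "r \<bullet> ?T f = Ident C ?X" and r: "in_hom r ?Y ?X" using r Tf_simps by simp_all
  let ?z = "RUnitor C P \<bullet> (Ident C P \<star> e)"
  have z: "in_hom ?z (P \<boxtimes> (P' \<boxtimes> P)) P" using PO by simp
  have zz: "?z \<bullet> \<eta> P = Ident C P"
    using dual' PO by (simp add: is_duality_def coev_def)
  let ?h = "?z \<bullet> ?T g \<bullet> r \<bullet> \<eta> (tgt f)"
  have Tg: "in_hom (?T g) ?X (P \<boxtimes> (P' \<boxtimes> P))" using g by simp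
  have "?h \<bullet> f = ?z \<bullet> ?T g \<bullet> r \<bullet> \<eta> (tgt f) \<bullet> f"
    using z Tg r f' by (simp del: tens_simps)
  also have "\<eta> (tgt f) \<bullet> f = ?T f \<bullet> \<eta> (src f)" using f' by (simp add: coev_nat)
  also have "r \<bullet> ?T f \<bullet> \<eta> (src f) = Ident C ?X \<bullet> \<eta> (src f)"
    by (rule comp_reduce[OF rf]) (use r Tf_simps f' in simp_all)
  also have "?T g \<bullet> Ident C ?X \<bullet> \<eta> (src f) = \<eta> P \<bullet> g" using g f' by (simp add: coev_nat)
  also have "?z \<bullet> \<eta> P \<bullet> g = Ident C P \<bullet> g"
    by (rule comp_reduce[OF zz]) (use z g in simp_all)
  also have "\<dots> = g" using g by simp
  finally show ?thesis using z Tg r f' by (intro exI[of _ ?h]) (simp del: tens_simps)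
qed

end

sublocale finite_tensor_category \<subseteq> quasi_frobenius_category
  by unfold_locales (rule projective_is_injective)

section \<open>Finite biproducts\<close>

context linear_category begin

lemma finsum_simps [simp]:
  assumes "X \<in> Obj C" "Y \<in> Obj C" "\<And>i. i \<in> I \<Longrightarrow> in_hom (f i) X Y"
  shows "arr (finsum (Hom C X Y) f I)" "src (finsum (Hom C X Y) f I) = X" "tgt (finsum (Hom C X Y) f I) = Y"
proof -
  interpret H: abelian_group "Hom C X Y" using assms by (intro hom_abelian_group)
  have "finsum (Hom C X Y) f I \<in> mor C X Y" using assms by (intro H.finsum_closed) auto
  then show "arr (finsum (Hom C X Y) f I)" "src (finsum (Hom C X Y) f I) = X" "tgt (finsum (Hom C X Y) f I) = Y"
    using assms(1,2) by (simp_all add: mor_iff)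
qed

lemma comp_finsum:
  assumes "finite I" "X \<in> Obj C" "\<And>i. i \<in> I \<Longrightarrow> in_hom (f i) X Y" "in_hom h Y Z"
  shows "h \<bullet> finsum (Hom C X Y) f I = finsum (Hom C X Z) (\<lambda>i. h \<bullet> f i) I"
  using assms
proof (induction I rule: finite_induct)
  case empty
  have YZ: "Y \<in> Obj C" "Z \<in> Obj C" using empty by auto
  interpret H: abelian_group "Hom C X Y" using YZ empty by (intro hom_abelian_group)
  interpret H': abelian_group "Hom C X Z" using YZ empty by (intro hom_abelian_group)
  show ?case using empty YZ by simp
next
  case (insert i I)
  have YZ: "Y \<in> Obj C" "Z \<in> Obj C" using insert by auto
  interpret H: abelian_group "Hom C X Y" using YZ insert by (intro hom_abelian_group)
  interpret H': abelian_group "Hom C X Z" using YZ insert by (intro hom_abelian_group)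
  have fi: "in_hom (f i) X Y" and f: "\<And>j. j \<in> I \<Longrightarrow> in_hom (f j) X Y" using insert.prems by simp_all
  have "finsum (Hom C X Y) f (insert i I) = f i \<oplus>\<^bsub>Hom C X Y\<^esub> finsum (Hom C X Y) f I"
    using insert f fi by (intro H.finsum_insert) auto
  then have "h \<bullet> finsum (Hom C X Y) f (insert i I) = (h \<bullet> f i) \<oplus>\<^bsub>Hom C X Z\<^esub> (h \<bullet> finsum (Hom C X Y) f I)"
    using fi f insert.prems YZ by (simp add: comp_add)
  also have "\<dots> = (h \<bullet> f i) \<oplus>\<^bsub>Hom C X Z\<^esub> finsum (Hom C X Z) (\<lambda>i. h \<bullet> f i) I"
    using insert.IH insert.prems by simp
  also have "\<dots> = finsum (Hom C X Z) (\<lambda>i. h \<bullet> f i) (insert i I)"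
    using insert f fi by (intro H'.finsum_insert[symmetric]) auto
  finally show ?case .
qed

lemma finsum_comp:
  assumes "finite I" "Z \<in> Obj C" "\<And>i. i \<in> I \<Longrightarrow> in_hom (f i) Y Z" "in_hom h X Y"
  shows "finsum (Hom C Y Z) f I \<bullet> h = finsum (Hom C X Z) (\<lambda>i. f i \<bullet> h) I"
  using assms
proof (induction I rule: finite_induct)
  case empty
  have YZ: "Y \<in> Obj C" "X \<in> Obj C" using empty by auto
  interpret H: abelian_group "Hom C Y Z" using YZ empty by (intro hom_abelian_group)
  interpret H': abelian_group "Hom C X Z" using YZ empty by (intro hom_abelian_group)
  show ?case using empty YZ by simp
next
  case (insert i I)
  have YZ: "Y \<in> Obj C" "X \<in> Obj C" using insert by auto
  interpret H: abelian_group "Hom C Y Z" using YZ insert by (intro hom_abelian_group)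
  interpret H': abelian_group "Hom C X Z" using YZ insert by (intro hom_abelian_group)
  have fi: "in_hom (f i) Y Z" and f: "\<And>j. j \<in> I \<Longrightarrow> in_hom (f j) Y Z" using insert.prems by simp_all
  have "finsum (Hom C Y Z) f (insert i I) = f i \<oplus>\<^bsub>Hom C Y Z\<^esub> finsum (Hom C Y Z) f I"
    using insert f fi by (intro H.finsum_insert) auto
  then have "finsum (Hom C Y Z) f (insert i I) \<bullet> h = (f i \<bullet> h) \<oplus>\<^bsub>Hom C X Z\<^esub> (finsum (Hom C Y Z) f I \<bullet> h)"
    using fi f insert.prems YZ by (simp add: add_comp)
  also have "\<dots> = (f i \<bullet> h) \<oplus>\<^bsub>Hom C X Z\<^esub> finsum (Hom C X Z) (\<lambda>i. f i \<bullet> h) I"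
    using insert.IH insert.prems by simp
  also have "\<dots> = finsum (Hom C X Z) (\<lambda>i. f i \<bullet> h) (insert i I)"
    using insert f fi by (intro H'.finsum_insert[symmetric]) auto
  finally show ?case .
qed

end

locale biproduct = linear_category +
  fixes I :: "'i set" and X S \<iota> \<pi>
  assumes finite_index: "finite I" and S_obj [simp]: "S \<in> Obj C"
    and inj_arr: "i \<in> I \<Longrightarrow> in_hom (\<iota> i) (X i) S" and proj_arr: "i \<in> I \<Longrightarrow> in_hom (\<pi> i) S (X i)"
    and proj_inj: "i \<in> I \<Longrightarrow> \<pi> i \<bullet> \<iota> i = Ident C (X i)"
    and proj_inj_ne: "\<lbrakk> i \<in> I; j \<in> I; i \<noteq> j \<rbrakk> \<Longrightarrow> \<pi> i \<bullet> \<iota> j = \<zero>\<^bsub>Hom C (X j) (X i)\<^esub>"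
    and sum_inj_proj: "(\<Oplus>\<^bsub>Hom C S S\<^esub>i \<in> I. \<iota> i \<bullet> \<pi> i) = Ident C S"
begin

lemma inj_proj_simps [simp]:
  assumes "i \<in> I"
  shows "X i \<in> Obj C" "arr (\<iota> i)" "src (\<iota> i) = X i" "tgt (\<iota> i) = S" "arr (\<pi> i)" "src (\<pi> i) = S" "tgt (\<pi> i) = X i"
  using inj_arr[OF assms] proj_arr[OF assms] arr_obj(1)[of "\<iota> i"] by simp_all

lemma into_decomp:
  assumes "in_hom u Z S"
  shows "u = (\<Oplus>\<^bsub>Hom C Z S\<^esub>i \<in> I. \<iota> i \<bullet> \<pi> i \<bullet> u)"
proof -
  interpret H: abelian_group "Hom C Z S" using assms by (intro hom_abelian_group) auto
  have "u = Ident C S \<bullet> u" using assms by simp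
  also have "\<dots> = (\<Oplus>\<^bsub>Hom C Z S\<^esub>i \<in> I. (\<iota> i \<bullet> \<pi> i) \<bullet> u)"
    unfolding sum_inj_proj[symmetric] using assms by (intro finsum_comp finite_index) simp_all
  also have "\<dots> = (\<Oplus>\<^bsub>Hom C Z S\<^esub>i \<in> I. \<iota> i \<bullet> \<pi> i \<bullet> u)"
    using assms by (intro H.finsum_cong') auto
  finally show ?thesis .
qed

lemma out_decomp:
  assumes "in_hom u S Z"
  shows "u = (\<Oplus>\<^bsub>Hom C S Z\<^esub>i \<in> I. u \<bullet> \<iota> i \<bullet> \<pi> i)"
proof -
  have "u = u \<bullet> Ident C S" using assms by simp
  also have "\<dots> = (\<Oplus>\<^bsub>Hom C S Z\<^esub>i \<in> I. u \<bullet> \<iota> i \<bullet> \<pi> i)"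
    unfolding sum_inj_proj[symmetric] using assms by (intro comp_finsum finite_index) simp_all
  finally show ?thesis .
qed

lemma into_zeroI:
  assumes u: "in_hom u Z S" and z: "\<And>i. i \<in> I \<Longrightarrow> \<pi> i \<bullet> u = \<zero>\<^bsub>Hom C Z (X i)\<^esub>"
  shows "u = \<zero>\<^bsub>Hom C Z S\<^esub>"
proof -
  have Z: "Z \<in> Obj C" using u by auto
  interpret H: abelian_group "Hom C Z S" using Z by (intro hom_abelian_group) auto
  have "(\<Oplus>\<^bsub>Hom C Z S\<^esub>i \<in> I. \<iota> i \<bullet> \<pi> i \<bullet> u) = \<zero>\<^bsub>Hom C Z S\<^esub>"
    by (intro H.add.finprod_one_eqI) (simp add: z Z)
  then show ?thesis using into_decomp[OF u] by simp
qed

lemma out_zeroI: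
  assumes u: "in_hom u S Z" and z: "\<And>i. i \<in> I \<Longrightarrow> u \<bullet> \<iota> i = \<zero>\<^bsub>Hom C (X i) Z\<^esub>"
  shows "u = \<zero>\<^bsub>Hom C S Z\<^esub>"
proof -
  have Z: "Z \<in> Obj C" using u by auto
  interpret H: abelian_group "Hom C S Z" using Z by (intro hom_abelian_group) auto
  have "u \<bullet> \<iota> i \<bullet> \<pi> i = \<zero>\<^bsub>Hom C S Z\<^esub>" if "i \<in> I" for i
  proof -
    have "u \<bullet> \<iota> i \<bullet> \<pi> i = \<zero>\<^bsub>Hom C (X i) Z\<^esub> \<bullet> \<pi> i"
      by (rule comp_reduce[OF z[OF that]]) (use u that in simp_all)
    then show ?thesis using that Z by simp
  qed
  then have "(\<Oplus>\<^bsub>Hom C S Z\<^esub>i \<in> I. u \<bullet> \<iota> i \<bullet> \<pi> i) = \<zero>\<^bsub>Hom C S Z\<^esub>"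
    by (intro H.add.finprod_one_eqI)
  then show ?thesis using out_decomp[OF u] by simp
qed

lemma out_eqI:
  assumes u: "in_hom u S Z" and w: "in_hom w S Z" and eq: "\<And>i. i \<in> I \<Longrightarrow> u \<bullet> \<iota> i = w \<bullet> \<iota> i"
  shows "u = w"
proof -
  have Z: "Z \<in> Obj C" using u by auto
  have "u \<ominus>\<^bsub>Hom C S Z\<^esub> w = \<zero>\<^bsub>Hom C S Z\<^esub>"
  proof (rule out_zeroI)
    fix i assume i: "i \<in> I"
    have "(u \<ominus>\<^bsub>Hom C S Z\<^esub> w) \<bullet> \<iota> i = (u \<bullet> \<iota> i) \<ominus>\<^bsub>Hom C (X i) Z\<^esub> (w \<bullet> \<iota> i)"
      using u w i by (simp add: sub_comp)
    also have "\<dots> = \<zero>\<^bsub>Hom C (X i) Z\<^esub>"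
      unfolding eq[OF i] using i w by (subst sub_eq_zero_iff) simp_all
    finally show "(u \<ominus>\<^bsub>Hom C S Z\<^esub> w) \<bullet> \<iota> i = \<zero>\<^bsub>Hom C (X i) Z\<^esub>" .
  qed (use u w in simp)
  then show ?thesis by (rule iffD1[OF sub_eq_zero_iff, rotated -1]) (use u w in simp_all)
qed

lemma copair:
  assumes Z: "Z \<in> Obj C" and f: "\<And>i. i \<in> I \<Longrightarrow> in_hom (f i) (X i) Z"
  obtains q where "in_hom q S Z" "\<And>i. i \<in> I \<Longrightarrow> q \<bullet> \<iota> i = f i"
proof -
  let ?q = "\<Oplus>\<^bsub>Hom C S Z\<^esub>i \<in> I. f i \<bullet> \<pi> i"
  have q: "in_hom ?q S Z" using Z f by simp
  have "?q \<bullet> \<iota> j = f j" if j: "j \<in> I" for j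
  proof -
    interpret H: abelian_group "Hom C (X j) Z" using Z j by (intro hom_abelian_group) auto
    have fj: "f j \<in> mor C (X j) Z" using f j by simp
    have "?q \<bullet> \<iota> j = (\<Oplus>\<^bsub>Hom C (X j) Z\<^esub>i \<in> I. (f i \<bullet> \<pi> i) \<bullet> \<iota> j)"
      using Z f j by (intro finsum_comp finite_index) simp_all
    also have "\<dots> = (\<Oplus>\<^bsub>Hom C (X j) Z\<^esub>i \<in> I. if j = i then f j else \<zero>\<^bsub>Hom C (X j) Z\<^esub>)"
    proof (rule H.finsum_cong')
      fix i assume i: "i \<in> I"
      have "(f i \<bullet> \<pi> i) \<bullet> \<iota> j = f i \<bullet> \<pi> i \<bullet> \<iota> j" using f i j by (intro comp_assoc') simp_all
      also have "\<dots> = (if j = i then f j else \<zero>\<^bsub>Hom C (X j) Z\<^esub>)"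
        using i j f proj_inj[OF i] proj_inj_ne[OF i j] by (cases "j = i") simp_all
      finally show "(f i \<bullet> \<pi> i) \<bullet> \<iota> j = (if j = i then f j else \<zero>\<^bsub>Hom C (X j) Z\<^esub>)" .
    qed (use f j Z in auto)
    also have "\<dots> = f j" by (rule H.add.finprod_singleton[OF j finite_index, of "\<lambda>_. f j"]) (use fj in auto)
    finally show ?thesis .
  qed
  then show ?thesis using that q by blast
qed

lemma projective_biproduct:
  assumes "\<And>i. i \<in> I \<Longrightarrow> is_projective C (X i)"
  shows "is_projective C S"
  unfolding is_projective_iff
proof (intro conjI allI impI)
  fix e f assume e: "epi e" and f: "arr f" "src f = S" "tgt f = tgt e"
  have "\<forall>i \<in> I. \<exists>g. in_hom g (X i) (src e) \<and> e \<bullet> g = f \<bullet> \<iota> i"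
  proof
    fix i assume i: "i \<in> I"
    obtain g where "in_hom g (X i) (src e)" "e \<bullet> g = f \<bullet> \<iota> i"
      by (rule projective_lift[OF assms[OF i] e, of "f \<bullet> \<iota> i"]) (use f i in simp_all)
    then show "\<exists>g. in_hom g (X i) (src e) \<and> e \<bullet> g = f \<bullet> \<iota> i" by blast
  qed
  from bchoice[OF this] obtain g where g: "\<forall>i \<in> I. in_hom (g i) (X i) (src e) \<and> e \<bullet> g i = f \<bullet> \<iota> i" ..
  obtain q where q: "in_hom q S (src e)" "\<And>i. i \<in> I \<Longrightarrow> q \<bullet> \<iota> i = g i"
    by (rule copair[of "src e" g]) (use g e in simp_all)
  have "e \<bullet> q = f"
  proof (rule out_eqI)
    fix i assume i: "i \<in> I"
    have "(e \<bullet> q) \<bullet> \<iota> i = e \<bullet> q \<bullet> \<iota> i" using e q(1) i by (intro comp_assoc') simp_all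
    also have "\<dots> = f \<bullet> \<iota> i" using bspec[OF g i] by (simp add: q(2)[OF i])
    finally show "(e \<bullet> q) \<bullet> \<iota> i = f \<bullet> \<iota> i" .
  qed (use e q(1) f in simp_all)
  then show "\<exists>g. in_hom g S (src e) \<and> e \<bullet> g = f" using q(1) by blast
qed simp

end

lemma (in abelian_linear_category) ex_biproduct:
  assumes "finite I" "\<And>i. i \<in> I \<Longrightarrow> X i \<in> Obj C"
  shows "\<exists>S \<iota> \<pi>. biproduct K C I X S \<iota> \<pi>"
  using assms
proof (induction I rule: finite_induct)
  case empty
  obtain Z where Z: "is_zero_object C Z" using zero_object by blast
  then have ZO: "Z \<in> Obj C" "Ident C Z = \<zero>\<^bsub>Hom C Z Z\<^esub>" by (simp_all add: zero_object_iff)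
  interpret H: abelian_group "Hom C Z Z" using ZO by (intro hom_abelian_group)
  have "biproduct K C {} X Z undefined undefined"
    by unfold_locales (simp_all add: ZO)
  then show ?case by blast
next
  case (insert k I)
  then obtain S \<iota> \<pi> where "biproduct K C I X S \<iota> \<pi>" by auto
  then interpret B: biproduct K C I X S \<iota> \<pi> .
  have Xk: "X k \<in> Obj C" using insert by simp
  obtain T i1 i2 p1 p2 where "is_direct_sum C (X k) S T i1 i2 p1 p2" using direct_sums[OF Xk B.S_obj] by blast
  then have T: "T \<in> Obj C" and "i1 \<in> mor C (X k) T" "i2 \<in> mor C S T" "p1 \<in> mor C T (X k)" "p2 \<in> mor C T S"
    and pi: "p1 \<bullet> i1 = Ident C (X k)" "p2 \<bullet> i2 = Ident C S" "p1 \<bullet> i2 = \<zero>\<^bsub>Hom C S (X k)\<^esub>" "p2 \<bullet> i1 = \<zero>\<^bsub>Hom C (X k) S\<^esub>"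
    and sum: "(i1 \<bullet> p1) \<oplus>\<^bsub>Hom C T T\<^esub> (i2 \<bullet> p2) = Ident C T"
    unfolding is_direct_sum_def by blast+
  then have i1: "in_hom i1 (X k) T" and i2: "in_hom i2 S T" and p1: "in_hom p1 T (X k)" and p2: "in_hom p2 T S"
    using Xk by (simp_all add: mor_iff)
  define \<iota>' where "\<iota>' i = (if i = k then i1 else i2 \<bullet> \<iota> i)" for i
  define \<pi>' where "\<pi>' i = (if i = k then p1 else \<pi> i \<bullet> p2)" for i
  have k: "i \<noteq> k" if "i \<in> I" for i using that insert by auto
  have "biproduct K C (insert k I) X T \<iota>' \<pi>'"
  proof unfold_locales
    show "finite (insert k I)" using insert by simp
    show "T \<in> Obj C" by (rule T)
    fix i assume "i \<in> insert k I"
    then consider "i = k" | "i \<in> I" "i \<noteq> k" using k by blast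
    note ci = this
    show "in_hom (\<iota>' i) (X i) T" by (rule ci) (use i1 i2 in \<open>simp_all add: \<iota>'_def\<close>)
    show "in_hom (\<pi>' i) T (X i)" by (rule ci) (use p1 p2 in \<open>simp_all add: \<pi>'_def\<close>)
    show "\<pi>' i \<bullet> \<iota>' i = Ident C (X i)"
    proof (rule ci)
      assume i: "i \<in> I" "i \<noteq> k"
      have "p2 \<bullet> i2 \<bullet> \<iota> i = Ident C S \<bullet> \<iota> i" by (rule comp_reduce[OF pi(2)]) (use i i2 p2 in simp_all)
      then show ?thesis using i i2 p2 B.proj_inj[OF i(1)] by (simp add: \<iota>'_def \<pi>'_def)
    qed (simp add: \<iota>'_def \<pi>'_def pi)
    fix j assume "j \<in> insert k I" and ne: "i \<noteq> j"
    then consider "j = k" | "j \<in> I" "j \<noteq> k" using k by blast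
    note cj = this
    show "\<pi>' i \<bullet> \<iota>' j = \<zero>\<^bsub>Hom C (X j) (X i)\<^esub>"
    proof (rule ci)
      assume i: "i = k"
      have j: "j \<in> I" "j \<noteq> k" using cj i ne by auto
      have "p1 \<bullet> i2 \<bullet> \<iota> j = \<zero>\<^bsub>Hom C S (X k)\<^esub> \<bullet> \<iota> j" by (rule comp_reduce[OF pi(3)]) (use j i2 p1 in simp_all)
      then show ?thesis using i j Xk by (simp add: \<iota>'_def \<pi>'_def)
    next
      assume i: "i \<in> I" "i \<noteq> k"
      show ?thesis
      proof (rule cj)
        assume "j = k"
        then show ?thesis using i i1 p2 pi(4) Xk by (simp add: \<iota>'_def \<pi>'_def)
      next
        assume j: "j \<in> I" "j \<noteq> k"
        have "p2 \<bullet> i2 \<bullet> \<iota> j = Ident C S \<bullet> \<iota> j" by (rule comp_reduce[OF pi(2)]) (use j i2 p2 in simp_all)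
        then show ?thesis using i j i2 p2 B.proj_inj_ne[OF i(1) j(1) ne] by (simp add: \<iota>'_def \<pi>'_def)
      qed
    qed
  next
    interpret H: abelian_group "Hom C T T" using T by (intro hom_abelian_group)
    have "(\<Oplus>\<^bsub>Hom C T T\<^esub>i \<in> I. \<iota>' i \<bullet> \<pi>' i) = (\<Oplus>\<^bsub>Hom C T T\<^esub>i \<in> I. i2 \<bullet> (\<iota> i \<bullet> \<pi> i) \<bullet> p2)"
      using i2 p2 k by (intro H.finsum_cong') (auto simp: \<iota>'_def \<pi>'_def)
    also have "\<dots> = i2 \<bullet> (\<Oplus>\<^bsub>Hom C T S\<^esub>i \<in> I. (\<iota> i \<bullet> \<pi> i) \<bullet> p2)"
      using i2 p2 T B.finite_index by (intro comp_finsum[symmetric]) simp_all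
    also have "(\<Oplus>\<^bsub>Hom C T S\<^esub>i \<in> I. (\<iota> i \<bullet> \<pi> i) \<bullet> p2) = (\<Oplus>\<^bsub>Hom C S S\<^esub>i \<in> I. \<iota> i \<bullet> \<pi> i) \<bullet> p2"
      using p2 B.finite_index by (intro finsum_comp[symmetric]) simp_all
    also have "\<dots> = p2" using p2 by (simp add: B.sum_inj_proj)
    finally have *: "(\<Oplus>\<^bsub>Hom C T T\<^esub>i \<in> I. \<iota>' i \<bullet> \<pi>' i) = i2 \<bullet> p2" .
    have "(\<Oplus>\<^bsub>Hom C T T\<^esub>i \<in> insert k I. \<iota>' i \<bullet> \<pi>' i) = (\<iota>' k \<bullet> \<pi>' k) \<oplus>\<^bsub>Hom C T T\<^esub> (\<Oplus>\<^bsub>Hom C T T\<^esub>i \<in> I. \<iota>' i \<bullet> \<pi>' i)"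
      using insert i1 i2 p1 p2 k by (intro H.finsum_insert) (auto simp: \<iota>'_def \<pi>'_def)
    also have "\<dots> = Ident C T" unfolding * using sum by (simp add: \<iota>'_def \<pi>'_def)
    finally show "(\<Oplus>\<^bsub>Hom C T T\<^esub>i \<in> insert k I. \<iota>' i \<bullet> \<pi>' i) = Ident C T" .
  qed
  then show ?case by blast
qed

section \<open>A basic projective generator and its Frobenius form\<close>

lemma (in abelian_linear_category) comp_epi_nonzero:
  assumes "epi e" "arr w" "src w = tgt e" "w \<bullet> e \<noteq> \<zero>\<^bsub>Hom C (src e) (tgt w)\<^esub>"
  shows "w \<noteq> \<zero>\<^bsub>Hom C (tgt e) (tgt w)\<^esub>"
proof
  assume "w = \<zero>\<^bsub>Hom C (tgt e) (tgt w)\<^esub>"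
  then have "w \<bullet> e = \<zero>\<^bsub>Hom C (tgt e) (tgt w)\<^esub> \<bullet> e" by (rule arg_cong)
  then show False using assms by simp
qed

context quasi_frobenius_category begin

text \<open>A nonzero morphism into a projective cover hits the socle, which the projective \<open>Q\<close> reaches.\<close>

lemma socle_lift:
  assumes c: "simple_cover S P p" and c': "simple_cover T Q q" and v: "mono v" "src v = T" "tgt v = P"
    and a: "in_hom a X P" "a \<noteq> \<zero>\<^bsub>Hom C X P\<^esub>"
  obtains b where "in_hom b Q X" "a \<bullet> b = v \<bullet> q"
proof -
  note D = simple_coverD[OF c] and D' = simple_coverD[OF c']
  have aa: "arr a" using a by simp
  obtain m e where me: "mono m" "epi e" "tgt e = src m" "src e = src a" "tgt m = tgt a" and ame: "a = m \<bullet> e"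
    using image_factorization[OF aa] .
  have "m \<noteq> \<zero>\<^bsub>Hom C (tgt e) (tgt m)\<^esub>"
    by (rule comp_epi_nonzero[OF me(2)]) (use me a in \<open>simp_all flip: ame\<close>)
  then have m0: "m \<noteq> \<zero>\<^bsub>Hom C (src m) P\<^esub>" using me a by simp
  obtain w where w: "in_hom w (src v) (src m)" "m \<bullet> w = v"
    by (rule simple_cover_socle[OF c v(1,3) _ me(1) _ m0]) (use v D' me(5) a(1) in simp_all)
  obtain b where b: "in_hom b Q (src e)" "e \<bullet> b = w \<bullet> q"
    by (rule projective_lift[OF D'(2) me(2), of "w \<bullet> q"]) (use w(1) v D' me(1-5) in simp_all)
  have "a \<bullet> b = m \<bullet> e \<bullet> b" unfolding ame by (rule comp_assoc') (use b(1) me in simp_all)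
  also have "\<dots> = m \<bullet> w \<bullet> q" by (simp only: b(2))
  also have "\<dots> = v \<bullet> q" by (rule comp_reduce[OF w(2)]) (use w(1) me(1) D' v in simp_all)
  finally show ?thesis using that[of b] b(1) me(4) a(1) by simp
qed

text \<open>A nonzero quotient of \<open>Q\<close> still has the simple top of \<open>Q\<close>, and injectivity of \<open>P\<close> extends the map from
  that top into the socle of \<open>P\<close>.\<close>

lemma top_extend:
  assumes c: "simple_cover S P p" and c': "simple_cover T Q q" and v: "mono v" "src v = T" "tgt v = P"
    and a: "in_hom a Q X" "a \<noteq> \<zero>\<^bsub>Hom C Q X\<^esub>"
  obtains b where "in_hom b X P" "b \<bullet> a = v \<bullet> q"
proof -
  note D = simple_coverD[OF c] and D' = simple_coverD[OF c']
  have aa: "arr a" using a by simp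
  obtain m e where me: "mono m" "epi e" "tgt e = src m" "src e = src a" "tgt m = tgt a" and ame: "a = m \<bullet> e"
    using image_factorization[OF aa] .
  have "Ident C (tgt e) \<noteq> \<zero>\<^bsub>Hom C (tgt e) (tgt e)\<^esub>"
  proof
    assume "Ident C (tgt e) = \<zero>\<^bsub>Hom C (tgt e) (tgt e)\<^esub>"
    then have "is_zero_object C (src m)" using me by (simp add: zero_object_iff)
    then have "m = \<zero>\<^bsub>Hom C (src m) (tgt m)\<^esub>" by (rule arr_from_zero) (use me in simp_all)
    moreover have "m \<noteq> \<zero>\<^bsub>Hom C (tgt e) (tgt m)\<^esub>"
      by (rule comp_epi_nonzero[OF me(2)]) (use me a in \<open>simp_all flip: ame\<close>)
    ultimately show False using me by simp
  qed
  then obtain w where w: "in_hom w (tgt e) T" "w \<bullet> e = q"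
    by (rule_tac simple_cover_top[OF c' me(2)]) (use me(4) a(1) in simp_all)
  obtain b where b: "in_hom b (tgt m) P" "b \<bullet> m = v \<bullet> w"
    using projective_extend[OF D(2) me(1), of "v \<bullet> w"] w(1) me v by auto
  have "b \<bullet> a = (b \<bullet> m) \<bullet> e" unfolding ame by (rule comp_assoc'[symmetric]) (use b(1) me in simp_all)
  also have "\<dots> = v \<bullet> w \<bullet> e" unfolding b(2) by (rule comp_assoc') (use w(1) me v in simp_all)
  also have "\<dots> = v \<bullet> q" by (simp only: w(2))
  finally show ?thesis using that[of b] b(1) me(5) a(1) by simp
qed

lemma ex_simple_representatives:
  obtains I where "finite I" "\<And>S. S \<in> I \<Longrightarrow> is_simple C S" "\<And>S. is_simple C S \<Longrightarrow> \<exists>T \<in> I. isomorphic C S T"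
    "\<And>S T. \<lbrakk> S \<in> I; T \<in> I; isomorphic C S T \<rbrakk> \<Longrightarrow> S = T"
proof -
  obtain F where F: "finite F" "F \<subseteq> Obj C" "\<And>S. is_simple C S \<Longrightarrow> \<exists>T \<in> F. isomorphic C S T"
    using finitely_many_simples by blast
  \<comment> \<open>\<open>c S\<close> is a complete invariant of the isomorphism class of \<open>S\<close>, with values in the finite set of subsets of \<open>F\<close>.\<close>
  define c where "c S = {T \<in> F. isomorphic C S T}" for S
  define \<sigma> where "\<sigma> A = (SOME S. is_simple C S \<and> c S = A)" for A
  define I where "I = \<sigma> ` c ` Collect (is_simple C)"
  have \<sigma>: "is_simple C (\<sigma> (c S)) \<and> c (\<sigma> (c S)) = c S" if "is_simple C S" for S
    unfolding \<sigma>_def by (rule someI[of _ S]) (use that in simp)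
  have O: "S \<in> Obj C" if "is_simple C S" for S using that by (simp add: is_simple_def)
  have "c ` Collect (is_simple C) \<subseteq> Pow F" by (auto simp: c_def)
  then have "finite I" unfolding I_def using F(1) by (meson finite_Pow_iff finite_imageI finite_subset)
  moreover have "is_simple C S" if "S \<in> I" for S using that \<sigma> by (auto simp: I_def)
  moreover have "\<exists>T \<in> I. isomorphic C S T" if S: "is_simple C S" for S
  proof -
    obtain T where T: "T \<in> F" "isomorphic C S T" using F(3) S by blast
    then have "T \<in> c (\<sigma> (c S))" using \<sigma>[OF S] by (simp add: c_def)
    then have "isomorphic C (\<sigma> (c S)) T" by (simp add: c_def)
    then have "isomorphic C S (\<sigma> (c S))"
      using T F(2) O S \<sigma>[OF S] isomorphic_sym isomorphic_trans by (meson subsetD)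
    then show ?thesis using S by (auto simp: I_def)
  qed
  moreover have "S = T" if ST: "S \<in> I" "T \<in> I" and iso: "isomorphic C S T" for S T
  proof -
    obtain S' T' where S: "is_simple C S'" "S = \<sigma> (c S')" and T: "is_simple C T'" "T = \<sigma> (c T')"
      using ST by (auto simp: I_def)
    have ST: "S \<in> Obj C" "T \<in> Obj C" using S T \<sigma> O by blast+
    have "c S = c T"
      unfolding c_def using ST F(2) iso isomorphic_sym isomorphic_trans by (intro Collect_cong) (meson subsetD)
    then show ?thesis using \<sigma>[OF S(1)] \<sigma>[OF T(1)] S T by metis
  qed
  ultimately show ?thesis using that by blast
qed

text \<open>The Frobenius form reads the blocks of an endomorphism of \<open>G = \<Oplus>\<^sub>S P\<^sub>S\<close> along the permuted diagonal, where
  \<open>\<sigma>\<close> is the Nakayama permutation, which sends the top of each summand to its socle. Composing a nonzero endomorphism with a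
  suitable morphism through one summand leaves a single block on this diagonal, and this block is \<open>m S\<close>, on which the form is \<open>1\<close>.\<close>

theorem ex_generator_with_form:
  obtains G t where "is_projective C G"
    "\<And>X. \<lbrakk> X \<in> Obj C; Ident C X \<noteq> \<zero>\<^bsub>Hom C X X\<^esub> \<rbrakk> \<Longrightarrow> \<exists>g. in_hom g G X \<and> g \<noteq> \<zero>\<^bsub>Hom C G X\<^esub>"
    "linear_form K (Hom C G G) t"
    "\<And>a. \<lbrakk> in_hom a G G; \<And>b. in_hom b G G \<Longrightarrow> t (a \<bullet> b) = \<zero>\<^bsub>K\<^esub> \<rbrakk> \<Longrightarrow> a = \<zero>\<^bsub>Hom C G G\<^esub>"
    "\<And>a. \<lbrakk> in_hom a G G; \<And>b. in_hom b G G \<Longrightarrow> t (b \<bullet> a) = \<zero>\<^bsub>K\<^esub> \<rbrakk> \<Longrightarrow> a = \<zero>\<^bsub>Hom C G G\<^esub>"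
proof -
  obtain I where I: "finite I" "\<And>S. S \<in> I \<Longrightarrow> is_simple C S" "\<And>S. is_simple C S \<Longrightarrow> \<exists>T \<in> I. isomorphic C S T"
    "\<And>S T. \<lbrakk> S \<in> I; T \<in> I; isomorphic C S T \<rbrakk> \<Longrightarrow> S = T"
    using ex_simple_representatives by blast
  have "\<forall>S \<in> I. \<exists>Pp. simple_cover S (fst Pp) (snd Pp)" using ex_simple_cover I(2) by simp
  from bchoice[OF this] obtain Pp where Pp: "\<forall>S \<in> I. simple_cover S (fst (Pp S)) (snd (Pp S))" ..
  define P where "P S = fst (Pp S)" for S
  define p where "p S = snd (Pp S)" for S
  have cov: "simple_cover S (P S) (p S)" if "S \<in> I" for S using Pp that by (simp add: P_def p_def)
  note D = simple_coverD[OF cov]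
  have "\<forall>S \<in> I. \<exists>v. mono v \<and> tgt v = P S \<and> src v \<in> I"
  proof
    fix S assume S: "S \<in> I"
    have "Ident C (P S) \<noteq> \<zero>\<^bsub>Hom C (P S) (P S)\<^esub>"
    proof
      assume "Ident C (P S) = \<zero>\<^bsub>Hom C (P S) (P S)\<^esub>"
      then have "is_zero_object C (P S)" using D[OF S] by (simp add: zero_object_iff)
      then have "p S = \<zero>\<^bsub>Hom C (P S) (tgt (p S))\<^esub>" by (rule arr_from_zero) (use D[OF S] in simp_all)
      then show False using D[OF S] by simp
    qed
    then obtain u where u: "mono u" "tgt u = P S" "is_simple C (src u)" using ex_simple_subobject D(7)[OF S] by blast
    \<comment> \<open>Precomposing with an isomorphism makes the chosen representative itself the source, so that \<open>\<sigma>\<close> maps \<open>I\<close> to \<open>I\<close>.\<close>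
    obtain T where T: "T \<in> I" "isomorphic C (src u) T" using I(3)[OF u(3)] by blast
    have TO: "T \<in> Obj C" using I(2)[OF T(1)] by (simp add: is_simple_def)
    then obtain f where f: "iso f" "src f = T" "tgt f = src u"
      using isomorphicE[OF isomorphic_sym[OF T(2)]] u(1) by auto
    have "mono (u \<bullet> f)" by (rule mono_comp[OF iso_mono[OF f(1)] u(1)]) (use f in simp)
    then show "\<exists>v. mono v \<and> tgt v = P S \<and> src v \<in> I"
      using f u T(1) by (intro exI[of _ "u \<bullet> f"]) simp
  qed
  from bchoice[OF this] obtain v where v: "\<forall>S \<in> I. mono (v S) \<and> tgt (v S) = P S \<and> src (v S) \<in> I" ..
  define \<sigma> where "\<sigma> S = src (v S)" for S
  have vD: "mono (v S)" "arr (v S)" "tgt (v S) = P S" "src (v S) = \<sigma> S" "\<sigma> S \<in> I" if "S \<in> I" for S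
    using v that by (simp_all add: \<sigma>_def)
  have inj: "inj_on \<sigma> I"
  proof (rule inj_onI)
    fix S T assume ST: "S \<in> I" "T \<in> I" "\<sigma> S = \<sigma> T"
    show "S = T"
      by (rule I(4)[OF ST(1,2)], rule simple_cover_socle_inj[OF cov[OF ST(1)] cov[OF ST(2)], of "v S" "\<sigma> S" "v T"])
        (use vD[OF ST(1)] vD[OF ST(2)] ST I(2) in simp_all)
  qed
  have surj: "\<sigma> ` I = I" using inj vD(5) I(1) by (intro endo_inj_surj) auto
  define m where "m S = v S \<bullet> p (\<sigma> S)" for S
  have m: "in_hom (m S) (P (\<sigma> S)) (P S)" if "S \<in> I" for S
    using vD[OF that] D[OF vD(5)[OF that]] by (simp add: m_def)
  have m0: "m S \<noteq> \<zero>\<^bsub>Hom C (P (\<sigma> S)) (P S)\<^esub>" if "S \<in> I" for S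
  proof
    note V = vD[OF that] and D' = D[OF vD(5)[OF that]]
    assume "m S = \<zero>\<^bsub>Hom C (P (\<sigma> S)) (P S)\<^esub>"
    then have "v S \<bullet> p (\<sigma> S) = \<zero>\<^bsub>Hom C (src (p (\<sigma> S))) (tgt (v S))\<^esub>" using V D' by (simp add: m_def)
    then have "p (\<sigma> S) = \<zero>\<^bsub>Hom C (src (p (\<sigma> S))) (src (v S))\<^esub>" using V D' by (intro mono_zeroD) simp_all
    then show False using V D' by simp
  qed
  have PO: "P S \<in> Obj C" if "S \<in> I" for S using D(7)[OF that] .
  have "\<forall>S \<in> I. \<exists>t. linear_form K (Hom C (P (\<sigma> S)) (P S)) t \<and> t (m S) = \<one>\<^bsub>K\<^esub>"
  proof
    fix S assume S: "S \<in> I"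
    interpret V: vspace K "Hom C (P (\<sigma> S)) (P S)" by (intro vspace_hom PO S vD(5))
    show "\<exists>t. linear_form K (Hom C (P (\<sigma> S)) (P S)) t \<and> t (m S) = \<one>\<^bsub>K\<^esub>"
      using m[OF S] m0[OF S] by (intro V.ex_linear_form) simp_all
  qed
  from bchoice[OF this] obtain t where t: "\<forall>S \<in> I. linear_form K (Hom C (P (\<sigma> S)) (P S)) (t S) \<and> t S (m S) = \<one>\<^bsub>K\<^esub>" ..
  have t_cl: "t S u \<in> carrier K" if "S \<in> I" "in_hom u (P (\<sigma> S)) (P S)" for S u
    using t that unfolding linear_form_def by (auto simp: Pi_iff)
  have t_add: "t S (u \<oplus>\<^bsub>Hom C (P (\<sigma> S)) (P S)\<^esub> w) = t S u \<oplus>\<^bsub>K\<^esub> t S w"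
    if "S \<in> I" "in_hom u (P (\<sigma> S)) (P S)" "in_hom w (P (\<sigma> S)) (P S)" for S u w
    using t that unfolding linear_form_def by simp
  have t_smult: "t S (c \<odot>\<^bsub>Hom C (P (\<sigma> S)) (P S)\<^esub> u) = c \<otimes>\<^bsub>K\<^esub> t S u"
    if "S \<in> I" "in_hom u (P (\<sigma> S)) (P S)" "c \<in> carrier K" for S u c
    using t that unfolding linear_form_def by simp
  have t_zero: "t S \<zero>\<^bsub>Hom C (P (\<sigma> S)) (P S)\<^esub> = \<zero>\<^bsub>K\<^esub>" if S: "S \<in> I" for S
  proof -
    interpret V: vspace K "Hom C (P (\<sigma> S)) (P S)" by (intro vspace_hom PO S vD(5))
    have z: "in_hom \<zero>\<^bsub>Hom C (P (\<sigma> S)) (P S)\<^esub> (P (\<sigma> S)) (P S)" using PO[OF S] PO[OF vD(5)[OF S]] by simp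
    have "t S (\<zero>\<^bsub>K\<^esub> \<odot>\<^bsub>Hom C (P (\<sigma> S)) (P S)\<^esub> \<zero>\<^bsub>Hom C (P (\<sigma> S)) (P S)\<^esub>) = \<zero>\<^bsub>K\<^esub>"
      using t_smult[OF S z, of "\<zero>\<^bsub>K\<^esub>"] t_cl[OF S z] by simp
    then show ?thesis by simp
  qed
  obtain G \<iota> \<pi> where "biproduct K C I P G \<iota> \<pi>" using ex_biproduct[OF I(1), of P] PO by blast
  then interpret B: biproduct K C I P G \<iota> \<pi> .
  define q where "q S a = \<pi> S \<bullet> a \<bullet> \<iota> (\<sigma> S)" for S a
  have q: "in_hom (q S a) (P (\<sigma> S)) (P S)" if "S \<in> I" "in_hom a G G" for S a
    using that vD(5) by (simp add: q_def)
  define tr where "tr a = (\<Oplus>\<^bsub>K\<^esub>S \<in> I. t S (q S a))" for a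
  have proj: "is_projective C G" by (rule B.projective_biproduct) (rule D(2))
  have gen: "\<exists>g. in_hom g G X \<and> g \<noteq> \<zero>\<^bsub>Hom C G X\<^esub>" if X: "X \<in> Obj C" "Ident C X \<noteq> \<zero>\<^bsub>Hom C X X\<^esub>" for X
  proof -
    obtain e where e: "epi e" "src e = X" "is_simple C (tgt e)" using ex_simple_quotient[OF X] .
    obtain T where T: "T \<in> I" "isomorphic C (tgt e) T" using I(3)[OF e(3)] by blast
    obtain f where f: "iso f" "src f = tgt e" "tgt f = T"
      using isomorphicE[OF T(2)] e(1) D(8)[OF T(1)] by auto
    have fe: "epi (f \<bullet> e)" by (rule epi_comp[OF e(1) iso_epi[OF f(1)]]) (use f in simp)
    obtain g where g: "in_hom g (P T) (src (f \<bullet> e))" "(f \<bullet> e) \<bullet> g = p T"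
      by (rule projective_lift[OF D(2)[OF T(1)] fe, of "p T"]) (use D[OF T(1)] f e in simp_all)
    have gX: "in_hom g (P T) X" using g(1) e f by simp
    have "g \<noteq> \<zero>\<^bsub>Hom C (P T) X\<^esub>"
    proof
      assume "g = \<zero>\<^bsub>Hom C (P T) X\<^esub>"
      then have "p T = (f \<bullet> e) \<bullet> \<zero>\<^bsub>Hom C (P T) X\<^esub>" using g(2) by simp
      also have "\<dots> = \<zero>\<^bsub>Hom C (P T) T\<^esub>" using e(1,2) f D(7)[OF T(1)] X(1) by simp
      finally show False using D(9)[OF T(1)] by simp
    qed
    moreover have "g = \<zero>\<^bsub>Hom C (P T) X\<^esub>" if z: "g \<bullet> \<pi> T = \<zero>\<^bsub>Hom C G X\<^esub>"
    proof -
      have "g = (g \<bullet> \<pi> T) \<bullet> \<iota> T" using gX T(1) B.proj_inj[OF T(1)] by simp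
      also have "\<dots> = \<zero>\<^bsub>Hom C (P T) X\<^esub>" unfolding z using T(1) X by simp
      finally show ?thesis .
    qed
    ultimately show ?thesis using gX T(1) by (intro exI[of _ "g \<bullet> \<pi> T"]) auto
  qed
  have lin: "linear_form K (Hom C G G) tr"
    unfolding linear_form_def
  proof (intro conjI ballI)
    show "tr \<in> mor C G G \<rightarrow> carrier K"
      using t_cl q by (auto simp: tr_def mor_iff intro!: finsum_closed)
    fix a b assume "a \<in> mor C G G" "b \<in> mor C G G"
    then have ab: "in_hom a G G" "in_hom b G G" by (simp_all add: mor_iff)
    have qab: "q S (a \<oplus>\<^bsub>Hom C G G\<^esub> b) = q S a \<oplus>\<^bsub>Hom C (P (\<sigma> S)) (P S)\<^esub> q S b" if "S \<in> I" for S
      using ab that vD(5)[OF that] by (simp add: q_def add_comp comp_add)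
    have "tr (a \<oplus>\<^bsub>Hom C G G\<^esub> b) = (\<Oplus>\<^bsub>K\<^esub>S \<in> I. t S (q S a) \<oplus>\<^bsub>K\<^esub> t S (q S b))"
      unfolding tr_def using q ab t_cl by (intro finsum_cong') (auto simp: qab t_add)
    also have "\<dots> = tr a \<oplus>\<^bsub>K\<^esub> tr b" unfolding tr_def using q ab t_cl by (intro finsum_addf) auto
    finally show "tr (a \<oplus>\<^bsub>Hom C G G\<^esub> b) = tr a \<oplus>\<^bsub>K\<^esub> tr b" .
  next
    fix c a assume c: "c \<in> carrier K" and "a \<in> mor C G G"
    then have a: "in_hom a G G" by (simp add: mor_iff)
    have qa: "q S (c \<odot>\<^bsub>Hom C G G\<^esub> a) = c \<odot>\<^bsub>Hom C (P (\<sigma> S)) (P S)\<^esub> q S a" if "S \<in> I" for S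
      using a c that vD(5)[OF that] by (simp add: q_def smult_comp comp_smult)
    have "tr (c \<odot>\<^bsub>Hom C G G\<^esub> a) = (\<Oplus>\<^bsub>K\<^esub>S \<in> I. c \<otimes>\<^bsub>K\<^esub> t S (q S a))"
      unfolding tr_def using q a c t_cl by (intro finsum_cong') (auto simp: qa t_smult)
    also have "\<dots> = c \<otimes>\<^bsub>K\<^esub> tr a" unfolding tr_def using q a c t_cl I(1) by (intro finsum_rdistr[symmetric]) auto
    finally show "tr (c \<odot>\<^bsub>Hom C G G\<^esub> a) = c \<otimes>\<^bsub>K\<^esub> tr a" .
  qed
  have tr_one: "tr u = \<one>\<^bsub>K\<^esub>"
    if S: "S \<in> I" and u: "q S u = m S" "\<And>T. \<lbrakk> T \<in> I; T \<noteq> S \<rbrakk> \<Longrightarrow> q T u = \<zero>\<^bsub>Hom C (P (\<sigma> T)) (P T)\<^esub>" for S u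
  proof -
    have "tr u = (\<Oplus>\<^bsub>K\<^esub>T \<in> I. if S = T then \<one>\<^bsub>K\<^esub> else \<zero>\<^bsub>K\<^esub>)"
      unfolding tr_def using u t t_zero S by (intro finsum_cong') auto
    also have "\<dots> = \<one>\<^bsub>K\<^esub>" by (rule add.finprod_singleton[OF S I(1)]) auto
    finally show ?thesis .
  qed
  have nd1: "a = \<zero>\<^bsub>Hom C G G\<^esub>" if a: "in_hom a G G" and z: "\<And>b. in_hom b G G \<Longrightarrow> tr (a \<bullet> b) = \<zero>\<^bsub>K\<^esub>" for a
  proof (rule ccontr)
    assume ne: "a \<noteq> \<zero>\<^bsub>Hom C G G\<^esub>"
    obtain S where S: "S \<in> I" "\<pi> S \<bullet> a \<noteq> \<zero>\<^bsub>Hom C G (P S)\<^esub>" using B.into_zeroI[OF a] ne by blast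
    note V = vD[OF S(1)] and D' = D[OF vD(5)[OF S(1)]]
    obtain b where b: "in_hom b (P (\<sigma> S)) G" "(\<pi> S \<bullet> a) \<bullet> b = v S \<bullet> p (\<sigma> S)"
      by (rule socle_lift[OF cov[OF S(1)] cov[OF V(5)] V(1) _ _ _ S(2)]) (use V S(1) a in simp_all)
    let ?u = "a \<bullet> b \<bullet> \<pi> (\<sigma> S)"
    have qu: "q T ?u = ((\<pi> T \<bullet> a) \<bullet> b) \<bullet> \<pi> (\<sigma> S) \<bullet> \<iota> (\<sigma> T)" if "T \<in> I" for T
      using that a b(1) V(5) vD(5)[OF that] by (simp add: q_def)
    have "q S ?u = m S"
      using qu[OF S(1)] b(2) m[OF S(1)] V(5) by (simp add: B.proj_inj m_def)
    moreover have "q T ?u = \<zero>\<^bsub>Hom C (P (\<sigma> T)) (P T)\<^esub>" if T: "T \<in> I" "T \<noteq> S" for T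
    proof -
      have "\<sigma> S \<noteq> \<sigma> T" using inj T S(1) by (auto dest: inj_onD)
      then show ?thesis
        using qu[OF T(1)] B.proj_inj_ne[OF V(5) vD(5)[OF T(1)]] T(1) a b(1) vD(5)[OF T(1)] by simp
    qed
    ultimately have "tr ?u = \<one>\<^bsub>K\<^esub>" by (rule tr_one[OF S(1)])
    then show False using z[of "b \<bullet> \<pi> (\<sigma> S)"] b(1) V(5) by simp
  qed
  have nd2: "a = \<zero>\<^bsub>Hom C G G\<^esub>" if a: "in_hom a G G" and z: "\<And>b. in_hom b G G \<Longrightarrow> tr (b \<bullet> a) = \<zero>\<^bsub>K\<^esub>" for a
  proof (rule ccontr)
    assume ne: "a \<noteq> \<zero>\<^bsub>Hom C G G\<^esub>"
    obtain S' where S': "S' \<in> I" "a \<bullet> \<iota> S' \<noteq> \<zero>\<^bsub>Hom C (P S') G\<^esub>" using B.out_zeroI[OF a] ne by blast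
    then obtain S where S: "S \<in> I" "S' = \<sigma> S" using surj by blast
    note V = vD[OF S(1)] and D' = D[OF vD(5)[OF S(1)]]
    obtain b where b: "in_hom b G (P S)" "b \<bullet> a \<bullet> \<iota> (\<sigma> S) = v S \<bullet> p (\<sigma> S)"
      by (rule top_extend[OF cov[OF S(1)] cov[OF V(5)] V(1) _ _ _ S'(2)[unfolded S(2)]]) (use V S(1) a in simp_all)
    let ?u = "(\<iota> S \<bullet> b) \<bullet> a"
    have qu: "q T ?u = (\<pi> T \<bullet> \<iota> S) \<bullet> b \<bullet> a \<bullet> \<iota> (\<sigma> T)" if "T \<in> I" for T
      using that a b(1) S(1) vD(5)[OF that] by (simp add: q_def)
    have "q S ?u = m S"
      using qu[OF S(1)] b(2) m[OF S(1)] S(1) by (simp add: B.proj_inj m_def)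
    moreover have "q T ?u = \<zero>\<^bsub>Hom C (P (\<sigma> T)) (P T)\<^esub>" if T: "T \<in> I" "T \<noteq> S" for T
      using qu[OF T(1)] B.proj_inj_ne[OF T(1) S(1) T(2)] T(1) a b(1) vD(5)[OF T(1)] by simp
    ultimately have "tr ?u = \<one>\<^bsub>K\<^esub>" by (rule tr_one[OF S(1)])
    then show False using z[of "\<iota> S \<bullet> b"] b(1) S(1) by simp
  qed
  show ?thesis by (rule that[OF proj gen lin nd1 nd2])
qed

end

section \<open>The linear category of finite-dimensional modules\<close>

lemma (in associative_algebra) module_restrict_scalars:
  assumes "left_module A M"
  shows "module K (restrict_scalars A M)"
proof -
  interpret M: left_module A M by (rule assms)
  have one: "c \<odot>\<^bsub>A\<^esub> \<one>\<^bsub>A\<^esub> \<in> carrier A" if "c \<in> carrier K" for c using that by simp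
  have "abelian_group (restrict_scalars A M)"
    by (rule abelian_groupI) (auto simp: restrict_scalars_def M.M.a_ac intro!: bexI[of _ "\<ominus>\<^bsub>M\<^esub> _"] M.M.l_neg)
  then show ?thesis
  proof (rule moduleI[OF R.is_cring])
    fix a b x assume *: "a \<in> carrier K" "b \<in> carrier K" "x \<in> carrier (restrict_scalars A M)"
    have "(a \<odot>\<^bsub>A\<^esub> \<one>\<^bsub>A\<^esub>) \<otimes>\<^bsub>A\<^esub> (b \<odot>\<^bsub>A\<^esub> \<one>\<^bsub>A\<^esub>) = (a \<otimes>\<^bsub>K\<^esub> b) \<odot>\<^bsub>A\<^esub> \<one>\<^bsub>A\<^esub>"
      using * by (simp add: smult_mult_left smult_assoc1)
    then show "(a \<otimes>\<^bsub>K\<^esub> b) \<odot>\<^bsub>restrict_scalars A M\<^esub> x = a \<odot>\<^bsub>restrict_scalars A M\<^esub> (b \<odot>\<^bsub>restrict_scalars A M\<^esub> x)"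
      using * one M.act_assoc[of "a \<odot>\<^bsub>A\<^esub> \<one>\<^bsub>A\<^esub>" "b \<odot>\<^bsub>A\<^esub> \<one>\<^bsub>A\<^esub>" x] by (simp add: restrict_scalars_def)
  qed (use one in \<open>simp_all add: restrict_scalars_def M.act_closed M.act_l_distr M.act_r_distr M.act_one smult_l_distr\<close>)
qed

lemma restrict_scalars_simps [simp]:
  "carrier (restrict_scalars A M) = carrier M" "\<zero>\<^bsub>restrict_scalars A M\<^esub> = \<zero>\<^bsub>M\<^esub>"
  "u \<oplus>\<^bsub>restrict_scalars A M\<^esub> v = u \<oplus>\<^bsub>M\<^esub> v" "c \<odot>\<^bsub>restrict_scalars A M\<^esub> v = (c \<odot>\<^bsub>A\<^esub> \<one>\<^bsub>A\<^esub>) \<odot>\<^bsub>M\<^esub> v"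
  by (simp_all add: restrict_scalars_def)

lemma module_mapsD:
  assumes "f \<in> module_maps A M N"
  shows "u \<in> carrier M \<Longrightarrow> f u \<in> carrier N" "f \<in> extensional (carrier M)"
    "\<lbrakk> u \<in> carrier M; v \<in> carrier M \<rbrakk> \<Longrightarrow> f (u \<oplus>\<^bsub>M\<^esub> v) = f u \<oplus>\<^bsub>N\<^esub> f v"
    "\<lbrakk> a \<in> carrier A; u \<in> carrier M \<rbrakk> \<Longrightarrow> f (a \<odot>\<^bsub>M\<^esub> u) = a \<odot>\<^bsub>N\<^esub> f u"
  using assms unfolding module_maps_def PiE_def by auto

lemma module_mapsI:
  assumes "\<And>u. u \<in> carrier M \<Longrightarrow> f u \<in> carrier N" "f \<in> extensional (carrier M)"
    "\<And>u v. \<lbrakk> u \<in> carrier M; v \<in> carrier M \<rbrakk> \<Longrightarrow> f (u \<oplus>\<^bsub>M\<^esub> v) = f u \<oplus>\<^bsub>N\<^esub> f v"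
    "\<And>a u. \<lbrakk> a \<in> carrier A; u \<in> carrier M \<rbrakk> \<Longrightarrow> f (a \<odot>\<^bsub>M\<^esub> u) = a \<odot>\<^bsub>N\<^esub> f u"
  shows "f \<in> module_maps A M N"
  using assms unfolding module_maps_def PiE_def by auto

lemma module_maps_eqI:
  "\<lbrakk> f \<in> extensional (carrier M); g \<in> extensional (carrier M); \<And>u. u \<in> carrier M \<Longrightarrow> f u = g u \<rbrakk> \<Longrightarrow> f = g"
  by (rule extensionalityI)

lemma fd_modules_simps:
  "M \<in> Obj (fd_modules K A) \<longleftrightarrow> left_module A M \<and> finite_dimensional K (restrict_scalars A M)"
  "h \<in> mor (fd_modules K A) M N \<longleftrightarrow> (\<exists>f \<in> module_maps A M N. h = (M, f, N))"
  "Ident (fd_modules K A) M = (M, \<lambda>v \<in> carrier M. v, M)"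
  "Comp (fd_modules K A) (N', g, P) (M, f, N) = (M, compose (carrier M) g f, P)"
  by (auto simp: fd_modules_def module_hom_space_def)

lemma Hom_fd_modules: "Hom (fd_modules K A) M N = module_hom_space A M N"
  by (simp add: fd_modules_def)

lemma module_hom_space_simps:
  "\<zero>\<^bsub>module_hom_space A M N\<^esub> = (M, \<lambda>v \<in> carrier M. \<zero>\<^bsub>N\<^esub>, N)"
  "(M', f, N') \<oplus>\<^bsub>module_hom_space A M N\<^esub> (M'', g, N'') = (M, \<lambda>v \<in> carrier M. f v \<oplus>\<^bsub>N\<^esub> g v, N)"
  "c \<odot>\<^bsub>module_hom_space A M N\<^esub> (M', f, N') = (M, \<lambda>v \<in> carrier M. (c \<odot>\<^bsub>A\<^esub> \<one>\<^bsub>A\<^esub>) \<odot>\<^bsub>N\<^esub> f v, N)"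
  by (simp_all add: module_hom_space_def)

lemma compose_module_maps:
  assumes "f \<in> module_maps A L M" "g \<in> module_maps A M N" "left_module A L"
  shows "compose (carrier L) g f \<in> module_maps A L N"
proof -
  interpret L: left_module A L by (rule assms)
  note f = module_mapsD[OF assms(1)] and g = module_mapsD[OF assms(2)]
  show ?thesis
    by (rule module_mapsI) (simp_all add: compose_def f g L.act_closed)
qed

lemma category_fd_modules: "category (fd_modules K A)"
proof
  fix X assume "X \<in> Obj (fd_modules K A)"
  then interpret X: left_module A X by (simp add: fd_modules_simps)
  show "Ident (fd_modules K A) X \<in> mor (fd_modules K A) X X"
    unfolding fd_modules_simps by (rule bexI[of _ "\<lambda>v \<in> carrier X. v"], rule refl, rule module_mapsI) (simp_all add: X.act_closed)
next
  fix X Y Z f g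
  assume "X \<in> Obj (fd_modules K A)" "f \<in> mor (fd_modules K A) X Y" "g \<in> mor (fd_modules K A) Y Z"
  then show "g \<bullet>\<^bsub>fd_modules K A\<^esub> f \<in> mor (fd_modules K A) X Z"
    by (auto simp: fd_modules_simps intro: compose_module_maps)
next
  fix X Y f
  assume "X \<in> Obj (fd_modules K A)" "f \<in> mor (fd_modules K A) X Y"
  then obtain f' where f: "f = (X, f', Y)" "f' \<in> module_maps A X Y" by (auto simp: fd_modules_simps)
  note f' = module_mapsD[OF f(2)]
  show "Ident (fd_modules K A) Y \<bullet>\<^bsub>fd_modules K A\<^esub> f = f" "f \<bullet>\<^bsub>fd_modules K A\<^esub> Ident (fd_modules K A) X = f"
    unfolding f fd_modules_simps
    by (simp_all, (rule module_maps_eqI[OF _ f'(2)]; simp add: compose_def f')+)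
next
  fix W X Y Z f g h
  assume "f \<in> mor (fd_modules K A) W X" "g \<in> mor (fd_modules K A) X Y" "h \<in> mor (fd_modules K A) Y Z"
  then obtain f' g' h' where f: "f = (W, f', X)" "f' \<in> module_maps A W X" "g = (X, g', Y)" "h = (Y, h', Z)"
    by (auto simp: fd_modules_simps)
  show "(h \<bullet>\<^bsub>fd_modules K A\<^esub> g) \<bullet>\<^bsub>fd_modules K A\<^esub> f = h \<bullet>\<^bsub>fd_modules K A\<^esub> g \<bullet>\<^bsub>fd_modules K A\<^esub> f"
    unfolding f fd_modules_simps using module_mapsD(1)[OF f(2)] by (auto simp: compose_def fun_eq_iff)
qed (auto simp: fd_modules_simps)

context associative_algebra begin

lemma module_module_hom_space:
  assumes "left_module A M" "left_module A N"
  shows "module K (module_hom_space A M N)"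
proof -
  interpret M: left_module A M by (rule assms)
  interpret N: left_module A N by (rule assms)
  interpret NK: module K "restrict_scalars A N" by (rule module_restrict_scalars[OF assms(2)])
  let ?H = "module_hom_space A M N"
  have H: "h \<in> carrier ?H \<longleftrightarrow> (\<exists>f \<in> module_maps A M N. h = (M, f, N))" for h
    by (auto simp: module_hom_space_def)
  have one: "c \<odot>\<^bsub>A\<^esub> \<one>\<^bsub>A\<^esub> \<in> carrier A" if "c \<in> carrier K" for c using that by simp
  \<comment> \<open>Scalars act centrally, so scalar multiples of module maps are module maps.\<close>
  have central: "(c \<odot>\<^bsub>A\<^esub> \<one>\<^bsub>A\<^esub>) \<odot>\<^bsub>N\<^esub> (a \<odot>\<^bsub>N\<^esub> v) = a \<odot>\<^bsub>N\<^esub> ((c \<odot>\<^bsub>A\<^esub> \<one>\<^bsub>A\<^esub>) \<odot>\<^bsub>N\<^esub> v)"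
    if "c \<in> carrier K" "a \<in> carrier A" "v \<in> carrier N" for c a v
    using that one by (simp add: N.act_assoc[symmetric] smult_mult_left smult_mult_right)
  have add: "(\<lambda>v \<in> carrier M. f v \<oplus>\<^bsub>N\<^esub> g v) \<in> module_maps A M N"
    if "f \<in> module_maps A M N" "g \<in> module_maps A M N" for f g
    using module_mapsD[OF that(1)] module_mapsD[OF that(2)]
    by (intro module_mapsI) (simp_all add: M.act_closed N.act_r_distr N.M.a_ac)
  have smult: "(\<lambda>v \<in> carrier M. (c \<odot>\<^bsub>A\<^esub> \<one>\<^bsub>A\<^esub>) \<odot>\<^bsub>N\<^esub> f v) \<in> module_maps A M N"
    if "f \<in> module_maps A M N" "c \<in> carrier K" for f c
    using module_mapsD[OF that(1)] one[OF that(2)] that(2)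
    by (intro module_mapsI) (simp_all add: M.act_closed N.act_closed N.act_r_distr central)
  have zero: "(\<lambda>v \<in> carrier M. \<zero>\<^bsub>N\<^esub>) \<in> module_maps A M N"
  proof -
    have "a \<odot>\<^bsub>N\<^esub> \<zero>\<^bsub>N\<^esub> = \<zero>\<^bsub>N\<^esub>" if "a \<in> carrier A" for a
      using N.act_r_distr[OF that, of "\<zero>\<^bsub>N\<^esub>" "\<zero>\<^bsub>N\<^esub>"] N.act_closed[OF that, of "\<zero>\<^bsub>N\<^esub>"] by simp
    then show ?thesis by (intro module_mapsI) (simp_all add: M.act_closed)
  qed
  have "abelian_group ?H"
  proof (rule abelian_groupI)
    fix x assume "x \<in> carrier ?H"
    then obtain f where f: "x = (M, f, N)" "f \<in> module_maps A M N" by (auto simp: H)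
    note fD = module_mapsD[OF f(2)]
    show "\<zero>\<^bsub>?H\<^esub> \<oplus>\<^bsub>?H\<^esub> x = x"
      unfolding f module_hom_space_simps
      by (simp, rule module_maps_eqI[OF _ fD(2)]) (simp_all add: fD)
    let ?n = "\<lambda>v \<in> carrier M. ((\<ominus>\<^bsub>K\<^esub> \<one>\<^bsub>K\<^esub>) \<odot>\<^bsub>A\<^esub> \<one>\<^bsub>A\<^esub>) \<odot>\<^bsub>N\<^esub> f v"
    have "((\<ominus>\<^bsub>K\<^esub> \<one>\<^bsub>K\<^esub>) \<odot>\<^bsub>A\<^esub> \<one>\<^bsub>A\<^esub>) \<odot>\<^bsub>N\<^esub> v \<oplus>\<^bsub>N\<^esub> v = \<zero>\<^bsub>N\<^esub>" if "v \<in> carrier N" for v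
      using NK.smult_l_distr[of "\<ominus>\<^bsub>K\<^esub> \<one>\<^bsub>K\<^esub>" "\<one>\<^bsub>K\<^esub>" v] NK.smult_one[of v] NK.smult_l_null[of v] that
      by (simp add: R.l_neg)
    then have "(M, ?n, N) \<oplus>\<^bsub>?H\<^esub> x = \<zero>\<^bsub>?H\<^esub>"
      unfolding f module_hom_space_simps by (simp add: fD cong: restrict_cong)
    moreover have "(M, ?n, N) \<in> carrier ?H" using smult[OF f(2)] by (auto simp: H)
    ultimately show "\<exists>y \<in> carrier ?H. y \<oplus>\<^bsub>?H\<^esub> x = \<zero>\<^bsub>?H\<^esub>" by blast
  qed (auto simp: H module_hom_space_simps add zero module_mapsD(1) N.M.a_ac cong: restrict_cong)
  then show ?thesis
  proof (rule moduleI[OF R.is_cring])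
    fix x assume "x \<in> carrier ?H"
    then obtain f where f: "x = (M, f, N)" "f \<in> module_maps A M N" by (auto simp: H)
    note fD = module_mapsD[OF f(2)]
    show "\<one>\<^bsub>K\<^esub> \<odot>\<^bsub>?H\<^esub> x = x"
      unfolding f module_hom_space_simps
      by (simp, rule module_maps_eqI[OF _ fD(2)]) (simp_all add: fD N.act_one)
    fix a assume a: "a \<in> carrier K"
    then show "a \<odot>\<^bsub>?H\<^esub> x \<in> carrier ?H" using smult f by (auto simp: H module_hom_space_simps)
    fix b assume b: "b \<in> carrier K"
    show "(a \<oplus>\<^bsub>K\<^esub> b) \<odot>\<^bsub>?H\<^esub> x = a \<odot>\<^bsub>?H\<^esub> x \<oplus>\<^bsub>?H\<^esub> b \<odot>\<^bsub>?H\<^esub> x"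
      unfolding f module_hom_space_simps using NK.smult_l_distr[OF a b] fD(1) by (simp cong: restrict_cong)
    show "(a \<otimes>\<^bsub>K\<^esub> b) \<odot>\<^bsub>?H\<^esub> x = a \<odot>\<^bsub>?H\<^esub> (b \<odot>\<^bsub>?H\<^esub> x)"
      unfolding f module_hom_space_simps using NK.smult_assoc1[OF a b] fD(1) by (simp cong: restrict_cong)
  next
    fix a x y assume a: "a \<in> carrier K" and "x \<in> carrier ?H" "y \<in> carrier ?H"
    then obtain f g where f: "x = (M, f, N)" "f \<in> module_maps A M N" "y = (M, g, N)" "g \<in> module_maps A M N"
      by (auto simp: H)
    show "a \<odot>\<^bsub>?H\<^esub> (x \<oplus>\<^bsub>?H\<^esub> y) = a \<odot>\<^bsub>?H\<^esub> x \<oplus>\<^bsub>?H\<^esub> a \<odot>\<^bsub>?H\<^esub> y"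
      unfolding f module_hom_space_simps
      using NK.smult_r_distr[OF a] module_mapsD(1)[OF f(2)] module_mapsD(1)[OF f(4)] by (simp cong: restrict_cong)
  qed
qed

lemma linear_category_fd_modules:
  assumes "field K"
  shows "linear_category K (fd_modules K A :: ('k, ('a, 'v) module, ('a, 'v) module_mor) lincat)"
proof -
  show ?thesis
  proof (intro linear_category.intro assms category_fd_modules linear_category_axioms.intro)
    fix X Y :: "('a, 'v) module"
    assume "X \<in> Obj (fd_modules K A)" "Y \<in> Obj (fd_modules K A)"
    then show "module K (Hom (fd_modules K A) X Y)"
      by (simp add: fd_modules_simps Hom_fd_modules module_module_hom_space)
  next
    fix X Y Z f g h
    assume "f \<in> mor (fd_modules K A) X Y" "g \<in> mor (fd_modules K A) Y Z" "h \<in> mor (fd_modules K A) Y Z"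
    then obtain f' g' h' where f: "f = (X, f', Y)" "f' \<in> module_maps A X Y" "g = (Y, g', Z)" "h = (Y, h', Z)"
      by (auto simp: fd_modules_simps)
    show "(g \<oplus>\<^bsub>Hom (fd_modules K A) Y Z\<^esub> h) \<bullet>\<^bsub>fd_modules K A\<^esub> f =
        g \<bullet>\<^bsub>fd_modules K A\<^esub> f \<oplus>\<^bsub>Hom (fd_modules K A) X Z\<^esub> h \<bullet>\<^bsub>fd_modules K A\<^esub> f"
      unfolding f fd_modules_simps Hom_fd_modules module_hom_space_simps using module_mapsD(1)[OF f(2)]
      by (simp add: compose_def cong: restrict_cong)
  next
    fix X Y Z f g h
    assume "f \<in> mor (fd_modules K A) X Y" "g \<in> mor (fd_modules K A) X Y" "h \<in> mor (fd_modules K A) Y Z"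
    then obtain f' g' h' where f: "f = (X, f', Y)" "f' \<in> module_maps A X Y" "g = (X, g', Y)" "g' \<in> module_maps A X Y"
      "h = (Y, h', Z)" "h' \<in> module_maps A Y Z"
      by (auto simp: fd_modules_simps)
    show "h \<bullet>\<^bsub>fd_modules K A\<^esub> (f \<oplus>\<^bsub>Hom (fd_modules K A) X Y\<^esub> g) =
        h \<bullet>\<^bsub>fd_modules K A\<^esub> f \<oplus>\<^bsub>Hom (fd_modules K A) X Z\<^esub> h \<bullet>\<^bsub>fd_modules K A\<^esub> g"
      unfolding f fd_modules_simps Hom_fd_modules module_hom_space_simps
      using module_mapsD(1)[OF f(2)] module_mapsD(1)[OF f(4)] module_mapsD(3)[OF f(6)]
      by (simp add: compose_def cong: restrict_cong)
  next
    fix X Y Z c f g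
    assume "c \<in> carrier K" "f \<in> mor (fd_modules K A) X Y" "g \<in> mor (fd_modules K A) Y Z"
    then obtain f' g' where f: "f = (X, f', Y)" "f' \<in> module_maps A X Y" "g = (Y, g', Z)" "g' \<in> module_maps A Y Z"
      and c: "c \<odot>\<^bsub>A\<^esub> \<one>\<^bsub>A\<^esub> \<in> carrier A"
      by (auto simp: fd_modules_simps)
    show "(c \<odot>\<^bsub>Hom (fd_modules K A) Y Z\<^esub> g) \<bullet>\<^bsub>fd_modules K A\<^esub> f = c \<odot>\<^bsub>Hom (fd_modules K A) X Z\<^esub> (g \<bullet>\<^bsub>fd_modules K A\<^esub> f)"
      "g \<bullet>\<^bsub>fd_modules K A\<^esub> (c \<odot>\<^bsub>Hom (fd_modules K A) X Y\<^esub> f) = c \<odot>\<^bsub>Hom (fd_modules K A) X Z\<^esub> (g \<bullet>\<^bsub>fd_modules K A\<^esub> f)"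
      unfolding f fd_modules_simps Hom_fd_modules module_hom_space_simps
      using module_mapsD(1)[OF f(2)] module_mapsD(4)[OF f(4) c]
      by (simp_all add: compose_def cong: restrict_cong)
  qed
qed

end

lemma bijective_module_map_is_iso:
  assumes M: "left_module A M" and f: "f \<in> module_maps A M N" "bij_betw f (carrier M) (carrier N)"
  shows "is_iso (fd_modules K A) M N (M, f, N)"
proof -
  interpret M: left_module A M by (rule M)
  note fD = module_mapsD[OF f(1)]
  define g where "g = (\<lambda>v \<in> carrier N. inv_into (carrier M) f v)"
  have fg: "f (g v) = v" "g v \<in> carrier M" if "v \<in> carrier N" for v
    using that f(2) by (simp_all add: g_def bij_betw_inv_into_right bij_betwE[OF bij_betw_inv_into])
  have gf: "g (f u) = u" if "u \<in> carrier M" for u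
    using that f(2) fD(1) by (simp add: g_def bij_betw_inv_into_left)
  have g: "g \<in> module_maps A N M"
  proof (rule module_mapsI)
    fix u v assume uv: "u \<in> carrier N" "v \<in> carrier N"
    have "g (u \<oplus>\<^bsub>N\<^esub> v) = g (f (g u \<oplus>\<^bsub>M\<^esub> g v))" using uv fg fD(3) by simp
    then show "g (u \<oplus>\<^bsub>N\<^esub> v) = g u \<oplus>\<^bsub>M\<^esub> g v" using uv fg gf by simp
  next
    fix a v assume av: "a \<in> carrier A" "v \<in> carrier N"
    have "g (a \<odot>\<^bsub>N\<^esub> v) = g (f (a \<odot>\<^bsub>M\<^esub> g v))" using av fg fD(4) by simp
    then show "g (a \<odot>\<^bsub>N\<^esub> v) = a \<odot>\<^bsub>M\<^esub> g v" using av fg gf M.act_closed by simp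
  qed (simp_all add: fg, simp add: g_def)
  have "compose (carrier M) g f = (\<lambda>v \<in> carrier M. v)" "compose (carrier N) f g = (\<lambda>v \<in> carrier N. v)"
    by (simp_all add: compose_def fg gf cong: restrict_cong)
  then show ?thesis
    unfolding is_iso_def fd_modules_simps using f(1) g by (intro conjI bexI[of _ "(N, g, M)"]) (auto simp: fd_modules_simps)
qed

section \<open>Equivalences from full, faithful and dense functors\<close>

text \<open>The inverse functor picks for each object of the target an isomorphic object in the image and conjugates morphisms by the
  chosen isomorphisms; every identity it must satisfy can be checked after applying the given faithful functor.\<close>

lemma linearly_equivalentI:
  fixes C :: "('k, 'o, 'm, 'z) lincat_scheme" and D :: "('k, 'p, 'n, 'y) lincat_scheme"
  assumes C: "linear_category K C" and D: "linear_category K D" and F: "linear_functor K C D FO FM"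
    and faithful: "\<And>X Y f g. \<lbrakk> X \<in> Obj C; Y \<in> Obj C; f \<in> mor C X Y; g \<in> mor C X Y; FM f = FM g \<rbrakk> \<Longrightarrow> f = g"
    and full: "\<And>X Y h. \<lbrakk> X \<in> Obj C; Y \<in> Obj C; h \<in> mor D (FO X) (FO Y) \<rbrakk> \<Longrightarrow> \<exists>f \<in> mor C X Y. FM f = h"
    and dense: "\<And>M. M \<in> Obj D \<Longrightarrow> \<exists>X \<in> Obj C. isomorphic D (FO X) M"
  shows "linearly_equivalent K C D"
proof -
  interpret C: linear_category K C by (rule C)
  interpret D: linear_category K D by (rule D)
  have FO [simp]: "FO X \<in> Obj D" and F_id: "FM (Ident C X) = Ident D (FO X)" if "X \<in> Obj C" for X
    using F that unfolding linear_functor_def by blast+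
  have F_arr [simp]: "D.arr (FM f)" "D.src (FM f) = FO (C.src f)" "D.tgt (FM f) = FO (C.tgt f)" if "C.arr f" for f
  proof -
    have "FM f \<in> mor D (FO (C.src f)) (FO (C.tgt f))"
      using F that C.arr_obj[OF that] C.in_mor[OF that refl refl] unfolding linear_functor_def by blast
    then show "D.arr (FM f)" "D.src (FM f) = FO (C.src f)" "D.tgt (FM f) = FO (C.tgt f)"
      using that by (simp_all add: D.mor_iff)
  qed
  have F_comp: "FM (g \<bullet>\<^bsub>C\<^esub> f) = FM g \<bullet>\<^bsub>D\<^esub> FM f" if fg: "C.arr f" "C.arr g" "C.tgt f = C.src g" for f g
  proof -
    have "f \<in> mor C (C.src f) (C.src g)" "g \<in> mor C (C.src g) (C.tgt g)" using fg by simp_all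
    then show ?thesis
      using F C.arr_obj[OF fg(1)] C.arr_obj[OF fg(2)] unfolding linear_functor_def by blast
  qed
  have F_add: "FM (f \<oplus>\<^bsub>Hom C X Y\<^esub> g) = FM f \<oplus>\<^bsub>Hom D (FO X) (FO Y)\<^esub> FM g"
    if "C.in_hom f X Y" "C.in_hom g X Y" for f g X Y
  proof -
    have "X \<in> Obj C" "Y \<in> Obj C" "f \<in> mor C X Y" "g \<in> mor C X Y" using that by auto
    then show ?thesis using F unfolding linear_functor_def by blast
  qed
  have F_smult: "FM (c \<odot>\<^bsub>Hom C X Y\<^esub> f) = c \<odot>\<^bsub>Hom D (FO X) (FO Y)\<^esub> FM f"
    if "C.in_hom f X Y" "c \<in> carrier K" for f c X Y
  proof -
    have "X \<in> Obj C" "Y \<in> Obj C" "f \<in> mor C X Y" using that by auto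
    then show ?thesis using F that(2) unfolding linear_functor_def by blast
  qed
  have inj: "f = g" if "C.arr f" "C.arr g" "C.src f = C.src g" "C.tgt f = C.tgt g" "FM f = FM g" for f g
    by (rule faithful[of "C.src g" "C.tgt g"]) (use that C.arr_obj[of g] in simp_all)
  have lift: "\<exists>f. C.in_hom f X Y \<and> FM f = h" if XY: "X \<in> Obj C" "Y \<in> Obj C" and h: "D.in_hom h (FO X) (FO Y)" for X Y h
  proof -
    have "h \<in> mor D (FO X) (FO Y)" using h by simp
    then obtain f where "f \<in> mor C X Y" "FM f = h" using full[OF XY] by blast
    then show ?thesis using XY by (intro exI[of _ f]) (simp add: C.mor_iff)
  qed
  have "\<forall>M \<in> Obj D. \<exists>Xp. fst Xp \<in> Obj C \<and> D.iso (snd Xp) \<and> D.src (snd Xp) = FO (fst Xp) \<and> D.tgt (snd Xp) = M"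
  proof
    fix M assume M: "M \<in> Obj D"
    then obtain X where X: "X \<in> Obj C" "isomorphic D (FO X) M" using dense by blast
    obtain p where "D.iso p" "D.src p = FO X" "D.tgt p = M"
      by (rule D.isomorphicE[OF X(2) FO[OF X(1)] M])
    then show "\<exists>Xp. fst Xp \<in> Obj C \<and> D.iso (snd Xp) \<and> D.src (snd Xp) = FO (fst Xp) \<and> D.tgt (snd Xp) = M"
      using X(1) by (intro exI[of _ "(X, p)"]) simp
  qed
  from bchoice[OF this] obtain Xp
    where Xp: "\<forall>M \<in> Obj D. fst (Xp M) \<in> Obj C \<and> D.iso (snd (Xp M)) \<and> D.src (snd (Xp M)) = FO (fst (Xp M)) \<and> D.tgt (snd (Xp M)) = M" ..
  define GO where "GO M = fst (Xp M)" for M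
  define \<phi> where "\<phi> M = snd (Xp M)" for M
  have \<phi> [simp]: "GO M \<in> Obj C" "D.iso (\<phi> M)" "D.src (\<phi> M) = FO (GO M)" "D.tgt (\<phi> M) = M" if "M \<in> Obj D" for M
    using Xp that by (simp_all add: GO_def \<phi>_def)
  let ?\<psi> = "\<lambda>M. minv D (\<phi> M)"
  define GM where "GM h = (SOME f. C.in_hom f (GO (D.src h)) (GO (D.tgt h)) \<and> FM f = ?\<psi> (D.tgt h) \<bullet>\<^bsub>D\<^esub> h \<bullet>\<^bsub>D\<^esub> \<phi> (D.src h))" for h
  have GM: "C.in_hom (GM h) (GO (D.src h)) (GO (D.tgt h)) \<and> FM (GM h) = ?\<psi> (D.tgt h) \<bullet>\<^bsub>D\<^esub> h \<bullet>\<^bsub>D\<^esub> \<phi> (D.src h)"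
    if "D.arr h" for h
    unfolding GM_def by (rule someI_ex, rule lift) (use that in simp_all)
  have GM_arr [simp]: "C.arr (GM h)" "C.src (GM h) = GO (D.src h)" "C.tgt (GM h) = GO (D.tgt h)"
    and FGM: "FM (GM h) = ?\<psi> (D.tgt h) \<bullet>\<^bsub>D\<^esub> h \<bullet>\<^bsub>D\<^esub> \<phi> (D.src h)" if "D.arr h" for h
    using GM[OF that] by simp_all
  have G: "linear_functor K D C GO GM"
    unfolding linear_functor_def
  proof (intro conjI ballI)
    fix M assume M: "M \<in> Obj D"
    then show "GO M \<in> Obj C" by simp
    show "GM (Ident D M) = Ident C (GO M)"
      by (rule inj) (use M in \<open>simp_all add: FGM F_id D.minv_comp\<close>)
    fix N assume N: "N \<in> Obj D"
    show "GM h \<in> mor C (GO M) (GO N)" if "h \<in> mor D M N" for h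
      using that M N by (simp add: D.mor_iff)
    show "GM (g \<bullet>\<^bsub>D\<^esub> f) = GM g \<bullet>\<^bsub>C\<^esub> GM f" if P: "P \<in> Obj D" and fg: "f \<in> mor D M N" "g \<in> mor D N P" for P f g
    proof (rule inj)
      have h: "D.in_hom f M N" "D.in_hom g N P" using fg M N P by (simp_all add: D.mor_iff)
      then show "FM (GM (g \<bullet>\<^bsub>D\<^esub> f)) = FM (GM g \<bullet>\<^bsub>C\<^esub> GM f)" using M N P by (simp add: F_comp FGM)
      show "C.arr (GM (g \<bullet>\<^bsub>D\<^esub> f))" "C.arr (GM g \<bullet>\<^bsub>C\<^esub> GM f)" "C.src (GM (g \<bullet>\<^bsub>D\<^esub> f)) = C.src (GM g \<bullet>\<^bsub>C\<^esub> GM f)"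
        "C.tgt (GM (g \<bullet>\<^bsub>D\<^esub> f)) = C.tgt (GM g \<bullet>\<^bsub>C\<^esub> GM f)" using h by simp_all
    qed
    show "GM (f \<oplus>\<^bsub>Hom D M N\<^esub> g) = GM f \<oplus>\<^bsub>Hom C (GO M) (GO N)\<^esub> GM g" if fg: "f \<in> mor D M N" "g \<in> mor D M N" for f g
    proof (rule inj)
      have h: "D.in_hom f M N" "D.in_hom g M N" using fg M N by (simp_all add: D.mor_iff)
      then show "FM (GM (f \<oplus>\<^bsub>Hom D M N\<^esub> g)) = FM (GM f \<oplus>\<^bsub>Hom C (GO M) (GO N)\<^esub> GM g)"
        using M N by (simp add: F_add FGM D.add_comp D.comp_add)
      show "C.arr (GM (f \<oplus>\<^bsub>Hom D M N\<^esub> g))" "C.arr (GM f \<oplus>\<^bsub>Hom C (GO M) (GO N)\<^esub> GM g)"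
        "C.src (GM (f \<oplus>\<^bsub>Hom D M N\<^esub> g)) = C.src (GM f \<oplus>\<^bsub>Hom C (GO M) (GO N)\<^esub> GM g)"
        "C.tgt (GM (f \<oplus>\<^bsub>Hom D M N\<^esub> g)) = C.tgt (GM f \<oplus>\<^bsub>Hom C (GO M) (GO N)\<^esub> GM g)" using h by simp_all
    qed
    show "GM (c \<odot>\<^bsub>Hom D M N\<^esub> f) = c \<odot>\<^bsub>Hom C (GO M) (GO N)\<^esub> GM f" if c: "c \<in> carrier K" and f: "f \<in> mor D M N" for c f
    proof (rule inj)
      have h: "D.in_hom f M N" using f M N by (simp add: D.mor_iff)
      then show "FM (GM (c \<odot>\<^bsub>Hom D M N\<^esub> f)) = FM (c \<odot>\<^bsub>Hom C (GO M) (GO N)\<^esub> GM f)"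
        using M N c by (simp add: F_smult FGM D.smult_comp D.comp_smult)
      show "C.arr (GM (c \<odot>\<^bsub>Hom D M N\<^esub> f))" "C.arr (c \<odot>\<^bsub>Hom C (GO M) (GO N)\<^esub> GM f)"
        "C.src (GM (c \<odot>\<^bsub>Hom D M N\<^esub> f)) = C.src (c \<odot>\<^bsub>Hom C (GO M) (GO N)\<^esub> GM f)"
        "C.tgt (GM (c \<odot>\<^bsub>Hom D M N\<^esub> f)) = C.tgt (c \<odot>\<^bsub>Hom C (GO M) (GO N)\<^esub> GM f)" using h c by simp_all
    qed
  qed
  have "\<forall>X \<in> Obj C. \<exists>e. C.in_hom e X (GO (FO X)) \<and> FM e = ?\<psi> (FO X)"
    by (intro ballI lift) simp_all
  from bchoice[OF this] obtain \<eta> where "\<forall>X \<in> Obj C. C.in_hom (\<eta> X) X (GO (FO X)) \<and> FM (\<eta> X) = ?\<psi> (FO X)" ..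
  then have \<eta>_arr [simp]: "C.arr (\<eta> X)" "C.src (\<eta> X) = X" "C.tgt (\<eta> X) = GO (FO X)"
    and F\<eta>: "FM (\<eta> X) = ?\<psi> (FO X)" if "X \<in> Obj C" for X using that by simp_all
  have \<eta>: "natural_iso C C (\<lambda>X. X) (\<lambda>f. f) (GO \<circ> FO) (GM \<circ> FM) \<eta>"
    unfolding natural_iso_def
  proof (intro conjI ballI)
    fix X assume X: "X \<in> Obj C"
    obtain e where e: "C.in_hom e (GO (FO X)) X" "FM e = \<phi> (FO X)" using lift[of "GO (FO X)" X "\<phi> (FO X)"] X by auto
    have "C.iso (\<eta> X)"
    proof (rule C.isoI[of _ e])
      show "e \<bullet>\<^bsub>C\<^esub> \<eta> X = Ident C (C.src (\<eta> X))"
        by (rule inj) (use X e in \<open>simp_all add: F_comp F\<eta> F_id D.comp_minv\<close>)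
      show "\<eta> X \<bullet>\<^bsub>C\<^esub> e = Ident C (C.tgt (\<eta> X))"
        by (rule inj) (use X e in \<open>simp_all add: F_comp F\<eta> F_id D.minv_comp\<close>)
    qed (use X e in simp_all)
    then show "is_iso C X ((GO \<circ> FO) X) (\<eta> X)" using X by (simp add: C.is_iso_iff)
  next
    fix X Y f assume XY: "X \<in> Obj C" "Y \<in> Obj C" "f \<in> mor C X Y"
    then have f: "C.in_hom f X Y" by (simp add: C.mor_iff)
    have "\<eta> Y \<bullet>\<^bsub>C\<^esub> f = GM (FM f) \<bullet>\<^bsub>C\<^esub> \<eta> X"
      by (rule inj) (use XY f in \<open>simp_all add: F_comp F\<eta> FGM D.comp_minv\<close>)
    then show "\<eta> Y \<bullet>\<^bsub>C\<^esub> f = (GM \<circ> FM) f \<bullet>\<^bsub>C\<^esub> \<eta> X" by simp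
  qed
  have \<epsilon>: "natural_iso D D (FO \<circ> GO) (FM \<circ> GM) (\<lambda>X. X) (\<lambda>f. f) \<phi>"
    unfolding natural_iso_def
  proof (intro conjI ballI)
    fix M assume M: "M \<in> Obj D"
    then show "is_iso D ((FO \<circ> GO) M) M (\<phi> M)" by (simp add: D.is_iso_iff)
    fix N h assume N: "N \<in> Obj D" and "h \<in> mor D M N"
    then have h: "D.in_hom h M N" using M by (simp add: D.mor_iff)
    show "\<phi> N \<bullet>\<^bsub>D\<^esub> (FM \<circ> GM) h = h \<bullet>\<^bsub>D\<^esub> \<phi> M" using h M N by (simp add: FGM)
  qed
  show ?thesis unfolding linearly_equivalent_def using F G \<eta> \<epsilon> by blast
qed

section \<open>Modules over the endomorphism algebra of a projective generator\<close>

lemma (in abelian_monoid) finsum_induct: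
  assumes "P \<zero>" "\<And>x y. \<lbrakk> x \<in> carrier G; y \<in> carrier G; P x; P y \<rbrakk> \<Longrightarrow> P (x \<oplus> y)"
    and "\<And>i. i \<in> I \<Longrightarrow> f i \<in> carrier G \<and> P (f i)"
  shows "P (finsum G f I)"
  using assms(3)
proof (induction I rule: infinite_finite_induct)
  case (insert i I)
  then have "finsum G f (insert i I) = f i \<oplus> finsum G f I" by (intro finsum_insert) auto
  then show ?case using insert assms(2) by simp
qed (simp_all add: assms(1))

lemma abelian_group_transport:
  assumes "abelian_group M" "carrier N = e ` carrier M" "\<zero>\<^bsub>N\<^esub> = e \<zero>\<^bsub>M\<^esub>"
    and add: "\<And>u v. \<lbrakk> u \<in> carrier M; v \<in> carrier M \<rbrakk> \<Longrightarrow> e u \<oplus>\<^bsub>N\<^esub> e v = e (u \<oplus>\<^bsub>M\<^esub> v)"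
  shows "abelian_group N"
proof -
  interpret M: abelian_group M by (rule assms)
  show ?thesis
  proof (rule abelian_groupI)
    fix x assume "x \<in> carrier N"
    then obtain u where u: "u \<in> carrier M" "x = e u" using assms(2) by blast
    show "\<exists>y \<in> carrier N. y \<oplus>\<^bsub>N\<^esub> x = \<zero>\<^bsub>N\<^esub>"
      using u assms(2,3) by (intro bexI[of _ "e (\<ominus>\<^bsub>M\<^esub> u)"]) (simp_all add: add M.l_neg)
  qed (auto simp: assms(2,3) add M.a_ac)
qed

lemma finite_dimensional_transport:
  assumes "module K V" "module K W" "finite_dimensional K V"
    and e: "carrier W = e ` carrier V" "e \<zero>\<^bsub>V\<^esub> = \<zero>\<^bsub>W\<^esub>"
    "\<And>u v. \<lbrakk> u \<in> carrier V; v \<in> carrier V \<rbrakk> \<Longrightarrow> e (u \<oplus>\<^bsub>V\<^esub> v) = e u \<oplus>\<^bsub>W\<^esub> e v"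
    "\<And>c v. \<lbrakk> c \<in> carrier K; v \<in> carrier V \<rbrakk> \<Longrightarrow> e (c \<odot>\<^bsub>V\<^esub> v) = c \<odot>\<^bsub>W\<^esub> e v"
  shows "finite_dimensional K W"
proof -
  interpret V: module K V by (rule assms)
  interpret W: module K W by (rule assms)
  obtain B where B: "finite B" "B \<subseteq> carrier V" "carrier V \<subseteq> lspan K V B"
    using assms(3) V.finite_dimensional_iff_lspan by blast
  have "subspace K V {v \<in> carrier V. e v \<in> lspan K W (e ` B)}"
  proof (rule subspaceI)
    show "{v \<in> carrier V. e v \<in> lspan K W (e ` B)} \<subseteq> carrier V" by blast
  qed (simp_all add: e lspan_zero lspan_add lspan_smult)
  moreover have "B \<subseteq> {v \<in> carrier V. e v \<in> lspan K W (e ` B)}"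
    using B(2) by (auto intro: lspan_base)
  ultimately have "v \<in> {v \<in> carrier V. e v \<in> lspan K W (e ` B)}" if "v \<in> carrier V" for v
    by (rule lspan_least) (rule subsetD[OF B(3) that])
  then have "e v \<in> lspan K W (e ` B)" if "v \<in> carrier V" for v
    using that by simp
  then have "carrier W \<subseteq> lspan K W (e ` B)" unfolding e(1) by (rule image_subsetI)
  moreover have "finite (e ` B)" "e ` B \<subseteq> carrier W" using B e(1) by auto
  ultimately show ?thesis unfolding W.finite_dimensional_iff_lspan by (intro exI conjI)
qed

context left_module begin

lemma act_zero [simp]: "a \<in> carrier A \<Longrightarrow> a \<odot>\<^bsub>M\<^esub> \<zero>\<^bsub>M\<^esub> = \<zero>\<^bsub>M\<^esub>"
  using act_r_distr[of a "\<zero>\<^bsub>M\<^esub>" "\<zero>\<^bsub>M\<^esub>"] act_closed[of a "\<zero>\<^bsub>M\<^esub>"] by simp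

lemma zero_act [simp]: "v \<in> carrier M \<Longrightarrow> \<zero>\<^bsub>A\<^esub> \<odot>\<^bsub>M\<^esub> v = \<zero>\<^bsub>M\<^esub>"
  using act_l_distr[of "\<zero>\<^bsub>A\<^esub>" "\<zero>\<^bsub>A\<^esub>" v] act_closed[of "\<zero>\<^bsub>A\<^esub>" v] by simp

lemma act_finsum:
  assumes "a \<in> carrier A" "\<And>i. i \<in> I \<Longrightarrow> f i \<in> carrier M"
  shows "a \<odot>\<^bsub>M\<^esub> (\<Oplus>\<^bsub>M\<^esub>i \<in> I. f i) = (\<Oplus>\<^bsub>M\<^esub>i \<in> I. a \<odot>\<^bsub>M\<^esub> f i)"
  using assms(2)
proof (induction I rule: infinite_finite_induct)
  case (insert i I)
  have "(\<Oplus>\<^bsub>M\<^esub>i \<in> insert i I. f i) = f i \<oplus>\<^bsub>M\<^esub> (\<Oplus>\<^bsub>M\<^esub>i \<in> I. f i)"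
    using insert by (intro M.finsum_insert) auto
  moreover have "(\<Oplus>\<^bsub>M\<^esub>i \<in> insert i I. a \<odot>\<^bsub>M\<^esub> f i) = a \<odot>\<^bsub>M\<^esub> f i \<oplus>\<^bsub>M\<^esub> (\<Oplus>\<^bsub>M\<^esub>i \<in> I. a \<odot>\<^bsub>M\<^esub> f i)"
    using insert assms(1) by (intro M.finsum_insert) (auto intro: act_closed)
  ultimately show ?case using insert assms(1) by (simp add: act_r_distr M.finsum_closed Pi_iff)
qed (simp_all add: assms(1))

end

lemma (in biproduct) into_induct:
  assumes u: "in_hom u Z S" and zero: "Q \<zero>\<^bsub>Hom C Z S\<^esub>"
    and add: "\<And>x y. \<lbrakk> in_hom x Z S; in_hom y Z S; Q x; Q y \<rbrakk> \<Longrightarrow> Q (x \<oplus>\<^bsub>Hom C Z S\<^esub> y)"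
    and inj: "\<And>i v. \<lbrakk> i \<in> I; in_hom v Z (X i) \<rbrakk> \<Longrightarrow> Q (\<iota> i \<bullet> v)"
  shows "Q u"
proof -
  have Z: "Z \<in> Obj C" using u by auto
  interpret H: abelian_group "Hom C Z S" using Z by (intro hom_abelian_group) auto
  have "Q (\<Oplus>\<^bsub>Hom C Z S\<^esub>i \<in> I. \<iota> i \<bullet> \<pi> i \<bullet> u)"
  proof (rule H.finsum_induct[where P = Q])
    show "Q \<zero>\<^bsub>Hom C Z S\<^esub>" by (rule zero)
    fix x y assume "x \<in> mor C Z S" "y \<in> mor C Z S" "Q x" "Q y"
    then show "Q (x \<oplus>\<^bsub>Hom C Z S\<^esub> y)" using Z by (intro add) (simp_all add: mor_iff)
  next
    fix i assume i: "i \<in> I"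
    then show "\<iota> i \<bullet> \<pi> i \<bullet> u \<in> mor C Z S \<and> Q (\<iota> i \<bullet> \<pi> i \<bullet> u)" using u inj[OF i, of "\<pi> i \<bullet> u"] by simp
  qed
  then show ?thesis using into_decomp[OF u] by simp
qed

locale projective_generator = finite_linear_category +
  fixes G
  assumes G_projective: "is_projective C G"
    and G_generates: "\<lbrakk> X \<in> Obj C; Ident C X \<noteq> \<zero>\<^bsub>Hom C X X\<^esub> \<rbrakk> \<Longrightarrow> \<exists>g. in_hom g G X \<and> g \<noteq> \<zero>\<^bsub>Hom C G X\<^esub>"
begin

lemma G_obj [simp]: "G \<in> Obj C"
  using G_projective by (simp add: is_projective_def)

text \<open>If \<open>f\<close> is nonzero, its image receives a nonzero morphism from \<open>G\<close>, which lifts to the source of \<open>f\<close> since \<open>G\<close> is projective.\<close>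

lemma generator_faithful:
  assumes f: "arr f" and z: "\<And>u. in_hom u G (src f) \<Longrightarrow> f \<bullet> u = \<zero>\<^bsub>Hom C G (tgt f)\<^esub>"
  shows "f = \<zero>\<^bsub>Hom C (src f) (tgt f)\<^esub>"
proof -
  obtain m e where me: "mono m" "epi e" "tgt e = src m" "src e = src f" "tgt m = tgt f" and fme: "f = m \<bullet> e"
    using image_factorization[OF f] .
  have "Ident C (src m) = \<zero>\<^bsub>Hom C (src m) (src m)\<^esub>"
  proof (rule ccontr)
    assume "Ident C (src m) \<noteq> \<zero>\<^bsub>Hom C (src m) (src m)\<^esub>"
    then obtain y where y: "in_hom y G (src m)" "y \<noteq> \<zero>\<^bsub>Hom C G (src m)\<^esub>" using G_generates[of "src m"] me by auto
    obtain u where u: "in_hom u G (src e)" "e \<bullet> u = y"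
      by (rule projective_lift[OF G_projective me(2), of y]) (use y me in simp_all)
    have "m \<bullet> y = f \<bullet> u" unfolding fme u(2)[symmetric] by (rule comp_assoc'[symmetric]) (use u(1) me in simp_all)
    also have "\<dots> = \<zero>\<^bsub>Hom C G (tgt f)\<^esub>" using z u(1) me(4) by simp
    finally have "y = \<zero>\<^bsub>Hom C (src y) (src m)\<^esub>" using y(1) me by (intro mono_zeroD) simp_all
    then show False using y by simp
  qed
  then have "is_zero_object C (src m)" using me by (simp add: zero_object_iff)
  then have "m = \<zero>\<^bsub>Hom C (src m) (tgt m)\<^esub>" by (rule arr_from_zero) (use me in simp_all)
  then have "f = \<zero>\<^bsub>Hom C (src m) (tgt m)\<^esub> \<bullet> e" using fme by (simp only:)
  also have "\<dots> = \<zero>\<^bsub>Hom C (src f) (tgt f)\<^esub>" using me f by simp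
  finally show ?thesis .
qed

lemma generator_epiI:
  assumes q: "arr q" and surj: "\<And>u. in_hom u G (tgt q) \<Longrightarrow> \<exists>w. in_hom w G (src q) \<and> q \<bullet> w = u"
  shows "epi q"
proof (rule epi_zeroI[OF q])
  fix g assume g: "arr g" "src g = tgt q" "g \<bullet> q = \<zero>\<^bsub>Hom C (src q) (tgt g)\<^esub>"
  have "g = \<zero>\<^bsub>Hom C (src g) (tgt g)\<^esub>"
  proof (rule generator_faithful[OF g(1)])
    fix u assume u: "in_hom u G (src g)"
    then obtain w where w: "in_hom w G (src q)" "q \<bullet> w = u" using surj g(2) by auto
    have "g \<bullet> q \<bullet> w = \<zero>\<^bsub>Hom C (src q) (tgt g)\<^esub> \<bullet> w" by (rule comp_reduce[OF g(3)]) (use g(1,2) q w(1) in simp_all)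
    then show "g \<bullet> u = \<zero>\<^bsub>Hom C G (tgt g)\<^esub>" using w g(1) by simp
  qed
  then show "g = \<zero>\<^bsub>Hom C (tgt q) (tgt g)\<^esub>" using g(2) by simp
qed

lemma ex_copower:
  assumes "finite B" "B \<subseteq> mor C G X" "X \<in> Obj C"
  obtains S \<iota> \<pi> q where "biproduct K C B (\<lambda>_. G) S \<iota> \<pi>" "in_hom q S X" "\<And>b. b \<in> B \<Longrightarrow> q \<bullet> \<iota> b = b"
proof -
  obtain S \<iota> \<pi> where S: "biproduct K C B (\<lambda>_. G) S \<iota> \<pi>" using ex_biproduct[OF assms(1), of "\<lambda>_. G"] by auto
  then interpret B: biproduct K C B "\<lambda>_. G" S \<iota> \<pi> .
  obtain q where "in_hom q S X" "\<And>b. b \<in> B \<Longrightarrow> q \<bullet> \<iota> b = b"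
    by (rule B.copair[OF assms(3), of "\<lambda>b. b"]) (use assms(2,3) mor_iff[OF G_obj assms(3)] in blast)+
  then show ?thesis using that S by blast
qed

text \<open>A map that commutes with precomposition by endomorphisms of \<open>G\<close> is determined on a finite spanning set,
  hence comes from a morphism out of a copower of \<open>G\<close>; this morphism descends along the epimorphism from the copower,
  because the generator detects that it vanishes on the kernel.\<close>

lemma generator_full:
  assumes X: "X \<in> Obj C" and Y: "Y \<in> Obj C"
    and g: "\<And>u. in_hom u G X \<Longrightarrow> in_hom (g u) G Y"
    and add: "\<And>u w. \<lbrakk> in_hom u G X; in_hom w G X \<rbrakk> \<Longrightarrow> g (u \<oplus>\<^bsub>Hom C G X\<^esub> w) = g u \<oplus>\<^bsub>Hom C G Y\<^esub> g w"
    and act: "\<And>u a. \<lbrakk> in_hom u G X; in_hom a G G \<rbrakk> \<Longrightarrow> g (u \<bullet> a) = g u \<bullet> a"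
  shows "\<exists>f. in_hom f X Y \<and> (\<forall>u. in_hom u G X \<longrightarrow> f \<bullet> u = g u)"
proof -
  interpret H: vspace K "Hom C G X" using X by (intro vspace_hom G_obj)
  obtain B where B: "finite B" "B \<subseteq> mor C G X" "mor C G X \<subseteq> lspan K (Hom C G X) B"
    using hom_finite_dimensional[OF G_obj X] H.finite_dimensional_iff_lspan by blast
  have BX: "in_hom b G X" if "b \<in> B" for b
    using subsetD[OF B(2) that] X by (simp add: mor_iff)
  obtain S \<iota> \<pi> q where S: "biproduct K C B (\<lambda>_. G) S \<iota> \<pi>" and q: "in_hom q S X" "\<And>b. b \<in> B \<Longrightarrow> q \<bullet> \<iota> b = b"
    by (rule ex_copower[OF B(1,2) X]) (rule that)
  interpret B: biproduct K C B "\<lambda>_. G" S \<iota> \<pi> by (rule S)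
  obtain h where h: "in_hom h S Y" "\<And>b. b \<in> B \<Longrightarrow> h \<bullet> \<iota> b = g b"
    by (rule B.copair[OF Y, of g]) (use g BX in blast)+
  have g0: "g \<zero>\<^bsub>Hom C G X\<^esub> = \<zero>\<^bsub>Hom C G Y\<^esub>"
  proof -
    have z: "in_hom \<zero>\<^bsub>Hom C G X\<^esub> G X" using X by simp
    have "g (\<zero>\<^bsub>Hom C G X\<^esub> \<bullet> \<zero>\<^bsub>Hom C G G\<^esub>) = g \<zero>\<^bsub>Hom C G X\<^esub> \<bullet> \<zero>\<^bsub>Hom C G G\<^esub>" using act[OF z] by simp
    then show ?thesis using g[OF z] X by simp
  qed
  have hw: "h \<bullet> w = g (q \<bullet> w)" if "in_hom w G S" for w
  proof (rule B.into_induct[OF that])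
    show "h \<bullet> \<zero>\<^bsub>Hom C G S\<^esub> = g (q \<bullet> \<zero>\<^bsub>Hom C G S\<^esub>)" using h(1) q(1) g0 by simp
    show "h \<bullet> (x \<oplus>\<^bsub>Hom C G S\<^esub> y) = g (q \<bullet> (x \<oplus>\<^bsub>Hom C G S\<^esub> y))"
      if "in_hom x G S" "in_hom y G S" "h \<bullet> x = g (q \<bullet> x)" "h \<bullet> y = g (q \<bullet> y)" for x y
      using that h(1) q(1) by (simp add: comp_add add)
    fix b a assume b: "b \<in> B" and a: "in_hom a G G"
    have "h \<bullet> \<iota> b \<bullet> a = g b \<bullet> a" by (rule comp_reduce[OF h(2)[OF b]]) (use h(1) b a in simp_all)
    moreover have "q \<bullet> \<iota> b \<bullet> a = b \<bullet> a" by (rule comp_reduce[OF q(2)[OF b]]) (use q(1) b a in simp_all)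
    ultimately show "h \<bullet> \<iota> b \<bullet> a = g (q \<bullet> \<iota> b \<bullet> a)" using act[OF BX[OF b] a] by simp
  qed
  let ?W = "{u. \<exists>w. in_hom w G S \<and> q \<bullet> w = u}"
  have "subspace K (Hom C G X) ?W"
  proof (rule subspaceI)
    show "?W \<subseteq> mor C G X" using q(1) by auto
    show "\<zero>\<^bsub>Hom C G X\<^esub> \<in> ?W"
      using q(1) by (intro CollectI exI[of _ "\<zero>\<^bsub>Hom C G S\<^esub>"]) simp
    fix u v assume "u \<in> ?W" "v \<in> ?W"
    then obtain w x where "in_hom w G S" "q \<bullet> w = u" "in_hom x G S" "q \<bullet> x = v" by blast
    then show "u \<oplus>\<^bsub>Hom C G X\<^esub> v \<in> ?W"
      using q(1) by (intro CollectI exI[of _ "w \<oplus>\<^bsub>Hom C G S\<^esub> x"]) (simp add: comp_add)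
  next
    fix c u assume c: "c \<in> carrier K" and "u \<in> ?W"
    then obtain w where "in_hom w G S" "q \<bullet> w = u" by blast
    then show "c \<odot>\<^bsub>Hom C G X\<^esub> u \<in> ?W"
      using c q(1) by (intro CollectI exI[of _ "c \<odot>\<^bsub>Hom C G S\<^esub> w"]) (simp add: comp_smult)
  qed
  moreover have "B \<subseteq> ?W" using q(2) B.inj_arr by blast
  ultimately have "u \<in> ?W" if "u \<in> mor C G X" for u
    by (rule lspan_least) (rule subsetD[OF B(3) that])
  then have surj: "\<exists>w. in_hom w G S \<and> q \<bullet> w = u" if "in_hom u G X" for u
    using that by simp
  have qe: "epi q" by (rule generator_epiI) (use q(1) surj in simp_all)
  obtain k where k: "ker_of k q" using ex_ker[OF epi_arr[OF qe]] .
  note kD = ker_ofD[OF k]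
  have hk: "h \<bullet> k = \<zero>\<^bsub>Hom C (src (h \<bullet> k)) (tgt (h \<bullet> k))\<^esub>"
  proof (rule generator_faithful)
    show "arr (h \<bullet> k)" using h(1) q(1) kD by simp
    fix z assume "in_hom z G (src (h \<bullet> k))"
    then have z: "in_hom z G (src k)" using h(1) q(1) kD by simp
    have "q \<bullet> k \<bullet> z = \<zero>\<^bsub>Hom C (src k) (tgt q)\<^esub> \<bullet> z" by (rule comp_reduce[OF kD(5)]) (use kD z q(1) in simp_all)
    then have "q \<bullet> k \<bullet> z = \<zero>\<^bsub>Hom C G X\<^esub>" using z q(1) X by simp
    then have "h \<bullet> k \<bullet> z = \<zero>\<^bsub>Hom C G Y\<^esub>" using hw[of "k \<bullet> z"] z kD q(1) g0 by simp
    then show "(h \<bullet> k) \<bullet> z = \<zero>\<^bsub>Hom C G (tgt (h \<bullet> k))\<^esub>" using h(1) q(1) kD z by simp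
  qed
  obtain f where f: "in_hom f (tgt q) (tgt h)" "f \<bullet> q = h"
    by (rule coker_of_factor[OF epi_is_coker_of_ker[OF qe k], of h]) (use h(1) q(1) kD hk in simp_all)
  have "f \<bullet> u = g u" if u: "in_hom u G X" for u
  proof -
    obtain w where w: "in_hom w G S" "q \<bullet> w = u" using surj[OF u] by blast
    have "f \<bullet> q \<bullet> w = h \<bullet> w" by (rule comp_reduce[OF f(2)]) (use f(1) q(1) w(1) in simp_all)
    then show ?thesis using w hw by simp
  qed
  then show ?thesis using f(1) q(1) h(1) by (intro exI[of _ f]) simp
qed

subsection \<open>The algebra and the functor\<close>

text \<open>Coordinates move the algebra \<open>End(G)\<^sup>o\<^sup>p\<close> and its modules \<open>Hom(G, X)\<close> into the universe of sequences of scalars.\<close>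

definition enc :: "'c \<Rightarrow> 'd \<Rightarrow> nat \<Rightarrow> 'a" where
  "enc X = (SOME e. inj_on e (mor C G X))"

definition dec :: "'c \<Rightarrow> (nat \<Rightarrow> 'a) \<Rightarrow> 'd" where
  "dec X = inv_into (mor C G X) (enc X)"

lemma dec_enc [simp]:
  assumes "arr u" "src u = G" "tgt u = X"
  shows "dec X (enc X u) = u"
proof -
  have X: "X \<in> Obj C" using assms by auto
  interpret H: module K "Hom C G X" using X by (intro hom_module G_obj)
  have "\<exists>e :: 'd \<Rightarrow> nat \<Rightarrow> 'a. inj_on e (mor C G X)"
    by (rule H.ex_coordinates[OF hom_finite_dimensional[OF G_obj X]])
  then have "inj_on (enc X) (mor C G X)" unfolding enc_def by (rule someI_ex)
  then show ?thesis unfolding dec_def using assms by (intro inv_into_f_f) simp_all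
qed

text \<open>The multiplication is opposite to composition, so that precomposition is a left action on \<open>Hom(G, X)\<close>.\<close>

definition alg :: "('a, nat \<Rightarrow> 'a) module" where
  "alg = \<lparr> carrier = enc G ` mor C G G, monoid.mult = (\<lambda>x y. enc G (dec G y \<bullet> dec G x)), one = enc G (Ident C G),
     ring.zero = enc G \<zero>\<^bsub>Hom C G G\<^esub>, ring.add = (\<lambda>x y. enc G (dec G x \<oplus>\<^bsub>Hom C G G\<^esub> dec G y)),
     smult = (\<lambda>c x. enc G (c \<odot>\<^bsub>Hom C G G\<^esub> dec G x)) \<rparr>"

definition hom_obj :: "'c \<Rightarrow> (nat \<Rightarrow> 'a, nat \<Rightarrow> 'a) module" where
  "hom_obj X = \<lparr> carrier = enc X ` mor C G X, monoid.mult = undefined, one = undefined,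
     ring.zero = enc X \<zero>\<^bsub>Hom C G X\<^esub>, ring.add = (\<lambda>x y. enc X (dec X x \<oplus>\<^bsub>Hom C G X\<^esub> dec X y)),
     smult = (\<lambda>a x. enc X (dec X x \<bullet> dec G a)) \<rparr>"

definition hom_mor :: "'d \<Rightarrow> (nat \<Rightarrow> 'a, nat \<Rightarrow> 'a) module_mor" where
  "hom_mor f = (hom_obj (src f), \<lambda>v \<in> carrier (hom_obj (src f)). enc (tgt f) (f \<bullet> dec (src f) v), hom_obj (tgt f))"

lemma carrier_alg: "x \<in> carrier alg \<longleftrightarrow> (\<exists>a. in_hom a G G \<and> x = enc G a)"
  unfolding alg_def using mor_iff[of G G] by auto

lemma carrier_hom_obj: "X \<in> Obj C \<Longrightarrow> x \<in> carrier (hom_obj X) \<longleftrightarrow> (\<exists>u. in_hom u G X \<and> x = enc X u)"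
  unfolding hom_obj_def using mor_iff[of G X] by auto

lemma algE:
  assumes "x \<in> carrier alg"
  obtains a where "arr a" "src a = G" "tgt a = G" "x = enc G a"
  using assms unfolding carrier_alg by blast

lemma hom_objE:
  assumes "x \<in> carrier (hom_obj X)" "X \<in> Obj C"
  obtains u where "arr u" "src u = G" "tgt u = X" "x = enc X u"
  using assms(1) unfolding carrier_hom_obj[OF assms(2)] by blast

lemma alg_ops [simp]:
  assumes "arr a" "src a = G" "tgt a = G"
  shows "enc G a \<in> carrier alg" "c \<odot>\<^bsub>alg\<^esub> enc G a = enc G (c \<odot>\<^bsub>Hom C G G\<^esub> a)"
    "\<lbrakk> arr b; src b = G; tgt b = G \<rbrakk> \<Longrightarrow> enc G a \<otimes>\<^bsub>alg\<^esub> enc G b = enc G (b \<bullet> a)"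
    "\<lbrakk> arr b; src b = G; tgt b = G \<rbrakk> \<Longrightarrow> enc G a \<oplus>\<^bsub>alg\<^esub> enc G b = enc G (a \<oplus>\<^bsub>Hom C G G\<^esub> b)"
  using assms by (simp_all add: alg_def)

lemma alg_consts: "\<one>\<^bsub>alg\<^esub> = enc G (Ident C G)" "\<zero>\<^bsub>alg\<^esub> = enc G \<zero>\<^bsub>Hom C G G\<^esub>"
  by (simp_all add: alg_def)

lemma hom_obj_ops [simp]:
  assumes "arr u" "src u = G" "tgt u = X"
  shows "enc X u \<in> carrier (hom_obj X)"
    "\<lbrakk> arr a; src a = G; tgt a = G \<rbrakk> \<Longrightarrow> enc G a \<odot>\<^bsub>hom_obj X\<^esub> enc X u = enc X (u \<bullet> a)"
    "\<lbrakk> arr v; src v = G; tgt v = X \<rbrakk> \<Longrightarrow> enc X u \<oplus>\<^bsub>hom_obj X\<^esub> enc X v = enc X (u \<oplus>\<^bsub>Hom C G X\<^esub> v)"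
  using assms by (simp_all add: hom_obj_def)

lemma abelian_group_alg: "abelian_group alg"
proof (rule abelian_group_transport[OF hom_abelian_group[OF G_obj G_obj], of _ "enc G"])
  show "carrier alg = enc G ` mor C G G" "\<zero>\<^bsub>alg\<^esub> = enc G \<zero>\<^bsub>Hom C G G\<^esub>" by (simp_all add: alg_def)
  show "enc G u \<oplus>\<^bsub>alg\<^esub> enc G v = enc G (u \<oplus>\<^bsub>Hom C G G\<^esub> v)" if "u \<in> mor C G G" "v \<in> mor C G G" for u v
    using that by (simp add: mor_iff)
qed

lemma ring_alg: "ring alg"
proof (rule ringI[OF abelian_group_alg])
  show "monoid alg"
    by (rule monoidI) (erule algE | simp add: alg_consts)+
qed (erule algE | simp add: add_comp comp_add)+

lemma module_alg: "module K alg"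
proof (rule moduleI[OF is_cring abelian_group_alg])
  interpret H: module K "Hom C G G" by (intro hom_module G_obj)
  have mor: "u \<in> mor C G G" if "in_hom u G G" for u using that by simp
  show "c \<odot>\<^bsub>alg\<^esub> x \<in> carrier alg" if "c \<in> carrier K" "x \<in> carrier alg" for c x
    using that by (elim algE) (simp)
  show "(c \<oplus>\<^bsub>K\<^esub> d) \<odot>\<^bsub>alg\<^esub> x = c \<odot>\<^bsub>alg\<^esub> x \<oplus>\<^bsub>alg\<^esub> d \<odot>\<^bsub>alg\<^esub> x"
    if "c \<in> carrier K" "d \<in> carrier K" "x \<in> carrier alg" for c d x
    using that by (elim algE) (simp add: H.smult_l_distr mor)
  show "c \<odot>\<^bsub>alg\<^esub> (x \<oplus>\<^bsub>alg\<^esub> y) = c \<odot>\<^bsub>alg\<^esub> x \<oplus>\<^bsub>alg\<^esub> c \<odot>\<^bsub>alg\<^esub> y"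
    if "c \<in> carrier K" "x \<in> carrier alg" "y \<in> carrier alg" for c x y
    using that by (elim algE) (simp add: H.smult_r_distr mor)
  show "(c \<otimes>\<^bsub>K\<^esub> d) \<odot>\<^bsub>alg\<^esub> x = c \<odot>\<^bsub>alg\<^esub> (d \<odot>\<^bsub>alg\<^esub> x)"
    if "c \<in> carrier K" "d \<in> carrier K" "x \<in> carrier alg" for c d x
    using that by (elim algE) (simp add: H.smult_assoc1 mor)
  show "\<one>\<^bsub>K\<^esub> \<odot>\<^bsub>alg\<^esub> x = x" if "x \<in> carrier alg" for x
    using that by (elim algE) (simp add: H.smult_one mor)
qed

lemma associative_algebra_alg: "associative_algebra K alg"
proof (intro associative_algebra.intro module_alg ring_alg associative_algebra_axioms.intro)
  fix c x y assume "c \<in> carrier K" "x \<in> carrier alg" "y \<in> carrier alg"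
  then show "(c \<odot>\<^bsub>alg\<^esub> x) \<otimes>\<^bsub>alg\<^esub> y = c \<odot>\<^bsub>alg\<^esub> (x \<otimes>\<^bsub>alg\<^esub> y)" "x \<otimes>\<^bsub>alg\<^esub> (c \<odot>\<^bsub>alg\<^esub> y) = c \<odot>\<^bsub>alg\<^esub> (x \<otimes>\<^bsub>alg\<^esub> y)"
    by (elim algE, simp add: smult_comp comp_smult)+
qed

sublocale A: associative_algebra K alg
  by (rule associative_algebra_alg)

lemma finite_dimensional_alg: "finite_dimensional K alg"
proof (rule finite_dimensional_transport[OF hom_module[OF G_obj G_obj] module_alg hom_finite_dimensional[OF G_obj G_obj], of "enc G"])
  show "carrier alg = enc G ` mor C G G" "enc G \<zero>\<^bsub>Hom C G G\<^esub> = \<zero>\<^bsub>alg\<^esub>" by (simp_all add: alg_def)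
qed (simp_all add: mor_iff)

lemma frobenius_alg:
  assumes t: "linear_form K (Hom C G G) t"
    and nd1: "\<And>a. \<lbrakk> in_hom a G G; \<And>b. in_hom b G G \<Longrightarrow> t (a \<bullet> b) = \<zero>\<^bsub>K\<^esub> \<rbrakk> \<Longrightarrow> a = \<zero>\<^bsub>Hom C G G\<^esub>"
    and nd2: "\<And>a. \<lbrakk> in_hom a G G; \<And>b. in_hom b G G \<Longrightarrow> t (b \<bullet> a) = \<zero>\<^bsub>K\<^esub> \<rbrakk> \<Longrightarrow> a = \<zero>\<^bsub>Hom C G G\<^esub>"
  shows "frobenius_algebra K alg"
proof (intro frobenius_algebra.intro associative_algebra_alg frobenius_algebra_axioms.intro finite_dimensional_alg)
  let ?t = "\<lambda>x. t (dec G x)"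
  have "linear_form K alg ?t"
    using t unfolding linear_form_def
    by (intro conjI ballI funcsetI) (elim conjE algE, simp add: Pi_iff)+
  moreover have "x = \<zero>\<^bsub>alg\<^esub>" if x: "x \<in> carrier alg" and z: "\<forall>y \<in> carrier alg. ?t (x \<otimes>\<^bsub>alg\<^esub> y) = \<zero>\<^bsub>K\<^esub>" for x
  proof -
    obtain a where a: "in_hom a G G" "x = enc G a" using x unfolding carrier_alg by blast
    have "t (b \<bullet> a) = \<zero>\<^bsub>K\<^esub>" if "in_hom b G G" for b
      using bspec[OF z, of "enc G b"] that a by simp
    then show ?thesis using nd2[OF a(1)] a(2) by (simp add: alg_consts)
  qed
  moreover have "y = \<zero>\<^bsub>alg\<^esub>" if y: "y \<in> carrier alg" and z: "\<forall>x \<in> carrier alg. ?t (x \<otimes>\<^bsub>alg\<^esub> y) = \<zero>\<^bsub>K\<^esub>" for y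
  proof -
    obtain a where a: "in_hom a G G" "y = enc G a" using y unfolding carrier_alg by blast
    have "t (a \<bullet> b) = \<zero>\<^bsub>K\<^esub>" if "in_hom b G G" for b
      using bspec[OF z, of "enc G b"] that a by simp
    then show ?thesis using nd1[OF a(1)] a(2) by (simp add: alg_consts)
  qed
  ultimately show "\<exists>t. linear_form K alg t \<and>
         (\<forall>a \<in> carrier alg. (\<forall>b \<in> carrier alg. t (a \<otimes>\<^bsub>alg\<^esub> b) = \<zero>\<^bsub>K\<^esub>) \<longrightarrow> a = \<zero>\<^bsub>alg\<^esub>) \<and>
         (\<forall>b \<in> carrier alg. (\<forall>a \<in> carrier alg. t (a \<otimes>\<^bsub>alg\<^esub> b) = \<zero>\<^bsub>K\<^esub>) \<longrightarrow> b = \<zero>\<^bsub>alg\<^esub>)"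
    by (intro exI[of _ ?t] conjI ballI impI)
qed

lemma left_module_hom_obj:
  assumes X: "X \<in> Obj C"
  shows "left_module alg (hom_obj X)"
proof (intro left_module.intro ring_alg left_module_axioms.intro)
  show "abelian_group (hom_obj X)"
  proof (rule abelian_group_transport[OF hom_abelian_group[OF G_obj X], of _ "enc X"])
    show "carrier (hom_obj X) = enc X ` mor C G X" "\<zero>\<^bsub>hom_obj X\<^esub> = enc X \<zero>\<^bsub>Hom C G X\<^esub>" by (simp_all add: hom_obj_def)
    show "enc X u \<oplus>\<^bsub>hom_obj X\<^esub> enc X v = enc X (u \<oplus>\<^bsub>Hom C G X\<^esub> v)" if "u \<in> mor C G X" "v \<in> mor C G X" for u v
      using that X by (simp add: mor_iff)
  qed
qed (erule algE | erule hom_objE[OF _ X] | simp add: alg_consts add_comp comp_add)+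

lemma hom_obj_in_fd_modules:
  assumes X: "X \<in> Obj C"
  shows "hom_obj X \<in> Obj (fd_modules K alg)"
proof -
  note L = left_module_hom_obj[OF X]
  have "finite_dimensional K (restrict_scalars alg (hom_obj X))"
  proof (rule finite_dimensional_transport[OF hom_module[OF G_obj X] A.module_restrict_scalars[OF L] hom_finite_dimensional[OF G_obj X], of "enc X"])
    show "carrier (restrict_scalars alg (hom_obj X)) = enc X ` mor C G X"
      "enc X \<zero>\<^bsub>Hom C G X\<^esub> = \<zero>\<^bsub>restrict_scalars alg (hom_obj X)\<^esub>" by (simp_all add: hom_obj_def)
  qed (use X in \<open>simp_all add: mor_iff alg_consts comp_smult\<close>)
  then show ?thesis using L by (simp add: fd_modules_simps)
qed

lemma hom_mor_in_mor:
  assumes f: "in_hom f X Y"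
  shows "hom_mor f \<in> mor (fd_modules K alg) (hom_obj X) (hom_obj Y)"
proof -
  have X: "X \<in> Obj C" using f by auto
  have "(\<lambda>v \<in> carrier (hom_obj X). enc Y (f \<bullet> dec X v)) \<in> module_maps alg (hom_obj X) (hom_obj Y)"
    by (rule module_mapsI) (erule algE | erule hom_objE[OF _ X] | use f in \<open>simp add: comp_add\<close>)+
  then show ?thesis using f by (simp add: fd_modules_simps hom_mor_def)
qed

lemma hom_mor_eqI:
  assumes "in_hom f X Y" "\<And>u. in_hom u G X \<Longrightarrow> enc Y (f \<bullet> u) = \<phi> (enc X u)" "\<phi> \<in> extensional (carrier (hom_obj X))"
  shows "hom_mor f = (hom_obj X, \<phi>, hom_obj Y)"
proof -
  have X: "X \<in> Obj C" using assms by auto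
  have "(\<lambda>v \<in> carrier (hom_obj X). enc Y (f \<bullet> dec X v)) = \<phi>"
    by (rule extensionalityI[OF _ assms(3)]) (erule hom_objE[OF _ X] | use assms(1,2) in simp)+
  then show ?thesis using assms(1) by (simp add: hom_mor_def)
qed

lemma linear_functor_hom: "linear_functor K C (fd_modules K alg) hom_obj hom_mor"
  unfolding linear_functor_def
proof (intro conjI ballI)
  fix X assume X: "X \<in> Obj C"
  show "hom_obj X \<in> Obj (fd_modules K alg)" by (rule hom_obj_in_fd_modules[OF X])
  show "hom_mor (Ident C X) = Ident (fd_modules K alg) (hom_obj X)"
    unfolding fd_modules_simps by (rule hom_mor_eqI) (use X in simp_all)
  fix Y assume Y: "Y \<in> Obj C"
  show "hom_mor f \<in> mor (fd_modules K alg) (hom_obj X) (hom_obj Y)" if "f \<in> mor C X Y" for f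
    using that X Y by (intro hom_mor_in_mor) (simp add: mor_iff)
  show "hom_mor (g \<bullet> f) = hom_mor g \<bullet>\<^bsub>fd_modules K alg\<^esub> hom_mor f"
    if Z: "Z \<in> Obj C" and "f \<in> mor C X Y" "g \<in> mor C Y Z" for Z f g
  proof -
    have fg: "in_hom f X Y" "in_hom g Y Z" using that X Y by (simp_all add: mor_iff)
    then show ?thesis
      unfolding hom_mor_def[of f] hom_mor_def[of g] fd_modules_simps
      using X by (simp, intro hom_mor_eqI) (simp_all add: compose_def)
  qed
  show "hom_mor (f \<oplus>\<^bsub>Hom C X Y\<^esub> g) = hom_mor f \<oplus>\<^bsub>Hom (fd_modules K alg) (hom_obj X) (hom_obj Y)\<^esub> hom_mor g"
    if "f \<in> mor C X Y" "g \<in> mor C X Y" for f g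
  proof -
    have fg: "in_hom f X Y" "in_hom g X Y" using that X Y by (simp_all add: mor_iff)
    then show ?thesis
      unfolding hom_mor_def[of f] hom_mor_def[of g] Hom_fd_modules module_hom_space_simps
      by (intro hom_mor_eqI) (simp_all add: add_comp)
  qed
  show "hom_mor (c \<odot>\<^bsub>Hom C X Y\<^esub> f) = c \<odot>\<^bsub>Hom (fd_modules K alg) (hom_obj X) (hom_obj Y)\<^esub> hom_mor f"
    if c: "c \<in> carrier K" and "f \<in> mor C X Y" for c f
  proof -
    have f: "in_hom f X Y" using that X Y by (simp add: mor_iff)
    then show ?thesis
      unfolding hom_mor_def[of f] Hom_fd_modules module_hom_space_simps
      using c by (intro hom_mor_eqI) (simp_all add: smult_comp comp_smult alg_consts)
  qed
qed

lemma hom_faithful: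
  assumes f: "in_hom f X Y" and g: "in_hom g X Y" and eq: "hom_mor f = hom_mor g"
  shows "f = g"
proof -
  have X: "X \<in> Obj C" and Y: "Y \<in> Obj C" using f by auto
  have eq': "f \<bullet> u = g \<bullet> u" if u: "in_hom u G X" for u
  proof -
    have "fst (snd (hom_mor f)) (enc X u) = fst (snd (hom_mor g)) (enc X u)" using eq by simp
    then have "enc Y (f \<bullet> u) = enc Y (g \<bullet> u)" using f g u by (simp add: hom_mor_def)
    then have "dec Y (enc Y (f \<bullet> u)) = dec Y (enc Y (g \<bullet> u))" by simp
    then show ?thesis using f g u by simp
  qed
  let ?d = "f \<ominus>\<^bsub>Hom C X Y\<^esub> g"
  have d: "in_hom ?d X Y" using f g by simp
  have "?d = \<zero>\<^bsub>Hom C (src ?d) (tgt ?d)\<^esub>"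
  proof (rule generator_faithful)
    fix u assume "in_hom u G (src ?d)"
    then have u: "in_hom u G X" using d by simp
    have "?d \<bullet> u = (f \<bullet> u) \<ominus>\<^bsub>Hom C G Y\<^esub> (g \<bullet> u)" using f g u by (simp add: sub_comp)
    also have "\<dots> = \<zero>\<^bsub>Hom C G Y\<^esub>" unfolding eq'[OF u] using g u by (subst sub_eq_zero_iff) simp_all
    finally show "?d \<bullet> u = \<zero>\<^bsub>Hom C G (tgt ?d)\<^esub>" using d by simp
  qed (use d in simp)
  then have "?d = \<zero>\<^bsub>Hom C X Y\<^esub>" using d by simp
  then show ?thesis by (rule iffD1[OF sub_eq_zero_iff, rotated -1]) (use f g in simp_all)
qed

lemma hom_full:
  assumes X: "X \<in> Obj C" and Y: "Y \<in> Obj C" and h: "h \<in> mor (fd_modules K alg) (hom_obj X) (hom_obj Y)"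
  shows "\<exists>f \<in> mor C X Y. hom_mor f = h"
proof -
  obtain \<phi> where \<phi>: "\<phi> \<in> module_maps alg (hom_obj X) (hom_obj Y)" "h = (hom_obj X, \<phi>, hom_obj Y)"
    using h by (auto simp: fd_modules_simps)
  note \<phi>D = module_mapsD[OF \<phi>(1)]
  let ?g = "\<lambda>u. dec Y (\<phi> (enc X u))"
  have g: "in_hom (?g u) G Y \<and> enc Y (?g u) = \<phi> (enc X u)" if "in_hom u G X" for u
  proof -
    have "\<phi> (enc X u) \<in> carrier (hom_obj Y)" using that by (intro \<phi>D) simp
    then obtain w where "arr w" "src w = G" "tgt w = Y" "\<phi> (enc X u) = enc Y w" using hom_objE[OF _ Y] by blast
    then show ?thesis by simp
  qed
  have "\<exists>f. in_hom f X Y \<and> (\<forall>u. in_hom u G X \<longrightarrow> f \<bullet> u = ?g u)"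
  proof (rule generator_full[OF X Y])
    show "in_hom (?g u) G Y" if "in_hom u G X" for u using g[OF that] by blast
    show "?g (u \<oplus>\<^bsub>Hom C G X\<^esub> w) = ?g u \<oplus>\<^bsub>Hom C G Y\<^esub> ?g w" if uw: "in_hom u G X" "in_hom w G X" for u w
    proof -
      have "\<phi> (enc X (u \<oplus>\<^bsub>Hom C G X\<^esub> w)) = \<phi> (enc X u) \<oplus>\<^bsub>hom_obj Y\<^esub> \<phi> (enc X w)"
        using \<phi>D(3)[of "enc X u" "enc X w"] uw by simp
      also have "\<dots> = enc Y (?g u) \<oplus>\<^bsub>hom_obj Y\<^esub> enc Y (?g w)" using g[OF uw(1)] g[OF uw(2)] by simp
      also have "\<dots> = enc Y (?g u \<oplus>\<^bsub>Hom C G Y\<^esub> ?g w)" using g[OF uw(1)] g[OF uw(2)] by (intro hom_obj_ops) simp_all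
      finally show ?thesis using g[OF uw(1)] g[OF uw(2)] by simp
    qed
    show "?g (u \<bullet> a) = ?g u \<bullet> a" if u: "in_hom u G X" and a: "in_hom a G G" for u a
    proof -
      have "\<phi> (enc X (u \<bullet> a)) = enc G a \<odot>\<^bsub>hom_obj Y\<^esub> \<phi> (enc X u)"
        using \<phi>D(4)[of "enc G a" "enc X u"] u a by simp
      also have "\<dots> = enc G a \<odot>\<^bsub>hom_obj Y\<^esub> enc Y (?g u)" using g[OF u] by simp
      also have "\<dots> = enc Y (?g u \<bullet> a)" using g[OF u] a by (intro hom_obj_ops) simp_all
      finally show ?thesis using g[OF u] a by simp
    qed
  qed
  then obtain f where f: "in_hom f X Y" "\<And>u. in_hom u G X \<Longrightarrow> f \<bullet> u = ?g u" by blast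
  have "hom_mor f = h" unfolding \<phi>(2) by (rule hom_mor_eqI[OF f(1)]) (use f(2) g \<phi>D(2) in simp_all)
  then show ?thesis using f(1) by (intro bexI[of _ f]) simp_all
qed

text \<open>A finite-dimensional module has a finite presentation by free modules. Free modules are values of \<open>Hom(G, -)\<close> at
  copowers of \<open>G\<close>, and \<open>Hom(G, -)\<close> preserves the cokernel of the corresponding morphism between copowers.\<close>

lemma hom_dense:
  assumes M: "M \<in> Obj (fd_modules K alg)"
  shows "\<exists>X \<in> Obj C. isomorphic (fd_modules K alg) (hom_obj X) M"
proof -
  have LM: "left_module alg M" and fd: "finite_dimensional K (restrict_scalars alg M)" using M by (simp_all add: fd_modules_simps)
  interpret M: left_module alg M by (rule LM)
  interpret MK: module K "restrict_scalars alg M" by (rule A.module_restrict_scalars[OF LM])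
  obtain B where B: "finite B" "B \<subseteq> carrier M" "carrier M \<subseteq> lspan K (restrict_scalars alg M) B"
    using fd MK.finite_dimensional_iff_lspan by auto
  obtain S \<iota> \<pi> where "biproduct K C B (\<lambda>_. G) S \<iota> \<pi>" using ex_biproduct[OF B(1), of "\<lambda>_. G"] by auto
  then interpret B: biproduct K C B "\<lambda>_. G" S \<iota> \<pi> .
  have BM: "b \<in> carrier M" if "b \<in> B" for b using B(2) that by blast
  \<comment> \<open>\<open>Hom(G, S)\<close> is free on \<open>B\<close>, with basis \<open>\<iota>\<close>; \<open>\<theta>\<close> is the module map that sends the basis to the generators of \<open>M\<close>.\<close>
  define \<theta> where "\<theta> u = (\<Oplus>\<^bsub>M\<^esub>b \<in> B. enc G (\<pi> b \<bullet> u) \<odot>\<^bsub>M\<^esub> b)" for u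
  have tm: "enc G (\<pi> b \<bullet> u) \<odot>\<^bsub>M\<^esub> b \<in> carrier M" if "in_hom u G S" "b \<in> B" for u b
    using that BM by (intro M.act_closed) simp_all
  have \<theta>_cl: "\<theta> u \<in> carrier M" if "in_hom u G S" for u
    unfolding \<theta>_def using tm[OF that] by (intro M.M.finsum_closed) auto
  have \<theta>_add: "\<theta> (u \<oplus>\<^bsub>Hom C G S\<^esub> w) = \<theta> u \<oplus>\<^bsub>M\<^esub> \<theta> w" if uw: "in_hom u G S" "in_hom w G S" for u w
  proof -
    have "\<theta> (u \<oplus>\<^bsub>Hom C G S\<^esub> w) = (\<Oplus>\<^bsub>M\<^esub>b \<in> B. enc G (\<pi> b \<bullet> u) \<odot>\<^bsub>M\<^esub> b \<oplus>\<^bsub>M\<^esub> enc G (\<pi> b \<bullet> w) \<odot>\<^bsub>M\<^esub> b)"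
      unfolding \<theta>_def
    proof (rule M.M.finsum_cong')
      fix b assume b: "b \<in> B"
      have eq: "enc G (\<pi> b \<bullet> (u \<oplus>\<^bsub>Hom C G S\<^esub> w)) = enc G (\<pi> b \<bullet> u) \<oplus>\<^bsub>alg\<^esub> enc G (\<pi> b \<bullet> w)"
        using uw b by (simp add: comp_add)
      show "enc G (\<pi> b \<bullet> (u \<oplus>\<^bsub>Hom C G S\<^esub> w)) \<odot>\<^bsub>M\<^esub> b = enc G (\<pi> b \<bullet> u) \<odot>\<^bsub>M\<^esub> b \<oplus>\<^bsub>M\<^esub> enc G (\<pi> b \<bullet> w) \<odot>\<^bsub>M\<^esub> b"
        unfolding eq using uw b BM by (intro M.act_l_distr) simp_all
    qed (use tm[OF uw(1)] tm[OF uw(2)] in auto)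
    then show ?thesis unfolding \<theta>_def using tm[OF uw(1)] tm[OF uw(2)] by (simp add: M.M.finsum_addf Pi_iff)
  qed
  have \<theta>_act: "\<theta> (u \<bullet> a) = enc G a \<odot>\<^bsub>M\<^esub> \<theta> u" if u: "in_hom u G S" and a: "in_hom a G G" for u a
  proof -
    have "enc G a \<odot>\<^bsub>M\<^esub> \<theta> u = (\<Oplus>\<^bsub>M\<^esub>b \<in> B. enc G a \<odot>\<^bsub>M\<^esub> (enc G (\<pi> b \<bullet> u) \<odot>\<^bsub>M\<^esub> b))"
      unfolding \<theta>_def using a tm[OF u] by (intro M.act_finsum) simp_all
    also have "\<dots> = \<theta> (u \<bullet> a)"
      unfolding \<theta>_def
    proof (rule M.M.finsum_cong')
      fix b assume b: "b \<in> B"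
      have eq: "enc G (\<pi> b \<bullet> u \<bullet> a) = enc G a \<otimes>\<^bsub>alg\<^esub> enc G (\<pi> b \<bullet> u)" using u a b by simp
      show "enc G a \<odot>\<^bsub>M\<^esub> (enc G (\<pi> b \<bullet> u) \<odot>\<^bsub>M\<^esub> b) = enc G (\<pi> b \<bullet> u \<bullet> a) \<odot>\<^bsub>M\<^esub> b"
        unfolding eq using u a b BM by (intro M.act_assoc[symmetric]) simp_all
    qed (use tm[of "u \<bullet> a"] u a in auto)
    finally show ?thesis by simp
  qed
  have \<theta>_inj: "\<theta> (\<iota> b) = b" if b: "b \<in> B" for b
  proof -
    have "\<theta> (\<iota> b) = (\<Oplus>\<^bsub>M\<^esub>b' \<in> B. if b = b' then b' else \<zero>\<^bsub>M\<^esub>)"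
      unfolding \<theta>_def
    proof (rule M.M.finsum_cong')
      fix b' assume b': "b' \<in> B"
      show "enc G (\<pi> b' \<bullet> \<iota> b) \<odot>\<^bsub>M\<^esub> b' = (if b = b' then b' else \<zero>\<^bsub>M\<^esub>)"
      proof (cases "b = b'")
        case True
        then show ?thesis using b' B.proj_inj[OF b'] BM M.act_one[of b'] by (simp add: alg_consts)
      next
        case False
        then show ?thesis using b b' B.proj_inj_ne[OF b' b] BM M.zero_act[of b'] by (simp add: alg_consts)
      qed
    qed (use BM in auto)
    also have "\<dots> = b" by (rule M.M.add.finprod_singleton[OF b B(1), of "\<lambda>b. b"]) (use BM in auto)
    finally show ?thesis .
  qed
  have \<theta>_smult: "\<theta> (c \<odot>\<^bsub>Hom C G S\<^esub> u) = c \<odot>\<^bsub>restrict_scalars alg M\<^esub> \<theta> u" if c: "c \<in> carrier K" and u: "in_hom u G S" for c u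
  proof -
    let ?c = "c \<odot>\<^bsub>Hom C G G\<^esub> Ident C G"
    have "u \<bullet> ?c = c \<odot>\<^bsub>Hom C G S\<^esub> u" using c u by (simp add: comp_smult)
    then show ?thesis using \<theta>_act[OF u, of ?c] c by (simp add: alg_consts)
  qed
  have \<theta>_zero: "\<theta> \<zero>\<^bsub>Hom C G S\<^esub> = \<zero>\<^bsub>M\<^esub>"
  proof -
    have z: "in_hom \<zero>\<^bsub>Hom C G S\<^esub> G S" by simp
    show ?thesis using \<theta>_act[OF z, of "\<zero>\<^bsub>Hom C G G\<^esub>"] M.zero_act[OF \<theta>_cl[OF z]] by (simp add: alg_consts)
  qed
  have \<theta>_surj: "\<exists>u. in_hom u G S \<and> \<theta> u = v" if "v \<in> carrier M" for v
  proof -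
    let ?W = "{v. \<exists>u. in_hom u G S \<and> \<theta> u = v}"
    have "subspace K (restrict_scalars alg M) ?W"
    proof (rule subspaceI)
      show "?W \<subseteq> carrier (restrict_scalars alg M)" using \<theta>_cl by auto
      show "\<zero>\<^bsub>restrict_scalars alg M\<^esub> \<in> ?W" using \<theta>_zero by (intro CollectI exI[of _ "\<zero>\<^bsub>Hom C G S\<^esub>"]) simp
      fix x y assume "x \<in> ?W" "y \<in> ?W"
      then obtain u w where "in_hom u G S" "\<theta> u = x" "in_hom w G S" "\<theta> w = y" by blast
      then show "x \<oplus>\<^bsub>restrict_scalars alg M\<^esub> y \<in> ?W"
        by (intro CollectI exI[of _ "u \<oplus>\<^bsub>Hom C G S\<^esub> w"]) (simp add: \<theta>_add)
    next
      fix c x assume c: "c \<in> carrier K" and "x \<in> ?W"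
      then obtain u where u: "in_hom u G S" "\<theta> u = x" by blast
      then show "c \<odot>\<^bsub>restrict_scalars alg M\<^esub> x \<in> ?W"
        using \<theta>_smult[OF c u(1)] c by (intro CollectI exI[of _ "c \<odot>\<^bsub>Hom C G S\<^esub> u"]) simp
    qed
    moreover have "B \<subseteq> ?W" using \<theta>_inj B.inj_arr by blast
    ultimately have "v \<in> ?W" by (rule lspan_least) (use B(3) that in blast)
    then show ?thesis by blast
  qed
  interpret H: vspace K "Hom C G S" by (intro vspace_hom G_obj B.S_obj)
  \<comment> \<open>\<open>r\<close> covers the relations \<open>R\<close>, so its cokernel \<open>c\<close> represents the module \<open>M\<close>.\<close>
  define R where "R = {u. in_hom u G S \<and> \<theta> u = \<zero>\<^bsub>M\<^esub>}"
  have "subspace K (Hom C G S) R"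
  proof (rule subspaceI)
    show "R \<subseteq> mor C G S" by (auto simp: R_def)
    show "\<zero>\<^bsub>Hom C G S\<^esub> \<in> R" by (simp add: R_def \<theta>_zero)
    show "u \<oplus>\<^bsub>Hom C G S\<^esub> v \<in> R" if "u \<in> R" "v \<in> R" for u v using that by (simp add: R_def \<theta>_add)
    show "c \<odot>\<^bsub>Hom C G S\<^esub> u \<in> R" if c: "c \<in> carrier K" and "u \<in> R" for c u
      using \<open>u \<in> R\<close> c \<theta>_smult[OF c, of u] MK.smult_r_null[OF c] by (simp add: R_def)
  qed
  then obtain BR where BR: "finite BR" "BR \<subseteq> R" "R \<subseteq> lspan K (Hom C G S) BR"
    by (rule H.finite_dimensional_subspace[OF hom_finite_dimensional[OF G_obj B.S_obj]])
  have BRS: "BR \<subseteq> mor C G S" using BR(2) by (auto simp: R_def)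
  obtain T \<iota>' \<pi>' r where T: "biproduct K C BR (\<lambda>_. G) T \<iota>' \<pi>'" and r: "in_hom r T S" "\<And>x. x \<in> BR \<Longrightarrow> r \<bullet> \<iota>' x = x"
    by (rule ex_copower[OF BR(1) BRS B.S_obj]) (rule that)
  interpret T: biproduct K C BR "\<lambda>_. G" T \<iota>' \<pi>' by (rule T)
  obtain c where c: "coker_of c r" using ex_coker r(1) by blast
  note cD = coker_ofD[OF c]
  let ?X = "tgt c"
  have X: "?X \<in> Obj C" and c': "in_hom c S ?X" using cD r(1) by simp_all
  have \<theta>r: "\<theta> (r \<bullet> w) = \<zero>\<^bsub>M\<^esub>" if "in_hom w G T" for w
  proof (rule T.into_induct[OF that])
    show "\<theta> (r \<bullet> \<zero>\<^bsub>Hom C G T\<^esub>) = \<zero>\<^bsub>M\<^esub>" using r(1) \<theta>_zero by simp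
    show "\<theta> (r \<bullet> (x \<oplus>\<^bsub>Hom C G T\<^esub> y)) = \<zero>\<^bsub>M\<^esub>"
      if "in_hom x G T" "in_hom y G T" "\<theta> (r \<bullet> x) = \<zero>\<^bsub>M\<^esub>" "\<theta> (r \<bullet> y) = \<zero>\<^bsub>M\<^esub>" for x y
      using that r(1) by (simp add: comp_add \<theta>_add)
    fix x v assume x: "x \<in> BR" and v: "in_hom v G G"
    have xR: "in_hom x G S" "\<theta> x = \<zero>\<^bsub>M\<^esub>" using x BR(2) by (auto simp: R_def)
    have "r \<bullet> \<iota>' x \<bullet> v = x \<bullet> v" by (rule comp_reduce[OF r(2)[OF x]]) (use r(1) x v in simp_all)
    then show "\<theta> (r \<bullet> \<iota>' x \<bullet> v) = \<zero>\<^bsub>M\<^esub>" using \<theta>_act[OF xR(1) v] xR(2) v by simp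
  qed
  have cu_zero: "\<theta> u = \<zero>\<^bsub>M\<^esub>" if u: "in_hom u G S" and z: "c \<bullet> u = \<zero>\<^bsub>Hom C G ?X\<^esub>" for u
  proof -
    obtain w where "in_hom w G (src r)" "r \<bullet> w = u"
      by (rule projective_lift_coker[OF G_projective c, of u]) (use u z r(1) in simp_all)
    then show ?thesis using \<theta>r[of w] r(1) by simp
  qed
  have \<theta>_zero_c: "c \<bullet> u = \<zero>\<^bsub>Hom C G ?X\<^esub>" if u: "in_hom u G S" and z: "\<theta> u = \<zero>\<^bsub>M\<^esub>" for u
  proof -
    let ?N = "{u. in_hom u G S \<and> c \<bullet> u = \<zero>\<^bsub>Hom C G ?X\<^esub>}"
    have "subspace K (Hom C G S) ?N"
    proof (rule subspaceI)
      interpret HX: module K "Hom C G ?X" using X by (intro hom_module G_obj)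
      show "?N \<subseteq> mor C G S" by auto
      show "\<zero>\<^bsub>Hom C G S\<^esub> \<in> ?N" using c' by simp
      show "x \<oplus>\<^bsub>Hom C G S\<^esub> y \<in> ?N"
        if "x \<in> ?N" "y \<in> ?N" for x y
        using that c' by (simp add: comp_add)
      show "k \<odot>\<^bsub>Hom C G S\<^esub> x \<in> ?N"
        if "k \<in> carrier K" "x \<in> ?N" for k x
        using that c' by (simp add: comp_smult)
    qed
    moreover have "BR \<subseteq> ?N"
    proof
      fix x assume x: "x \<in> BR"
      then have xS: "in_hom x G S" using BR(2) by (auto simp: R_def)
      have "c \<bullet> r \<bullet> \<iota>' x = \<zero>\<^bsub>Hom C (src r) (tgt c)\<^esub> \<bullet> \<iota>' x"
        by (rule comp_reduce[OF cD(5)]) (use cD r(1) x in simp_all)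
      then have "c \<bullet> x = \<zero>\<^bsub>Hom C G ?X\<^esub>" using r x X by simp
      then show "x \<in> ?N" using xS by simp
    qed
    ultimately have "u \<in> ?N"
      by (rule lspan_least) (use BR(3) u z in \<open>auto simp: R_def\<close>)
    then show ?thesis by simp
  qed
  have c_eq: "c \<bullet> u = c \<bullet> w \<longleftrightarrow> \<theta> u = \<theta> w" if uw: "in_hom u G S" "in_hom w G S" for u w
  proof -
    let ?d = "u \<oplus>\<^bsub>Hom C G S\<^esub> (\<ominus>\<^bsub>Hom C G S\<^esub> w)"
    have d: "in_hom ?d G S" using uw by simp
    have u: "u = ?d \<oplus>\<^bsub>Hom C G S\<^esub> w" using uw H.M.a_assoc[of u "\<ominus>\<^bsub>Hom C G S\<^esub> w" w] H.M.l_neg[of w] H.M.r_zero[of u] by simp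
    have 1: "\<theta> u = \<theta> ?d \<oplus>\<^bsub>M\<^esub> \<theta> w" using \<theta>_add[OF d uw(2)] u by simp
    have 2: "c \<bullet> ?d = (c \<bullet> u) \<ominus>\<^bsub>Hom C G ?X\<^esub> (c \<bullet> w)" using uw c' by (simp add: a_minus_def comp_add comp_neg)
    have 3: "c \<bullet> ?d = \<zero>\<^bsub>Hom C G ?X\<^esub> \<longleftrightarrow> c \<bullet> u = c \<bullet> w" unfolding 2 by (rule sub_eq_zero_iff) (use uw c' in simp_all)
    have 4: "\<theta> ?d = \<zero>\<^bsub>M\<^esub> \<longleftrightarrow> \<theta> u = \<theta> w"
      unfolding 1 using M.M.add.r_cancel_one[OF \<theta>_cl[OF uw(2)] \<theta>_cl[OF d]] by simp
    show ?thesis using 3 4 cu_zero[OF d] \<theta>_zero_c[OF d] by blast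
  qed
  have lift: "\<exists>u. in_hom u G S \<and> c \<bullet> u = x" if x: "in_hom x G ?X" for x
  proof -
    obtain u where "in_hom u G (src c)" "c \<bullet> u = x"
      by (rule projective_lift[OF G_projective cD(1), of x]) (use x in simp_all)
    then show ?thesis using c' by auto
  qed
  define \<phi> where "\<phi> = (\<lambda>v \<in> carrier (hom_obj ?X). \<theta> (SOME u. in_hom u G S \<and> c \<bullet> u = dec ?X v))"
  have \<phi>: "\<phi> (enc ?X (c \<bullet> u)) = \<theta> u" if u: "in_hom u G S" for u
  proof -
    have x: "in_hom (c \<bullet> u) G ?X" using u c' by simp
    let ?w = "SOME w. in_hom w G S \<and> c \<bullet> w = c \<bullet> u"
    have "in_hom ?w G S \<and> c \<bullet> ?w = c \<bullet> u" by (rule someI[of _ u]) (use u in simp)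
    then have "\<theta> ?w = \<theta> u" using c_eq u by blast
    then show ?thesis using x by (simp add: \<phi>_def)
  qed
  have elem: "\<exists>u. in_hom u G S \<and> v = enc ?X (c \<bullet> u)" if v: "v \<in> carrier (hom_obj ?X)" for v
  proof -
    obtain x where "in_hom x G ?X" "v = enc ?X x" using v X unfolding carrier_hom_obj[OF X] by blast
    then show ?thesis using lift by blast
  qed
  have map: "\<phi> \<in> module_maps alg (hom_obj ?X) M"
  proof (rule module_mapsI)
    show "\<phi> \<in> extensional (carrier (hom_obj ?X))" by (simp add: \<phi>_def)
    fix x assume "x \<in> carrier (hom_obj ?X)"
    then obtain u where u: "in_hom u G S" "x = enc ?X (c \<bullet> u)" using elem by blast
    show "\<phi> x \<in> carrier M" using \<phi>[OF u(1)] u \<theta>_cl by simp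
    show "\<phi> (a \<odot>\<^bsub>hom_obj ?X\<^esub> x) = a \<odot>\<^bsub>M\<^esub> \<phi> x" if a: "a \<in> carrier alg" for a
    proof -
      obtain b where b: "in_hom b G G" "a = enc G b" using a unfolding carrier_alg by blast
      have "a \<odot>\<^bsub>hom_obj ?X\<^esub> x = enc ?X (c \<bullet> u \<bullet> b)" using u b c' by simp
      then show ?thesis using \<phi>[of "u \<bullet> b"] \<phi>[OF u(1)] \<theta>_act[OF u(1) b(1)] u b by simp
    qed
    fix y assume "y \<in> carrier (hom_obj ?X)"
    then obtain w where w: "in_hom w G S" "y = enc ?X (c \<bullet> w)" using elem by blast
    have "x \<oplus>\<^bsub>hom_obj ?X\<^esub> y = enc ?X (c \<bullet> (u \<oplus>\<^bsub>Hom C G S\<^esub> w))" using u w c' by (simp add: comp_add)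
    then show "\<phi> (x \<oplus>\<^bsub>hom_obj ?X\<^esub> y) = \<phi> x \<oplus>\<^bsub>M\<^esub> \<phi> y"
      using \<phi>[of "u \<oplus>\<^bsub>Hom C G S\<^esub> w"] \<phi>[OF u(1)] \<phi>[OF w(1)] \<theta>_add[OF u(1) w(1)] u w by simp
  qed
  have "inj_on \<phi> (carrier (hom_obj ?X))"
  proof (rule inj_onI)
    fix x y assume "x \<in> carrier (hom_obj ?X)" "y \<in> carrier (hom_obj ?X)" and eq: "\<phi> x = \<phi> y"
    then obtain u w where u: "in_hom u G S" "x = enc ?X (c \<bullet> u)" and w: "in_hom w G S" "y = enc ?X (c \<bullet> w)"
      using elem by meson
    show "x = y" using eq \<phi>[OF u(1)] \<phi>[OF w(1)] c_eq[OF u(1) w(1)] u w by simp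
  qed
  moreover have "\<phi> ` carrier (hom_obj ?X) = carrier M"
  proof
    show "\<phi> ` carrier (hom_obj ?X) \<subseteq> carrier M" using module_mapsD(1)[OF map] by blast
    show "carrier M \<subseteq> \<phi> ` carrier (hom_obj ?X)"
    proof
      fix v assume "v \<in> carrier M"
      then obtain u where u: "in_hom u G S" "\<theta> u = v" using \<theta>_surj by blast
      have "enc ?X (c \<bullet> u) \<in> carrier (hom_obj ?X)" using u(1) c' by simp
      then show "v \<in> \<phi> ` carrier (hom_obj ?X)" using \<phi>[OF u(1)] u(2) by (metis imageI)
    qed
  qed
  ultimately have "bij_betw \<phi> (carrier (hom_obj ?X)) (carrier M)" by (simp add: bij_betw_def)
  then have "is_iso (fd_modules K alg) (hom_obj ?X) M (hom_obj ?X, \<phi>, M)"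
    by (rule bijective_module_map_is_iso[OF left_module_hom_obj[OF X] map])
  then show ?thesis using X unfolding isomorphic_def by blast
qed

theorem linearly_equivalent_fd_modules:
  "linearly_equivalent K C (fd_modules K alg :: ('a, (nat \<Rightarrow> 'a, nat \<Rightarrow> 'a) module, (nat \<Rightarrow> 'a, nat \<Rightarrow> 'a) module_mor) lincat)"
proof (rule linearly_equivalentI[OF _ _ linear_functor_hom])
  show "linear_category K C" by unfold_locales
  show "linear_category K (fd_modules K alg :: ('a, (nat \<Rightarrow> 'a, nat \<Rightarrow> 'a) module, (nat \<Rightarrow> 'a, nat \<Rightarrow> 'a) module_mor) lincat)"
    by (rule A.linear_category_fd_modules[OF field_axioms])
  show "f = g" if "X \<in> Obj C" "Y \<in> Obj C" "f \<in> mor C X Y" "g \<in> mor C X Y" "hom_mor f = hom_mor g" for X Y f g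
    using that by (intro hom_faithful[of f X Y g]) (simp_all add: mor_iff)
qed (rule hom_full hom_dense; assumption)+

end

section \<open>Finite tensor categories and Frobenius algebras\<close>

theorem mainTheorem7:
  fixes K :: "('k, 'r) ring_scheme" and C :: "('k, 'o, 'm, 'z) pivcat_scheme"
  assumes "algebraically_closed K"
    and "pivotal_finite_tensor_category K C"
  shows "\<exists>A :: ('k, nat \<Rightarrow> 'k) module. frobenius_algebra K A \<and>
           linearly_equivalent K C
             (fd_modules K A :: ('k, (nat \<Rightarrow> 'k, nat \<Rightarrow> 'k) module, (nat \<Rightarrow> 'k, nat \<Rightarrow> 'k) module_mor) lincat)"
proof -
  interpret pivotal_finite_tensor_category K C by (rule assms(2))
  obtain G t where G: "is_projective C G"
    "\<And>X. \<lbrakk> X \<in> Obj C; Ident C X \<noteq> \<zero>\<^bsub>Hom C X X\<^esub> \<rbrakk> \<Longrightarrow> \<exists>g. in_hom g G X \<and> g \<noteq> \<zero>\<^bsub>Hom C G X\<^esub>"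
    and t: "linear_form K (Hom C G G) t"
    "\<And>a. \<lbrakk> in_hom a G G; \<And>b. in_hom b G G \<Longrightarrow> t (a \<bullet>\<^bsub>C\<^esub> b) = \<zero>\<^bsub>K\<^esub> \<rbrakk> \<Longrightarrow> a = \<zero>\<^bsub>Hom C G G\<^esub>"
    "\<And>a. \<lbrakk> in_hom a G G; \<And>b. in_hom b G G \<Longrightarrow> t (b \<bullet>\<^bsub>C\<^esub> a) = \<zero>\<^bsub>K\<^esub> \<rbrakk> \<Longrightarrow> a = \<zero>\<^bsub>Hom C G G\<^esub>"
    using ex_generator_with_form by blast
  interpret projective_generator K C G by unfold_locales (use G in blast)+
  show ?thesis using frobenius_alg[OF t] linearly_equivalent_fd_modules by blast
qed

end
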